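(* Let $s>0$ and $\beta>0$ be fixed, and for each positive integer $N$ let $\mathcal{D}(N)=\mathcal{D}_{s,\beta}(N)$ denote the diameter (in the graph metric) of the random graph $G_{s,\beta}(N)$, the long-range percolation graph on the cycle $\mathbb{Z}/N\mathbb{Z}$. (A) If $s>2$, then there is a constant $C=C_{s,\beta}>0$ such that $$\lim_{N\to\infty}\mathbf{P}(\mathcal{D}(N)<CN)=0.$$ Moreover, there exists a constant $\eta$ with $0<\eta\le 1$ such that $\mathcal{D}(N)/N\to\eta$ in distribution as $N\to\infty$. (B) If $s<1$, then there is a constant $C=C_{s,\beta}$ such that $$\lim_{N\to\infty}\mathbf{P}(\mathcal{D}(N)>C)=0.$$ (C) If $1<s<2$, then there is a constant $\delta=\delta_{s,\beta}$ such that $$\lim_{N\to\infty}\mathbf{P}\big(\mathcal{D}(N)>(\log N)^{\delta}\big)=0.$$ (D) If $1<s<2$, then there is a constant $C=C_{s,\beta}>0$ such that $$\lim_{N\to\infty}\mathbf{P}(\mathcal{D}(N)<C\log N)=0.$$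
   Context: For a positive integer $N$ and $s,\beta>0$, the random graph $G_{s,\beta}(N)$ is defined as follows. Its vertices are the elements of the cycle $\mathbb{Z}/N\mathbb{Z}$, represented by $0,1,\dots,N-1$. Put $\rho(x,y)=\min(|x-y|,\,N-|x-y|)$. If $\rho(x,y)=1$, then $x$ and $y$ are joined by an edge (with certainty). If $x\ne y$ and $\rho(x,y)\neq 1$, then $x$ and $y$ are joined by an edge with probability $1-\exp(-\beta\rho(x,y)^{-s})$. The presence or absence of different edges are independent events. *)

theory Defs
  imports "HOL-Probability.Probability"
begin

text \<open>The vertices of \<open>\<int>/N\<int>\<close> are represented by \<open>0, \<dots>, N - 1\<close>. The value is an integer
  so that no subtraction is truncated.\<close>

definition cycle_dist :: "nat \<Rightarrow> nat \<Rightarrow> nat \<Rightarrow> int" where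
  "cycle_dist N x y = min \<bar>int x - int y\<bar> (int N - \<bar>int x - int y\<bar>)"

definition edge_prob :: "real \<Rightarrow> real \<Rightarrow> nat \<Rightarrow> nat \<Rightarrow> nat \<Rightarrow> real" where
  "edge_prob s \<beta> N x y =
     (if cycle_dist N x y = 1 then 1
      else 1 - exp (- \<beta> * real_of_int (cycle_dist N x y) powr (- s)))"

text \<open>The law of the edge set of the random graph. An edge is a two-element set \<open>{x, y}\<close>; each
  unordered pair of distinct vertices is represented once, by its increasing enumeration, as an
  index of the family of independent Bernoulli variables.\<close>

definition lrp_graph :: "real \<Rightarrow> real \<Rightarrow> nat \<Rightarrow> nat set set pmf" where
  "lrp_graph s \<beta> N =
     map_pmf (\<lambda>\<omega>. {{x, y} | x y. x < y \<and> y < N \<and> \<omega> (x, y)})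
       (Pi_pmf {(x, y). x < y \<and> y < N} False
          (\<lambda>(x, y). bernoulli_pmf (edge_prob s \<beta> N x y)))"

definition adj :: "'a set set \<Rightarrow> ('a \<times> 'a) set" where
  "adj E = {(u, v). {u, v} \<in> E}"

text \<open>The relation \<open>adj E ^^ n\<close> relates the endpoints of walks of length \<open>n\<close>, so this is the length
  of a shortest path. It is meaningful only if \<open>x\<close> and \<open>y\<close> are connected, which the lemma
  \<open>lrp_graph_connected\<close> below shows for every outcome of positive probability.\<close>

definition graph_dist :: "'a set set \<Rightarrow> 'a \<Rightarrow> 'a \<Rightarrow> nat" where
  "graph_dist E x y = (LEAST n. (x, y) \<in> adj E ^^ n)"

text \<open>For finite nonempty \<open>V\<close>.\<close>

definition graph_diameter :: "'a set \<Rightarrow> 'a set set \<Rightarrow> nat" where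
  "graph_diameter V E = Max {graph_dist E x y | x y. x \<in> V \<and> y \<in> V}"

lemma edge_prob_bounds:
  assumes "\<beta> > 0"
  shows "0 \<le> edge_prob s \<beta> N x y" "edge_prob s \<beta> N x y \<le> 1"
  using assms by (auto simp: edge_prob_def)

lemma lrp_graph_cycle_edge:
  assumes E: "E \<in> set_pmf (lrp_graph s \<beta> N)" and "Suc x < N"
  shows "{x, Suc x} \<in> E"
proof -
  let ?A = "{(x, y). x < y \<and> y < N}"
  have "finite ?A"
    by (rule finite_subset[of _ "{..<N} \<times> {..<N}"]) auto
  then obtain \<omega> where
    \<omega>: "\<omega> \<in> PiE_dflt ?A False
      (\<lambda>e. set_pmf (bernoulli_pmf (edge_prob s \<beta> N (fst e) (snd e))))"
    and E_eq: "E = {{x, y} | x y. x < y \<and> y < N \<and> \<omega> (x, y)}"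
    using E by (auto simp: lrp_graph_def set_Pi_pmf comp_def case_prod_unfold)
  have "cycle_dist N x (Suc x) = 1"
    using assms(2) by (auto simp: cycle_dist_def)
  moreover have "set_pmf (bernoulli_pmf 1) = {True}"
  proof -
    have "b \<in> set_pmf (bernoulli_pmf 1) \<longleftrightarrow> b = True" for b
      by (cases b) (simp_all add: set_pmf_iff)
    then show ?thesis by blast
  qed
  ultimately have "set_pmf (bernoulli_pmf (edge_prob s \<beta> N x (Suc x))) = {True}"
    by (simp add: edge_prob_def)
  moreover have "\<omega> (x, Suc x) \<in> set_pmf (bernoulli_pmf (edge_prob s \<beta> N x (Suc x)))"
  proof -
    have "\<omega> e \<in> set_pmf (bernoulli_pmf (edge_prob s \<beta> N (fst e) (snd e)))" if "e \<in> ?A" for e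
      using \<omega> that unfolding PiE_dflt_def by blast
    from this[of "(x, Suc x)"] show ?thesis
      using assms(2) by simp
  qed
  ultimately have "\<omega> (x, Suc x)"
    by simp
  then show ?thesis
    using assms(2) E_eq by blast
qed

lemma lrp_graph_connected:
  assumes E: "E \<in> set_pmf (lrp_graph s \<beta> N)" and "x < N" "y < N"
  shows "\<exists>n. (x, y) \<in> adj E ^^ n"
proof -
  have reach: "(0, z) \<in> (adj E)\<^sup>*" if "z < N" for z
    using that
  proof (induction z)
    case (Suc z)
    then have "(z, Suc z) \<in> adj E"
      using lrp_graph_cycle_edge[OF E] by (simp add: adj_def)
    with Suc show ?case
      by (meson Suc_lessD rtrancl.rtrancl_into_rtrancl)
  qed simp
  have "sym (adj E)"
    by (auto simp: sym_def adj_def insert_commute)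
  then have "(x, y) \<in> (adj E)\<^sup>*"
    using reach[OF assms(2)] reach[OF assms(3)] by (meson rtrancl_trans symD sym_rtrancl)
  then show ?thesis
    by (simp add: rtrancl_power)
qed

end

theory Submission
  imports Defs "HOL-Real_Asymp.Real_Asymp"
begin

text \<open>
  (A) A bond \<open>{i, i + 1}\<close> of a segment of length \<open>n\<close> is crossed by no long edge with probability
  bounded below, because \<open>\<Sum> k * k powr (- s)\<close> converges; so the mean distance between the ends
  of the segment is at least linear in \<open>n\<close>. It is subadditive, hence asymptotic to \<open>\<gamma> n\<close>.
  Deleting an edge of length \<open>k\<close> changes distances by at most \<open>k\<close>, so by the Efron--Stein
  inequality the variance of the distance is at most \<open>\<beta> n (\<Sum>k\<le>n. k powr (2 - s)) = o(n\<^sup>2)\<close>, and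
  the distance concentrates. On the cycle, chains of segments bound the diameter from above by
  \<open>\<gamma> N / 2 + o(N)\<close>. Conversely a walk from \<open>0\<close> to \<open>N / 2\<close> must traverse one of the two arcs, once
  the edges joining the arcs are deleted; the total length of these is \<open>o(N)\<close> in the mean. So
  \<open>\<eta> = \<gamma> / 2\<close>.

  (B) By a union bound over pairs of vertex sets, balls grow by a factor \<open>N powr ((1 - s) / 2)\<close>
  until they contain more than half of the vertices, and then any two of them meet.

  (C) If \<open>s / 2 < g < 1\<close>, then with high probability any two points at distance
  \<open>R \<ge> (ln N) powr c\<close> have an edge between their neighbourhoods of radius \<open>R powr g\<close>. Applying this
  recursively to the two remaining gaps gives a path with polylogarithmically many steps.

  (D) Mean degrees are bounded by a constant \<open>M\<close>, so the expected number of simple paths of length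
  \<open>k\<close> from a given vertex is at most \<open>M ^ k\<close>.
\<close>

subsection \<open>Graph distance\<close>

text \<open>No random vertex set is ever conditioned on; this shapes the argument. In (B), a ball of
  radius \<open>j\<close> has no edge to the complement of the ball of radius \<open>j + 1\<close>;
  instead of exploring the graph, one excludes such a gap simultaneously for all deterministic
  nested pairs of sets. A ball \<open>A\<close> facing \<open>N / 2\<close> vertices expects at
  least about \<open>card A * N powr (1 - s)\<close> outgoing edges up to constants; half of the
  exponent \<open>1 - s\<close> pays for the logarithm of the union bound. In (A), true distances
  depend on the edges of the whole cycle. Distances inside a segment depend only on its own edges,
  which gives subadditivity and the same law on the line and on short arcs. The variance bound asks
  only that \<open>k powr (2 - s)\<close> tend to 0, since it enters through a Cesaro mean;
  summability would force \<open>s > 3\<close>. In (C), \<open>g > s / 2\<close> because two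
  neighbourhoods offer \<open>R powr (2 * g)\<close> pairs, each open with probability of order at
  least \<open>R powr (- s)\<close>. The cutoff \<open>(ln N) powr c\<close> makes a failure rare
  enough to beat the \<open>N\<^sup>2\<close> pairs of points; shorter gaps are walked along the
  cycle. In (D), a small diameter would require \<open>N\<close> open simple paths to a single
  vertex.\<close>

lemma sym_adj: "(x, y) \<in> adj E \<longleftrightarrow> (y, x) \<in> adj E"
  by (simp add: adj_def insert_commute)

lemma adj_relpow_sym: "(x, y) \<in> adj E ^^ n \<Longrightarrow> (y, x) \<in> adj E ^^ n"
proof (induction n arbitrary: y)
  case (Suc n)
  from Suc.prems obtain z where z: "(x, z) \<in> adj E ^^ n" "(z, y) \<in> adj E"
    by (rule relpow_Suc_E)
  have "(z, x) \<in> adj E ^^ n" "(y, z) \<in> adj E"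
    using z Suc.IH sym_adj[of z y E] by simp_all
  then show ?case
    by (intro relpow_Suc_I2)
qed auto

lemma adj_mono: "E \<subseteq> E' \<Longrightarrow> adj E \<subseteq> adj E'"
  by (auto simp: adj_def)

lemma adj_relpow_mono: "E \<subseteq> E' \<Longrightarrow> (x, y) \<in> adj E ^^ n \<Longrightarrow> (x, y) \<in> adj E' ^^ n"
proof (induction n arbitrary: y)
  case (Suc n)
  from Suc.prems(2) obtain z where "(x, z) \<in> adj E ^^ n" "(z, y) \<in> adj E"
    by (rule relpow_Suc_E)
  then show ?case
    using Suc.IH[OF Suc.prems(1)] adj_mono[OF Suc.prems(1)] by (intro relpow_Suc_I) auto
qed auto

definition reach :: "'a set set \<Rightarrow> 'a \<Rightarrow> 'a \<Rightarrow> bool" where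
  "reach E x y \<longleftrightarrow> (\<exists>n. (x, y) \<in> adj E ^^ n)"

lemma reachI: "(x, y) \<in> adj E ^^ n \<Longrightarrow> reach E x y"
  by (auto simp: reach_def)

lemma reach_refl [simp]: "reach E x x"
  by (rule reachI[where n = 0]) simp

lemma reach_sym: "reach E x y \<Longrightarrow> reach E y x"
  unfolding reach_def by (erule exE) (rule exI, erule adj_relpow_sym)

lemma reach_trans: "reach E x y \<Longrightarrow> reach E y z \<Longrightarrow> reach E x z"
  unfolding reach_def by (elim exE) (rule exI, erule (1) relpow_trans)

lemma reach_mono: "reach E x y \<Longrightarrow> E \<subseteq> E' \<Longrightarrow> reach E' x y"
  unfolding reach_def by (erule exE) (rule exI, erule (1) adj_relpow_mono)

lemma graph_dist_le: "(x, y) \<in> adj E ^^ n \<Longrightarrow> graph_dist E x y \<le> n"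
  by (simp add: graph_dist_def Least_le)

lemma graph_dist_walk: "reach E x y \<Longrightarrow> (x, y) \<in> adj E ^^ graph_dist E x y"
  unfolding reach_def graph_dist_def by (rule LeastI_ex)

lemma graph_dist_refl [simp]: "graph_dist E x x = 0"
  using graph_dist_le[where x = x and y = x and n = 0] by simp

lemma graph_dist_sym: "graph_dist E x y = graph_dist E y x"
proof -
  have "(x, y) \<in> adj E ^^ n \<longleftrightarrow> (y, x) \<in> adj E ^^ n" for n
    by (rule iffI) (erule adj_relpow_sym)+
  then show ?thesis
    by (simp add: graph_dist_def)
qed

lemma graph_dist_triangle:
  assumes "reach E x y" "reach E y z"
  shows "graph_dist E x z \<le> graph_dist E x y + graph_dist E y z"
  by (rule graph_dist_le[OF relpow_trans[OF graph_dist_walk[OF assms(1)] graph_dist_walk[OF assms(2)]]])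

lemma reach_adj: "(x, y) \<in> adj E \<Longrightarrow> reach E x y"
  by (rule reachI[where n = 1]) simp

lemma graph_dist_adj: "(x, y) \<in> adj E \<Longrightarrow> graph_dist E x y \<le> 1"
  by (rule graph_dist_le) simp

lemma graph_dist_mono: "reach E x y \<Longrightarrow> E \<subseteq> E' \<Longrightarrow> graph_dist E' x y \<le> graph_dist E x y"
  by (rule graph_dist_le[OF adj_relpow_mono[OF _ graph_dist_walk]])

lemma lipschitz_walk:
  fixes \<phi> :: "'a \<Rightarrow> real"
  assumes lip: "\<And>a b. (a, b) \<in> adj E \<Longrightarrow> \<phi> b \<le> \<phi> a + 1"
  shows "(x, y) \<in> adj E ^^ n \<Longrightarrow> \<phi> y \<le> \<phi> x + real n"
proof (induction n arbitrary: y)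
  case (Suc n)
  from Suc.prems obtain z where z: "(x, z) \<in> adj E ^^ n" "(z, y) \<in> adj E"
    by (rule relpow_Suc_E)
  from Suc.IH[OF z(1)] lip[OF z(2)] show ?case
    by simp
qed auto

text \<open>Telescoping along a shortest walk. Potentials that grow by at most 1 along each edge are
  the device for bounding distances from below: in comparing a graph with and without an edge, in
  counting uncrossed bonds, and in separating the two arcs.\<close>

lemma lipschitz_graph_dist:
  fixes \<phi> :: "'a \<Rightarrow> real"
  assumes "\<And>a b. (a, b) \<in> adj E \<Longrightarrow> \<phi> b \<le> \<phi> a + 1" "reach E x y"
  shows "\<phi> y - \<phi> x \<le> real (graph_dist E x y)"
  using lipschitz_walk[of E \<phi>, OF assms(1) graph_dist_walk[OF assms(2)]] by simp

text \<open>The potential \<open>\<psi>\<close> is the length of a shortest walk from \<open>x\<close> that uses \<open>{u, v}\<close> at most once,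
  in the direction from \<open>u\<close> to \<open>v\<close>, where \<open>u\<close> is the end closer to \<open>x\<close>.\<close>
lemma graph_dist_insert_aux:
  assumes "reach E x u" "reach E u v" "reach E x z"
    and l: "graph_dist E u v \<le> l" and le: "graph_dist E x u \<le> graph_dist E x v"
  shows "graph_dist E x z \<le> graph_dist (insert {u, v} E) x z + l"
proof -
  define \<phi> where "\<phi> w = graph_dist E x w" for w
  define \<psi> where "\<psi> w = (if reach E x w then real (min (\<phi> w) (\<phi> u + 1 + graph_dist E v w)) else 0)" for w
  have rv: "reach E x v"
    using reach_trans[OF assms(1,2)] .
  have lip: "\<psi> b \<le> \<psi> a + 1" if ab: "(a, b) \<in> adj (insert {u, v} E)" for a b
  proof -
    consider (old) "(a, b) \<in> adj E" | (uv) "a = u" "b = v" | (vu) "a = v" "b = u"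
      using ab unfolding adj_def by (auto simp: doubleton_eq_iff)
    then show ?thesis
    proof cases
      case old
      \<comment> \<open>No edge of \<open>E\<close> joins the component of \<open>x\<close> to its
        complement, so the default value 0 of \<open>\<psi>\<close> outside that component breaks no
        inequality.\<close>
      have iff: "reach E x a \<longleftrightarrow> reach E x b"
        using reach_trans[OF _ reach_adj[OF old]] reach_trans[OF _ reach_sym[OF reach_adj[OF old]]]
        by blast
      show ?thesis
      proof (cases "reach E x a")
        case True
        have va: "reach E v a"
          using reach_trans[OF reach_sym[OF rv] True] .
        have "\<phi> b \<le> \<phi> a + 1"
          using graph_dist_triangle[OF True reach_adj[OF old]] graph_dist_adj[OF old]
          by (simp add: \<phi>_def)
        moreover have "graph_dist E v b \<le> graph_dist E v a + 1"
          using graph_dist_triangle[OF va reach_adj[OF old]] graph_dist_adj[OF old] by simp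
        ultimately show ?thesis
          using True iff by (simp add: \<psi>_def min_def)
      next
        case False
        then show ?thesis using iff by (simp add: \<psi>_def)
      qed
    next
      case uv
      then show ?thesis using assms rv le by (auto simp: \<psi>_def \<phi>_def min_def)
    next
      \<comment> \<open>Here \<open>le\<close> enters: both terms of the minimum
        \<open>\<psi> v\<close> are at least \<open>\<phi> u\<close>, so going backwards over the
        edge gains nothing.\<close>
      case vu
      then show ?thesis using assms rv le by (auto simp: \<psi>_def \<phi>_def min_def)
    qed
  qed
  have "reach (insert {u, v} E) x z"
    using reach_mono[OF assms(3)] by blast
  from lipschitz_graph_dist[of _ \<psi>, OF lip this]
  have "\<psi> z - \<psi> x \<le> real (graph_dist (insert {u, v} E) x z)" .
  moreover have "\<psi> x = 0"
    by (simp add: \<psi>_def \<phi>_def)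
  moreover have "real (\<phi> z) \<le> \<psi> z + real l"
  proof -
    have "reach E v z"
      using reach_trans[OF reach_sym[OF rv] assms(3)] .
    then have "\<phi> z \<le> \<phi> u + graph_dist E u v + graph_dist E v z"
      using graph_dist_triangle[of E x u z] graph_dist_triangle[of E u v z] assms
        reach_trans[of E u v z] unfolding \<phi>_def by linarith
    then show ?thesis
      using assms(3) l by (simp add: \<psi>_def min_def)
  qed
  ultimately show ?thesis
    by (simp add: \<phi>_def)
qed

text \<open>One crossing of the new edge can be replaced by a detour of length \<open>l\<close>.
  This bounds both the effect of one variable in the variance estimate and the cost of deleting the
  edges between two arcs.\<close>

lemma graph_dist_insert:
  assumes "reach E x u" "reach E u v" "reach E x z" "graph_dist E u v \<le> l"
  shows "graph_dist E x z \<le> graph_dist (insert {u, v} E) x z + l"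
proof (cases "graph_dist E x u \<le> graph_dist E x v")
  case True
  then show ?thesis using assms by (intro graph_dist_insert_aux)
next
  case False
  have "graph_dist E x z \<le> graph_dist (insert {v, u} E) x z + l"
    using False assms(4) graph_dist_sym[of E u v]
    by (intro graph_dist_insert_aux reach_trans[OF assms(1,2)] reach_sym[OF assms(2)] assms(3)) auto
  then show ?thesis by (simp add: insert_commute)
qed

lemma graph_diameter_eq_Max:
  "graph_diameter V E = Max ((\<lambda>(x, y). graph_dist E x y) ` (V \<times> V))"
  unfolding graph_diameter_def by (rule arg_cong[of _ _ Max]) auto

lemma graph_dist_le_diameter:
  "finite V \<Longrightarrow> x \<in> V \<Longrightarrow> y \<in> V \<Longrightarrow> graph_dist E x y \<le> graph_diameter V E"
  unfolding graph_diameter_eq_Max by (rule Max_ge) auto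

lemma graph_diameter_le_iff:
  "finite V \<Longrightarrow> V \<noteq> {} \<Longrightarrow>
    graph_diameter V E \<le> b \<longleftrightarrow> (\<forall>x\<in>V. \<forall>y\<in>V. graph_dist E x y \<le> b)"
  unfolding graph_diameter_eq_Max by (subst Max_le_iff) auto

subsection \<open>Independent Bernoulli variables\<close>

text \<open>The index set is left abstract so that the line and the cycle are both instances, and
  one can be compared with a marginal of the other.\<close>

definition bern_field :: "'a set \<Rightarrow> ('a \<Rightarrow> real) \<Rightarrow> ('a \<Rightarrow> bool) pmf" where
  "bern_field A p = Pi_pmf A False (\<lambda>e. bernoulli_pmf (p e))"

lemma finite_set_bern_field: "finite A \<Longrightarrow> finite (set_pmf (bern_field A p))"
  unfolding bern_field_def
  by (rule finite_subset[OF set_Pi_pmf_subset']) (auto intro!: finite_PiE_dflt)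

lemma integrable_bern_field [simp]:
  fixes f :: "('a \<Rightarrow> bool) \<Rightarrow> real"
  shows "finite A \<Longrightarrow> integrable (measure_pmf (bern_field A p)) f"
  by (simp add: integrable_measure_pmf_finite finite_set_bern_field)

lemma bern_field_certain:
  assumes "finite A" "e \<in> A" "p e = 1" "w \<in> set_pmf (bern_field A p)"
  shows "w e"
proof -
  have "w e \<in> set_pmf (bernoulli_pmf (p e))"
    using assms by (auto simp: bern_field_def set_Pi_pmf PiE_dflt_def)
  with assms(3) show ?thesis
    by (cases "w e") (simp_all add: set_pmf_iff)
qed

lemma prob_all_open:
  assumes "finite A" "F \<subseteq> A" "\<And>e. e \<in> F \<Longrightarrow> 0 \<le> p e \<and> p e \<le> 1"
  shows "measure_pmf.prob (bern_field A p) {w. \<forall>e\<in>F. w e} = (\<Prod>e\<in>F. p e)"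
proof -
  have "{w. \<forall>e\<in>F. w e} = Pi A (\<lambda>e. if e \<in> F then {True} else UNIV)"
    using assms(2) by (auto simp: Pi_def)
  then have "measure_pmf.prob (bern_field A p) {w. \<forall>e\<in>F. w e} =
      (\<Prod>e\<in>A. measure_pmf.prob (bernoulli_pmf (p e)) (if e \<in> F then {True} else UNIV))"
    unfolding bern_field_def using assms(1) by (simp add: measure_Pi_pmf_Pi)
  also have "\<dots> = (\<Prod>e\<in>A. if e \<in> F then p e else 1)"
    using assms(3) by (intro prod.cong) (auto simp: measure_pmf_single)
  also have "\<dots> = (\<Prod>e\<in>F. p e)"
    using assms(1,2) by (simp add: prod.If_cases Int_absorb1)
  finally show ?thesis .
qed

lemma prob_all_closed:
  assumes "finite A" "F \<subseteq> A" "\<And>e. e \<in> F \<Longrightarrow> 0 \<le> p e \<and> p e \<le> 1"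
  shows "measure_pmf.prob (bern_field A p) {w. \<forall>e\<in>F. \<not> w e} = (\<Prod>e\<in>F. 1 - p e)"
proof -
  have "{w. \<forall>e\<in>F. \<not> w e} = Pi A (\<lambda>e. if e \<in> F then {False} else UNIV)"
    using assms(2) by (auto simp: Pi_def)
  then have "measure_pmf.prob (bern_field A p) {w. \<forall>e\<in>F. \<not> w e} =
      (\<Prod>e\<in>A. measure_pmf.prob (bernoulli_pmf (p e)) (if e \<in> F then {False} else UNIV))"
    unfolding bern_field_def using assms(1) by (simp add: measure_Pi_pmf_Pi)
  also have "\<dots> = (\<Prod>e\<in>A. if e \<in> F then 1 - p e else 1)"
    using assms(3) by (intro prod.cong) (auto simp: measure_pmf_single)
  also have "\<dots> = (\<Prod>e\<in>F. 1 - p e)"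
    using assms(1,2) by (simp add: prod.If_cases Int_absorb1)
  finally show ?thesis .
qed

lemma prob_all_closed_le:
  assumes "finite A" "F \<subseteq> A" "\<And>e. e \<in> F \<Longrightarrow> 0 \<le> p e \<and> p e \<le> 1"
    and "\<And>e. e \<in> F \<Longrightarrow> 1 - p e \<le> exp (- c)"
  shows "measure_pmf.prob (bern_field A p) {w. \<forall>e\<in>F. \<not> w e} \<le> exp (- c * real (card F))"
proof -
  have "(\<Prod>e\<in>F. 1 - p e) \<le> (\<Prod>e\<in>F. exp (- c))"
    using assms by (intro prod_mono) auto
  also have "\<dots> = exp (- c * real (card F))"
    using exp_of_nat_mult[of "card F" "- c"] by (simp add: mult.commute)
  finally show ?thesis
    using prob_all_closed[of A F p] assms by simp
qed

lemma expectation_bern_field_insert: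
  fixes f :: "('a \<Rightarrow> bool) \<Rightarrow> real"
  assumes "finite A" "e \<notin> A" "0 \<le> p e" "p e \<le> 1"
  shows "measure_pmf.expectation (bern_field (insert e A) p) f =
    p e * measure_pmf.expectation (bern_field A p) (\<lambda>w. f (w(e := True))) +
    (1 - p e) * measure_pmf.expectation (bern_field A p) (\<lambda>w. f (w(e := False)))"
proof -
  have "bern_field (insert e A) p =
      bind_pmf (bernoulli_pmf (p e)) (\<lambda>b. map_pmf (\<lambda>w. w(e := b)) (bern_field A p))"
    unfolding bern_field_def by (subst Pi_pmf_insert') (use assms in \<open>auto simp: map_pmf_def\<close>)
  moreover have "measure_pmf.expectation
      (bind_pmf (bernoulli_pmf (p e)) (\<lambda>b. map_pmf (\<lambda>w. w(e := b)) (bern_field A p))) f =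
      (\<Sum>b\<in>UNIV. pmf (bernoulli_pmf (p e)) b *\<^sub>R
        measure_pmf.expectation (map_pmf (\<lambda>w. w(e := b)) (bern_field A p)) f)"
    by (rule pmf_expectation_bind) (use assms(1) finite_set_bern_field in auto)
  ultimately show ?thesis
    using assms by (simp add: UNIV_bool)
qed

lemma expectation_bern_field_mono:
  fixes f :: "('a \<Rightarrow> bool) \<Rightarrow> real"
  assumes "finite A" "\<And>w. w \<in> set_pmf (bern_field A p) \<Longrightarrow> f w \<le> g w"
  shows "measure_pmf.expectation (bern_field A p) f \<le> measure_pmf.expectation (bern_field A p) g"
  using assms by (intro integral_mono_AE) (auto intro: AE_pmfI)

lemma markov_bern_field:
  fixes f :: "('a \<Rightarrow> bool) \<Rightarrow> real"
  assumes "finite A" "\<And>w. f w \<ge> 0" "c > 0"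
  shows "measure_pmf.prob (bern_field A p) {w. f w \<ge> c} \<le>
    measure_pmf.expectation (bern_field A p) f / c"
  using integral_Markov_inequality_measure[of "measure_pmf (bern_field A p)" f UNIV c]
    assms by simp

lemma prob_le_cong_set_pmf:
  "(\<And>x. x \<in> set_pmf M \<Longrightarrow> P x \<Longrightarrow> Q x) \<Longrightarrow>
    measure_pmf.prob M {x. P x} \<le> measure_pmf.prob M {x. Q x}"
  by (intro measure_pmf.finite_measure_mono_AE) (auto intro!: AE_pmfI)

lemma prob_Bex_le:
  assumes "finite I"
  shows "measure_pmf.prob M {x. \<exists>i\<in>I. P i x} \<le> (\<Sum>i\<in>I. measure_pmf.prob M {x. P i x})"
proof -
  have "{x. \<exists>i\<in>I. P i x} = (\<Union>i\<in>I. {x. P i x})" by auto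
  then show ?thesis
    using measure_pmf.finite_measure_subadditive_finite[of I "\<lambda>i. {x. P i x}" M] assms by simp
qed

lemma prob_disj_le:
  "measure_pmf.prob M {x. P x \<or> Q x} \<le> measure_pmf.prob M {x. P x} + measure_pmf.prob M {x. Q x}"
  using measure_Un_le[of "{x. P x}" M "{x. Q x}"]
  by (simp add: Collect_disj_eq)

text \<open>Induction over the coordinates by the law of total variance: fixing one coordinate keeps
  the oscillations in the others, and the conditional means differ by at most \<open>c e\<close>.
  The factor \<open>p e\<close>, from \<open>p e * (1 - p e) \<le> p e\<close>, is what makes rare
  long edges cheap.\<close>

lemma efron_stein:
  fixes f :: "('a \<Rightarrow> bool) \<Rightarrow> real"
  assumes "finite A" "\<And>e. e \<in> A \<Longrightarrow> 0 \<le> p e \<and> p e \<le> 1"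
    and "\<And>e w. e \<in> A \<Longrightarrow> \<bar>f (w(e := True)) - f (w(e := False))\<bar> \<le> c e"
  shows "measure_pmf.expectation (bern_field A p) (\<lambda>w. (f w)\<^sup>2) -
    (measure_pmf.expectation (bern_field A p) f)\<^sup>2 \<le> (\<Sum>e\<in>A. p e * (c e)\<^sup>2)"
  using assms
proof (induction A arbitrary: f rule: finite_induct)
  case empty
  then show ?case by (simp add: bern_field_def)
next
  case (insert e A)
  let ?E = "measure_pmf.expectation (bern_field A p)"
  define g where "g b w = f (w(e := b))" for b w
  have p: "0 \<le> p e" "p e \<le> 1"
    using insert.prems by auto
  have IH: "?E (\<lambda>w. (g b w)\<^sup>2) - (?E (g b))\<^sup>2 \<le> (\<Sum>e\<in>A. p e * (c e)\<^sup>2)" for b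
  proof (rule insert.IH)
    fix e' w assume e': "e' \<in> A"
    then have "(w(e' := d))(e := b) = (w(e := b))(e' := d)" for d
      using insert.hyps by (intro fun_upd_twist) auto
    then show "\<bar>g b (w(e' := True)) - g b (w(e' := False))\<bar> \<le> c e'"
      using insert.prems(2)[of e' "w(e := b)"] e' unfolding g_def by (simp only: insert_iff simp_thms)
  qed (use insert.prems in auto)
  have diff: "\<bar>?E (g True) - ?E (g False)\<bar> \<le> c e"
  proof -
    have "\<bar>?E (g True) - ?E (g False)\<bar> = \<bar>?E (\<lambda>w. g True w - g False w)\<bar>"
      using insert.hyps by simp
    also have "\<dots> \<le> ?E (\<lambda>w. \<bar>g True w - g False w\<bar>)"
      by (rule integral_abs_bound)
    also have "\<dots> \<le> ?E (\<lambda>w. c e)"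
      using insert.hyps(1) insert.prems(2)[OF insertI1]
      by (intro expectation_bern_field_mono) (simp_all only: g_def)
    finally show ?thesis by simp
  qed
  then have sq: "(?E (g True) - ?E (g False))\<^sup>2 \<le> (c e)\<^sup>2"
    using power_mono[of "\<bar>?E (g True) - ?E (g False)\<bar>" "c e" 2] by simp
  \<comment> \<open>Total variance for a two-point mixture: mean conditional variance plus variance
    of the conditional mean.\<close>
  have eq: "(q * A + (1 - q) * B) - (q * a + (1 - q) * b)\<^sup>2 =
      q * (A - a\<^sup>2) + (1 - q) * (B - b\<^sup>2) + q * (1 - q) * (a - b)\<^sup>2" for q A B a b :: real
    by (simp add: power2_eq_square algebra_simps)
  let ?S = "\<Sum>e\<in>A. p e * (c e)\<^sup>2"
  have "measure_pmf.expectation (bern_field (insert e A) p) (\<lambda>w. (f w)\<^sup>2) -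
      (measure_pmf.expectation (bern_field (insert e A) p) f)\<^sup>2 =
      (p e * ?E (\<lambda>w. (g True w)\<^sup>2) + (1 - p e) * ?E (\<lambda>w. (g False w)\<^sup>2)) -
      (p e * ?E (g True) + (1 - p e) * ?E (g False))\<^sup>2"
    unfolding g_def[abs_def] expectation_bern_field_insert[of A e p, OF insert.hyps p] ..
  also have "\<dots> = p e * (?E (\<lambda>w. (g True w)\<^sup>2) - (?E (g True))\<^sup>2) +
      (1 - p e) * (?E (\<lambda>w. (g False w)\<^sup>2) - (?E (g False))\<^sup>2) +
      p e * (1 - p e) * (?E (g True) - ?E (g False))\<^sup>2"
    by (rule eq)
  also have "\<dots> \<le> p e * ?S + (1 - p e) * ?S + p e * 1 * (c e)\<^sup>2"
    using p by (intro add_mono mult_left_mono IH mult_mono sq) auto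
  also have "\<dots> = (\<Sum>e\<in>insert e A. p e * (c e)\<^sup>2)"
    using insert.hyps by (simp add: algebra_simps)
  finally show ?case .
qed

lemma chebyshev_bern_field:
  fixes f :: "('a \<Rightarrow> bool) \<Rightarrow> real"
  assumes "finite A" "\<And>e. e \<in> A \<Longrightarrow> 0 \<le> p e \<and> p e \<le> 1"
    and "\<And>e w. e \<in> A \<Longrightarrow> \<bar>f (w(e := True)) - f (w(e := False))\<bar> \<le> c e" and "a > 0"
  shows "measure_pmf.prob (bern_field A p)
      {w. a \<le> \<bar>f w - measure_pmf.expectation (bern_field A p) f\<bar>} \<le>
    (\<Sum>e\<in>A. p e * (c e)\<^sup>2) / a\<^sup>2"
proof -
  have "measure_pmf.prob (bern_field A p)
      {w. a \<le> \<bar>f w - measure_pmf.expectation (bern_field A p) f\<bar>} \<le>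
      measure_pmf.variance (bern_field A p) f / a\<^sup>2"
    using measure_pmf.Chebyshev_inequality[of f "bern_field A p" a] assms by simp
  also have "measure_pmf.variance (bern_field A p) f =
      measure_pmf.expectation (bern_field A p) (\<lambda>w. (f w)\<^sup>2) -
      (measure_pmf.expectation (bern_field A p) f)\<^sup>2"
    using assms(1) by (intro measure_pmf.variance_eq) auto
  also have "\<dots> / a\<^sup>2 \<le> (\<Sum>e\<in>A. p e * (c e)\<^sup>2) / a\<^sup>2"
    using assms by (intro divide_right_mono efron_stein) auto
  finally show ?thesis .
qed

subsection \<open>The long-range percolation graph\<close>

definition pairs :: "nat \<Rightarrow> (nat \<times> nat) set" where
  "pairs N = {(x, y). x < y \<and> y < N}"

definition edges :: "nat \<Rightarrow> (nat \<times> nat \<Rightarrow> bool) \<Rightarrow> nat set set" where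
  "edges N w = {{x, y} | x y. x < y \<and> y < N \<and> w (x, y)}"

definition lrp_field :: "real \<Rightarrow> real \<Rightarrow> nat \<Rightarrow> (nat \<times> nat \<Rightarrow> bool) pmf" where
  "lrp_field s \<beta> N = bern_field (pairs N) (\<lambda>(x, y). edge_prob s \<beta> N x y)"

lemma finite_pairs [simp]: "finite (pairs N)"
  by (rule finite_subset[of _ "{..<N} \<times> {..<N}"]) (auto simp: pairs_def)

lemma lrp_graph_eq: "lrp_graph s \<beta> N = map_pmf (edges N) (lrp_field s \<beta> N)"
  by (simp add: lrp_graph_def lrp_field_def bern_field_def pairs_def edges_def[abs_def]
      case_prod_unfold)

lemma prob_lrp_graph:
  "measure_pmf.prob (lrp_graph s \<beta> N) {E. P E} =
    measure_pmf.prob (lrp_field s \<beta> N) {w. P (edges N w)}"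
  by (simp add: lrp_graph_eq vimage_def)

lemma mem_edges: "x < y \<Longrightarrow> {x, y} \<in> edges N w \<longleftrightarrow> y < N \<and> w (x, y)"
  by (auto simp: edges_def doubleton_eq_iff)

lemma adj_edges:
  "(x, y) \<in> adj (edges N w) \<longleftrightarrow> x < y \<and> y < N \<and> w (x, y) \<or> y < x \<and> x < N \<and> w (y, x)"
  by (auto simp: adj_def edges_def doubleton_eq_iff)

lemma edges_lrp_field: "w \<in> set_pmf (lrp_field s \<beta> N) \<Longrightarrow> edges N w \<in> set_pmf (lrp_graph s \<beta> N)"
  by (simp add: lrp_graph_eq)

lemma reach_lrp:
  "w \<in> set_pmf (lrp_field s \<beta> N) \<Longrightarrow> x < N \<Longrightarrow> y < N \<Longrightarrow> reach (edges N w) x y"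
  using lrp_graph_connected[OF edges_lrp_field] by (simp add: reach_def)

lemma line_walk: "(\<And>i. x \<le> i \<Longrightarrow> i < x + n \<Longrightarrow> (i, Suc i) \<in> adj E) \<Longrightarrow> (x, x + n) \<in> adj E ^^ n"
proof (induction n)
  case (Suc n)
  then have "(x, x + n) \<in> adj E ^^ n" "(x + n, x + Suc n) \<in> adj E"
    by simp_all
  then show ?case
    by (rule relpow_Suc_I)
qed auto

lemma lrp_succ_adj:
  "w \<in> set_pmf (lrp_field s \<beta> N) \<Longrightarrow> Suc i < N \<Longrightarrow> (i, Suc i) \<in> adj (edges N w)"
  using lrp_graph_cycle_edge[OF edges_lrp_field] by (simp add: adj_def)

lemma graph_dist_lrp_le_diff:
  assumes "w \<in> set_pmf (lrp_field s \<beta> N)" "x \<le> y" "y < N"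
  shows "graph_dist (edges N w) x y \<le> y - x"
proof -
  have "(x, x + (y - x)) \<in> adj (edges N w) ^^ (y - x)"
    using assms by (intro line_walk lrp_succ_adj) auto
  then show ?thesis
    using assms graph_dist_le by fastforce
qed

lemma cycle_dist_pos: "x < y \<Longrightarrow> y < N \<Longrightarrow> 1 \<le> cycle_dist N x y"
  by (auto simp: cycle_dist_def)

lemma cycle_dist_le_diff: "x < y \<Longrightarrow> real_of_int (cycle_dist N x y) \<le> real (y - x)"
  by (simp add: cycle_dist_def of_nat_diff)

lemma cycle_dist_cases:
  assumes "x < y" "y < N"
  shows "cycle_dist N x y = int (y - x) \<or> cycle_dist N x y = int (N - (y - x))"
  using assms by (auto simp: cycle_dist_def min_def)

text \<open>The cycle distance is one of the two arc lengths, and both summands are nonnegative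
  whatever the sign of \<open>a\<close>. Sums over the cycle thus become two sums over lengths,
  without a case split.\<close>

lemma cycle_dist_powr_le:
  assumes "x < y" "y < N"
  shows "real_of_int (cycle_dist N x y) powr a \<le> real (y - x) powr a + real (N - (y - x)) powr a"
  using cycle_dist_cases[OF assms] by auto

lemma edge_prob_compl_le:
  assumes "\<beta> > 0" "s > 0" "x < y" "y < N" "real_of_int (cycle_dist N x y) \<le> R"
  shows "1 - edge_prob s \<beta> N x y \<le> exp (- (\<beta> * R powr (- s)))"
proof -
  have "1 \<le> real_of_int (cycle_dist N x y)"
    using cycle_dist_pos[OF assms(3,4)] by simp
  then have "R powr (- s) \<le> real_of_int (cycle_dist N x y) powr (- s)"
    using assms by (intro powr_mono2') auto
  then show ?thesis
    using assms by (auto simp: edge_prob_def)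
qed

lemma edge_prob_le:
  assumes "\<beta> > 0" "cycle_dist N x y \<noteq> 1"
  shows "edge_prob s \<beta> N x y \<le> \<beta> * real_of_int (cycle_dist N x y) powr (- s)"
  using assms exp_ge_add_one_self[of "- \<beta> * real_of_int (cycle_dist N x y) powr (- s)"]
  by (simp add: edge_prob_def)

text \<open>For a certain edge the distance and its power are 1, which the constant
  \<open>max 1 \<beta>\<close> covers.\<close>

lemma edge_prob_le_max:
  assumes "\<beta> > 0"
  shows "edge_prob s \<beta> N x y \<le> max 1 \<beta> * real_of_int (cycle_dist N x y) powr (- s)"
proof (cases "cycle_dist N x y = 1")
  case False
  have "edge_prob s \<beta> N x y \<le> \<beta> * real_of_int (cycle_dist N x y) powr (- s)"
    using edge_prob_le[OF assms False] .
  also have "\<dots> \<le> max 1 \<beta> * real_of_int (cycle_dist N x y) powr (- s)"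
    by (intro mult_right_mono) auto
  finally show ?thesis .
qed (simp add: edge_prob_def)

lemma lrp_diameter_le_iff:
  fixes N :: nat
  assumes "N > 0"
  shows "graph_diameter {..<N} E \<le> b \<longleftrightarrow> (\<forall>x<N. \<forall>y<N. graph_dist E x y \<le> b)"
proof -
  have "{..<N} \<noteq> {}" using assms by (simp add: lessThan_empty_iff)
  then show ?thesis
    using graph_diameter_le_iff[OF finite_lessThan, of N E b] by (simp add: Ball_def)
qed

lemma tendsto_0_le:
  fixes f g :: "nat \<Rightarrow> real"
  assumes "\<And>N. 0 \<le> f N" "eventually (\<lambda>N. f N \<le> g N) sequentially" "g \<longlonglongrightarrow> 0"
  shows "f \<longlonglongrightarrow> 0"
  using assms by (intro tendsto_sandwich[of "\<lambda>_. 0" f _ g]) auto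

lemma lrp_all_closed_le:
  assumes "s > 0" "\<beta> > 0" "F \<subseteq> pairs N"
    and "\<And>x y. (x, y) \<in> F \<Longrightarrow> real_of_int (cycle_dist N x y) \<le> R"
  shows "measure_pmf.prob (lrp_field s \<beta> N) {w. \<forall>e\<in>F. \<not> w e} \<le>
    exp (- (\<beta> * R powr (- s)) * real (card F))"
  unfolding lrp_field_def
  using assms edge_prob_bounds[OF assms(2)]
  by (intro prob_all_closed_le finite_pairs) (auto simp: pairs_def intro!: edge_prob_compl_le)

subsection \<open>Distances in segments\<close>

text \<open>The edges \<open>{i, i + 1}\<close> belong to the segment whatever \<open>w\<close> is, so that it is always
  connected. Under \<open>lrp_field\<close> they are open almost surely anyway.\<close>
definition seg :: "nat \<Rightarrow> nat \<Rightarrow> (nat \<times> nat \<Rightarrow> bool) \<Rightarrow> nat set set" where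
  "seg u n w = {{x, y} | x y. u \<le> x \<and> x < y \<and> y \<le> u + n \<and> (y = Suc x \<or> w (x, y))}"

text \<open>Walks may not leave the segment. The value is therefore a function of the edges inside
  it, which makes its law translation invariant and lets walks in adjacent segments be
  concatenated.\<close>

definition seg_dist :: "nat \<Rightarrow> nat \<Rightarrow> (nat \<times> nat \<Rightarrow> bool) \<Rightarrow> nat" where
  "seg_dist u n w = graph_dist (seg u n w) u (u + n)"

lemma adj_seg:
  "(x, y) \<in> adj (seg u n w) \<longleftrightarrow>
    u \<le> x \<and> x < y \<and> y \<le> u + n \<and> (y = Suc x \<or> w (x, y)) \<or>
    u \<le> y \<and> y < x \<and> x \<le> u + n \<and> (x = Suc y \<or> w (y, x))"
  by (auto simp: adj_def seg_def doubleton_eq_iff)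

lemma seg_line_walk:
  assumes "u \<le> x" "x \<le> y" "y \<le> u + n"
  shows "(x, y) \<in> adj (seg u n w) ^^ (y - x)"
proof -
  have "(x, x + (y - x)) \<in> adj (seg u n w) ^^ (y - x)"
    using assms by (intro line_walk) (auto simp: adj_seg)
  then show ?thesis using assms by simp
qed

lemma reach_seg:
  assumes "u \<le> x" "x \<le> u + n" "u \<le> y" "y \<le> u + n"
  shows "reach (seg u n w) x y"
proof (cases "x \<le> y")
  case True
  then show ?thesis using assms reachI[OF seg_line_walk] by blast
next
  case False
  then have "reach (seg u n w) y x" using assms by (intro reachI[OF seg_line_walk]) auto
  then show ?thesis by (rule reach_sym)
qed

lemma seg_dist_le: "seg_dist u n w \<le> n"
  using graph_dist_le[OF seg_line_walk[of u u "u + n" n w]] by (simp add: seg_dist_def)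

lemma seg_mono: "u \<le> u' \<Longrightarrow> u' + n' \<le> u + n \<Longrightarrow> seg u' n' w \<subseteq> seg u n w"
  unfolding seg_def by (intro subsetI, elim CollectE exE) (auto intro!: exI)

lemma seg_dist_add: "seg_dist u (m + n) w \<le> seg_dist u m w + seg_dist (u + m) n w"
proof -
  have "seg_dist u (m + n) w \<le>
      graph_dist (seg u (m + n) w) u (u + m) + graph_dist (seg u (m + n) w) (u + m) (u + m + n)"
    unfolding seg_dist_def by (subst add.assoc[symmetric]) (intro graph_dist_triangle reach_seg; simp)
  also have "graph_dist (seg u (m + n) w) u (u + m) \<le> seg_dist u m w"
    unfolding seg_dist_def by (intro graph_dist_mono reach_seg seg_mono) auto
  also have "graph_dist (seg u (m + n) w) (u + m) (u + m + n) \<le> seg_dist (u + m) n w"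
    unfolding seg_dist_def by (intro graph_dist_mono reach_seg seg_mono) auto
  finally show ?thesis by simp
qed

lemma relpow_map:
  assumes "\<And>a b. (a, b) \<in> R \<Longrightarrow> (f a, f b) \<in> S"
  shows "(x, y) \<in> R ^^ k \<Longrightarrow> (f x, f y) \<in> S ^^ k"
proof (induction k arbitrary: y)
  case (Suc k)
  from Suc.prems obtain z where z: "(x, z) \<in> R ^^ k" "(z, y) \<in> R"
    by (rule relpow_Suc_E)
  from relpow_Suc_I[OF Suc.IH[OF z(1)] assms[OF z(2)]] show ?case .
qed auto

lemma seg_dist_shift:
  assumes "\<And>x y. x < y \<Longrightarrow> y \<le> n \<Longrightarrow> w' (x, y) = w (x + u, y + u)"
  shows "seg_dist u n w = seg_dist 0 n w'"
proof -
  have 1: "(a - u, b - u) \<in> adj (seg 0 n w')" if "(a, b) \<in> adj (seg u n w)" for a b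
  proof -
    have "u \<le> a" "u \<le> b" using that by (auto simp: adj_seg)
    then obtain a' b' where ab: "a = a' + u" "b = b' + u"
      by (metis le_add_diff_inverse2)
    then show ?thesis
      using that assms[of a' b'] assms[of b' a'] by (auto simp: adj_seg)
  qed
  have 2: "(a + u, b + u) \<in> adj (seg u n w)" if "(a, b) \<in> adj (seg 0 n w')" for a b
    using that assms[of a b] assms[of b a] by (auto simp: adj_seg)
  have "(u, u + n) \<in> adj (seg u n w) ^^ k \<longleftrightarrow> (0, n) \<in> adj (seg 0 n w') ^^ k" for k
    using relpow_map[of "adj (seg u n w)" "\<lambda>a. a - u", OF 1, of u "u + n" k]
      relpow_map[of "adj (seg 0 n w')" "\<lambda>a. a + u", OF 2, of 0 n k]
    by (auto simp: add.commute)
  then show ?thesis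
    by (simp add: seg_dist_def graph_dist_def)
qed

lemma seg_insert:
  assumes "x < y" "y \<le> n" "y \<noteq> Suc x"
  shows "seg 0 n (w((x, y) := True)) = insert {x, y} (seg 0 n (w((x, y) := False)))"
proof -
  have "e \<in> seg 0 n (w((x, y) := True)) \<longleftrightarrow> e \<in> insert {x, y} (seg 0 n (w((x, y) := False)))" for e
  proof -
    have "e = {x, y}" if "e = {a, b}" "(a, b) = (x, y)" for a b using that by simp
    then show ?thesis
      using assms unfolding seg_def by (auto; metis)
  qed
  then show ?thesis by blast
qed

text \<open>The unit edges always remain and provide a detour of length \<open>y - x\<close>. For a
  unit edge the variable is not consulted at all, so the bound is 0; otherwise these certain edges
  would contribute to the variance sum.\<close>

lemma seg_dist_switch:
  assumes "x < y" "y \<le> n"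
  shows "\<bar>real (seg_dist 0 n (w((x, y) := True))) - real (seg_dist 0 n (w((x, y) := False)))\<bar> \<le>
    (if y = Suc x then 0 else real (y - x))"
proof (cases "y = Suc x")
  case True
  have "seg_dist 0 n (w((x, y) := True)) = seg_dist 0 n (w((x, y) := False))"
  proof -
    have "adj (seg 0 n (w((x, y) := True))) = adj (seg 0 n (w((x, y) := False)))"
      using True by (auto simp: adj_seg)
    then show ?thesis by (simp add: seg_dist_def graph_dist_def)
  qed
  with True show ?thesis by simp
next
  case False
  let ?E = "seg 0 n (w((x, y) := False))"
  have "graph_dist ?E 0 n \<le> graph_dist (insert {x, y} ?E) 0 n + (y - x)"
    using assms graph_dist_le[OF seg_line_walk[of 0 x y n]]
    by (intro graph_dist_insert reach_seg) auto
  moreover have "graph_dist (insert {x, y} ?E) 0 n \<le> graph_dist ?E 0 n"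
    by (intro graph_dist_mono reach_seg) auto
  ultimately show ?thesis
    using False seg_insert[OF assms False] by (simp add: seg_dist_def)
qed

section \<open>Laws and means of segment distances\<close>

text \<open>Coordinates read through an injection stay independent. Adding one coordinate
  \<open>e\<close> to \<open>B\<close> exposes the coordinate \<open>h e\<close>, which by
  injectivity no other element of \<open>B\<close> reads.\<close>

lemma bern_field_marginal:
  assumes "finite A" "finite B" "inj_on h B" "h ` B \<subseteq> A" "\<And>e. e \<in> B \<Longrightarrow> p (h e) = q e"
  shows "map_pmf (\<lambda>w e. e \<in> B \<and> w (h e)) (bern_field A p) = bern_field B q"
proof -
  have *: "map_pmf (\<lambda>w e. e \<in> B \<and> w (h e)) (bern_field (h ` B) p) = bern_field B q"
    using assms(2,3,5)
  proof (induction B rule: finite_induct)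
    case empty
    then show ?case by (simp add: bern_field_def)
  next
    case (insert e B)
    have he': "h x \<noteq> h e" if "x \<in> B" for x
      using that insert.hyps insert.prems(1) by (auto simp: inj_on_def)
    then have he: "h e \<notin> h ` B" by fastforce
    have "map_pmf (\<lambda>w e'. e' \<in> insert e B \<and> w (h e')) (bern_field (h ` insert e B) p) =
        map_pmf (\<lambda>(b, w) e'. e' \<in> insert e B \<and> (w(h e := b)) (h e'))
          (pair_pmf (bernoulli_pmf (p (h e))) (bern_field (h ` B) p))"
      unfolding bern_field_def image_insert
      using insert.hyps he by (subst Pi_pmf_insert) (auto simp: pmf.map_comp o_def case_prod_unfold)
    also have "(\<lambda>(b, w) e'. e' \<in> insert e B \<and> (w(h e := b)) (h e')) =
        (\<lambda>(b, v). v(e := b)) \<circ> (\<lambda>(b, w). (b, \<lambda>e'. e' \<in> B \<and> w (h e')))"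
      using he' insert.hyps(2) by (auto simp: fun_eq_iff)
    also have "map_pmf \<dots> (pair_pmf (bernoulli_pmf (p (h e))) (bern_field (h ` B) p)) =
        map_pmf (\<lambda>(b, v). v(e := b)) (pair_pmf (bernoulli_pmf (p (h e)))
          (map_pmf (\<lambda>w e'. e' \<in> B \<and> w (h e')) (bern_field (h ` B) p)))"
      by (simp add: pair_map_pmf2 pmf.map_comp apsnd_def map_prod_def)
    also have "\<dots> = map_pmf (\<lambda>(b, v). v(e := b)) (pair_pmf (bernoulli_pmf (q e)) (bern_field B q))"
      using insert by (subst insert.IH) (auto simp: inj_on_def)
    also have "\<dots> = bern_field (insert e B) q"
      using insert.hyps by (simp add: bern_field_def Pi_pmf_insert)
    finally show ?case .
  qed
  have "bern_field (h ` B) p = map_pmf (\<lambda>w e. if e \<in> h ` B then w e else False) (bern_field A p)"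
    unfolding bern_field_def using assms by (intro Pi_pmf_subset) auto
  then have "map_pmf (\<lambda>w e. e \<in> B \<and> w (h e)) (bern_field (h ` B) p) =
      map_pmf (\<lambda>w e. e \<in> B \<and> w (h e)) (bern_field A p)"
    by (simp add: pmf.map_comp o_def cong: conj_cong)
  with * show ?thesis by simp
qed

definition line_prob :: "real \<Rightarrow> real \<Rightarrow> nat \<times> nat \<Rightarrow> real" where
  "line_prob s \<beta> = (\<lambda>(x, y). if y = Suc x then 1 else 1 - exp (- \<beta> * real (y - x) powr (- s)))"

definition line_field :: "real \<Rightarrow> real \<Rightarrow> nat \<Rightarrow> (nat \<times> nat \<Rightarrow> bool) pmf" where
  "line_field s \<beta> n = bern_field (pairs (Suc n)) (line_prob s \<beta>)"

lemma line_prob_bounds: "\<beta> > 0 \<Longrightarrow> 0 \<le> line_prob s \<beta> e \<and> line_prob s \<beta> e \<le> 1"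
  by (auto simp: line_prob_def split: prod.splits)

text \<open>Only the probabilities inside the segment matter, so this applies both to subsegments of
  the line and to arcs of the cycle.\<close>

lemma seg_dist_law:
  assumes "finite A" "\<And>x y. x < y \<Longrightarrow> y \<le> n \<Longrightarrow> (x + u, y + u) \<in> A"
    and "\<And>x y. x < y \<Longrightarrow> y \<le> n \<Longrightarrow> p (x + u, y + u) = line_prob s \<beta> (x, y)"
  shows "map_pmf (seg_dist u n) (bern_field A p) = map_pmf (seg_dist 0 n) (line_field s \<beta> n)"
proof -
  let ?h = "\<lambda>(x, y). (x + u, y + u)"
  have "line_field s \<beta> n = map_pmf (\<lambda>w e. e \<in> pairs (Suc n) \<and> w (?h e)) (bern_field A p)"
    unfolding line_field_def using assms
    by (intro bern_field_marginal[symmetric]) (auto simp: inj_on_def pairs_def finite_pairs[unfolded pairs_def])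
  moreover have "seg_dist 0 n (\<lambda>e. e \<in> pairs (Suc n) \<and> w (?h e)) = seg_dist u n w" for w
    by (rule seg_dist_shift[symmetric]) (auto simp: pairs_def)
  ultimately show ?thesis
    by (simp add: pmf.map_comp o_def)
qed

definition mean_dist :: "real \<Rightarrow> real \<Rightarrow> nat \<Rightarrow> real" where
  "mean_dist s \<beta> n = measure_pmf.expectation (line_field s \<beta> n) (\<lambda>w. real (seg_dist 0 n w))"

lemma mean_dist_law:
  assumes "map_pmf (seg_dist u n) M = map_pmf (seg_dist 0 n) (line_field s \<beta> n)"
  shows "measure_pmf.expectation M (\<lambda>w. real (seg_dist u n w)) = mean_dist s \<beta> n"
proof -
  have "measure_pmf.expectation (map_pmf (seg_dist u n) M) real =
      measure_pmf.expectation (map_pmf (seg_dist 0 n) (line_field s \<beta> n)) real"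
    by (simp add: assms)
  then show ?thesis by (simp add: mean_dist_def)
qed

lemma prob_seg_dist_law:
  assumes "map_pmf (seg_dist u n) M = map_pmf (seg_dist 0 n) (line_field s \<beta> n)"
  shows "measure_pmf.prob M {w. P (seg_dist u n w)} =
    measure_pmf.prob (line_field s \<beta> n) {w. P (seg_dist 0 n w)}"
proof -
  have "measure_pmf.prob (map_pmf (seg_dist u n) M) {k. P k} =
      measure_pmf.prob (map_pmf (seg_dist 0 n) (line_field s \<beta> n)) {k. P k}"
    by (simp add: assms)
  then show ?thesis by (simp add: vimage_def)
qed

lemma mean_dist_nonneg: "0 \<le> mean_dist s \<beta> n"
  by (simp add: mean_dist_def)

lemma mean_dist_le: "mean_dist s \<beta> n \<le> real n"
proof -
  have "mean_dist s \<beta> n \<le> measure_pmf.expectation (line_field s \<beta> n) (\<lambda>w. real n)"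
    unfolding mean_dist_def line_field_def
    by (intro expectation_bern_field_mono) (auto simp: seg_dist_le)
  then show ?thesis by simp
qed

lemma mean_dist_subadditive: "mean_dist s \<beta> (m + n) \<le> mean_dist s \<beta> m + mean_dist s \<beta> n"
proof -
  let ?M = "line_field s \<beta> (m + n)"
  have "mean_dist s \<beta> (m + n) \<le>
      measure_pmf.expectation ?M (\<lambda>w. real (seg_dist 0 m w) + real (seg_dist m n w))"
    unfolding mean_dist_def line_field_def
    using seg_dist_add[of 0 m n]
    by (intro expectation_bern_field_mono) (auto simp flip: of_nat_add)
  also have "\<dots> = measure_pmf.expectation ?M (\<lambda>w. real (seg_dist 0 m w)) +
      measure_pmf.expectation ?M (\<lambda>w. real (seg_dist m n w))"
    by (simp add: line_field_def)
  also have "measure_pmf.expectation ?M (\<lambda>w. real (seg_dist 0 m w)) = mean_dist s \<beta> m"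
    unfolding line_field_def
    by (intro mean_dist_law seg_dist_law) (auto simp: pairs_def finite_pairs[unfolded pairs_def] line_prob_def)
  also have "measure_pmf.expectation ?M (\<lambda>w. real (seg_dist m n w)) = mean_dist s \<beta> n"
    unfolding line_field_def
    by (intro mean_dist_law seg_dist_law) (auto simp: pairs_def finite_pairs[unfolded pairs_def] line_prob_def)
  finally show ?thesis .
qed

section \<open>Asymptotic speed on the line\<close>

text \<open>Fekete's lemma; the limit is the infimum of the ratios. With \<open>m\<close> nearly
  optimal, \<open>n\<close> is divided into blocks of length \<open>m\<close>, and the remainder
  costs less than \<open>m\<close> because \<open>a n \<le> real n\<close>.\<close>

lemma fekete_subadditive:
  fixes a :: "nat \<Rightarrow> real"
  assumes sub: "\<And>m n. a (m + n) \<le> a m + a n" and nonneg: "\<And>n. 0 \<le> a n" and le: "\<And>n. a n \<le> real n"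
  shows "\<exists>\<gamma>. (\<lambda>n. a n / real n) \<longlonglongrightarrow> \<gamma>"
proof -
  define S where "S = (\<lambda>n. a n / real n) ` {1..}"
  define \<gamma> where "\<gamma> = Inf S"
  have bdd: "bdd_below S"
    using nonneg by (auto simp: S_def intro!: bdd_belowI[of _ 0])
  have mult: "a (k * m) \<le> real k * a m" for k m
  proof (induction k)
    case 0
    then show ?case using le[of 0] by simp
  next
    case (Suc k)
    then show ?case using sub[of m "k * m"] by (simp add: algebra_simps)
  qed
  have "(\<lambda>n. a n / real n) \<longlonglongrightarrow> \<gamma>"
  proof (rule LIMSEQ_I)
    fix r :: real assume r: "0 < r"
    then obtain m where m: "m \<ge> 1" "a m / real m < \<gamma> + r / 2"
      using cInf_lessD[of S "\<gamma> + r / 2"] by (auto simp: S_def \<gamma>_def)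
    obtain n0 where n0: "2 * real m / r < real n0"
      using reals_Archimedean2 by blast
    have "norm (a n / real n - \<gamma>) < r" if n: "n \<ge> max 1 n0" for n
    proof -
      have npos: "real n > 0" using n by simp
      have "\<gamma> \<le> a n / real n"
        unfolding \<gamma>_def using n bdd by (intro cInf_lower) (auto simp: S_def)
      moreover have "a n / real n < \<gamma> + r"
      proof -
        have "a n = a (n div m * m + n mod m)" by simp
        also have "\<dots> \<le> real (n div m) * a m + real (n mod m)"
          using sub[of "n div m * m" "n mod m"] mult[of "n div m" m] le[of "n mod m"] by linarith
        also have "real (n mod m) \<le> real m"
          using m(1) by (simp add: less_imp_le)
        also have "real (n div m) * a m \<le> (real n / real m) * a m"
          using nonneg by (intro mult_right_mono of_nat_div_le_of_nat)
        also have "(real n / real m) * a m = real n * (a m / real m)" by simp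
        also have "\<dots> \<le> real n * (\<gamma> + r / 2)"
          using m by (intro mult_left_mono) auto
        finally have "a n \<le> real n * (\<gamma> + r / 2) + real m" by simp
        moreover have "2 * real m < real n * r"
        proof -
          have "2 * real m / r < real n" using n0 n by (meson less_le_trans max.bounded_iff of_nat_le_iff)
          then show ?thesis using r by (simp add: field_simps)
        qed
        ultimately have "a n < real n * (\<gamma> + r)" by (simp add: algebra_simps)
        then show ?thesis using npos by (simp add: field_simps)
      qed
      ultimately show ?thesis by simp
    qed
    then show "\<exists>no. \<forall>n\<ge>no. norm (a n / real n - \<gamma>) < r" by blast
  qed
  then show ?thesis ..
qed

text \<open>Grouping by length. In the linear regime every sum over edges is reduced in this way to
  a sum over lengths, with \<open>c k\<close> counting the edges of length \<open>k\<close>.\<close>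

lemma sum_by_length_le:
  fixes f :: "nat \<Rightarrow> real" and L :: "'a \<Rightarrow> nat"
  assumes "finite P" "L ` P \<subseteq> {1..n}" "\<And>k. 0 \<le> f k"
    and "\<And>k. 1 \<le> k \<Longrightarrow> k \<le> n \<Longrightarrow> card {e \<in> P. L e = k} \<le> c k"
  shows "(\<Sum>e\<in>P. f (L e)) \<le> (\<Sum>k=1..n. real (c k) * f k)"
proof -
  have "(\<Sum>e\<in>P. f (L e)) = (\<Sum>k=1..n. \<Sum>e\<in>{e \<in> P. L e = k}. f (L e))"
    using assms(1,2) by (intro sum.group[symmetric]) auto
  also have "\<dots> = (\<Sum>k=1..n. real (card {e \<in> P. L e = k}) * f k)"
    by (intro sum.cong refl) simp
  also have "\<dots> \<le> (\<Sum>k=1..n. real (c k) * f k)"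
    using assms by (intro sum_mono mult_right_mono) auto
  finally show ?thesis .
qed

lemma cesaro_zero:
  fixes f :: "nat \<Rightarrow> real"
  assumes "f \<longlonglongrightarrow> 0" and nonneg: "\<And>k. 0 \<le> f k"
  shows "(\<lambda>n. (\<Sum>k=1..n. f k) / real n) \<longlonglongrightarrow> 0"
proof (rule LIMSEQ_I)
  fix r :: real assume r: "0 < r"
  then obtain K where K: "\<And>k. k \<ge> K \<Longrightarrow> f k < r / 2"
    using LIMSEQ_D[OF assms(1), of "r / 2"] by (auto simp: nonneg)
  define S where "S = (\<Sum>k=1..K. f k)"
  obtain n0 where n0: "2 * S / r < real n0"
    using reals_Archimedean2 by blast
  have "norm ((\<Sum>k=1..n. f k) / real n - 0) < r" if n: "n \<ge> max 1 n0" for n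
  proof -
    \<comment> \<open>Terms beyond \<open>K\<close> are below \<open>r / 2\<close>; the remaining
      ones have total at most \<open>S\<close>, independently of \<open>n\<close>.\<close>
    have "(\<Sum>k=1..n. f k) \<le> (\<Sum>k=1..n. r / 2 + (if k \<le> K then f k else 0))"
      using K r by (intro sum_mono) (auto simp: not_le intro: less_imp_le)
    also have "\<dots> = real n * (r / 2) + (\<Sum>k=1..n. if k \<le> K then f k else 0)"
      by (simp add: sum.distrib)
    also have "(\<Sum>k=1..n. if k \<le> K then f k else 0) = (\<Sum>k | k \<in> {1..n} \<and> k \<le> K. f k)"
      by (rule sum.inter_filter[symmetric]) simp
    also have "\<dots> \<le> S"
      unfolding S_def using nonneg by (intro sum_mono2) auto
    also have "S < real n * r / 2"
    proof -
      have "2 * S / r < real n" using n0 n by (meson less_le_trans max.bounded_iff of_nat_le_iff)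
      then show ?thesis using r by (simp add: field_simps)
    qed
    finally have "(\<Sum>k=1..n. f k) < r * real n" by (simp add: mult.commute)
    then show ?thesis
      using n nonneg by (simp add: sum_nonneg pos_divide_less_eq)
  qed
  then show "\<exists>no. \<forall>n\<ge>no. norm ((\<Sum>k=1..n. f k) / real n - 0) < r" by blast
qed

text \<open>The terms tend to 0 because the exponent is negative, and this passes to their means
  even where the series diverges.\<close>

lemma mean_powr_tendsto_0:
  "s > 2 \<Longrightarrow> (\<lambda>n. (\<Sum>k=1..n. real k powr (2 - s)) / real n) \<longlonglongrightarrow> 0"
  by (intro cesaro_zero) (auto, real_asymp)

text \<open>Chebyshev with the variance bound: a long edge of length \<open>k\<close> contributes at
  most \<open>\<beta> * k powr (- s) * k\<^sup>2\<close>, there are at most \<open>n\<close> such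
  edges, and one factor \<open>n\<close> of \<open>(\<epsilon> * n)\<^sup>2\<close>
  survives.\<close>

lemma line_deviation_le:
  assumes "\<beta> > 0" "\<epsilon> > 0" "n > 0"
  shows "measure_pmf.prob (line_field s \<beta> n)
      {w. \<epsilon> * real n \<le> \<bar>real (seg_dist 0 n w) - mean_dist s \<beta> n\<bar>} \<le>
    \<beta> / \<epsilon>\<^sup>2 * ((\<Sum>k=1..n. real k powr (2 - s)) / real n)"
proof -
  let ?A = "pairs (Suc n)"
  let ?c = "\<lambda>(x, y). if y = Suc x then 0 else real (y - x)"
  have "measure_pmf.prob (line_field s \<beta> n)
      {w. \<epsilon> * real n \<le> \<bar>real (seg_dist 0 n w) - mean_dist s \<beta> n\<bar>} \<le>
      (\<Sum>e\<in>?A. line_prob s \<beta> e * (?c e)\<^sup>2) / (\<epsilon> * real n)\<^sup>2"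
    unfolding line_field_def mean_dist_def
  proof (rule chebyshev_bern_field)
    fix e w assume "e \<in> ?A"
    then obtain x y where e: "e = (x, y)" "x < y" "y \<le> n"
      by (auto simp: pairs_def)
    show "\<bar>real (seg_dist 0 n (w(e := True))) - real (seg_dist 0 n (w(e := False)))\<bar> \<le> ?c e"
      using seg_dist_switch[OF e(2,3), of w] unfolding e(1) prod.case .
  qed (use assms line_prob_bounds in auto)
  also have "(\<Sum>e\<in>?A. line_prob s \<beta> e * (?c e)\<^sup>2) \<le> (\<Sum>e\<in>?A. \<beta> * real (snd e - fst e) powr (2 - s))"
  proof (rule sum_mono)
    fix e assume "e \<in> ?A"
    then obtain x y where e: "e = (x, y)" "x < y"
      by (auto simp: pairs_def)
    have "1 - exp (- \<beta> * real (y - x) powr (- s)) \<le> \<beta> * real (y - x) powr (- s)"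
      using exp_ge_add_one_self[of "- \<beta> * real (y - x) powr (- s)"] by simp
    then have "(1 - exp (- \<beta> * real (y - x) powr (- s))) * (real (y - x))\<^sup>2 \<le>
        \<beta> * real (y - x) powr (- s) * (real (y - x))\<^sup>2"
      by (intro mult_right_mono) auto
    also have "\<dots> = \<beta> * real (y - x) powr (2 - s)"
      using e powr_numeral[of "real (y - x)" "num.Bit0 num.One"]
      by (simp add: powr_diff powr_minus field_simps)
    finally show "line_prob s \<beta> e * (?c e)\<^sup>2 \<le> \<beta> * real (snd e - fst e) powr (2 - s)"
      using assms by (auto simp: e line_prob_def)
  qed
  also have "\<dots> \<le> (\<Sum>k=1..n. real n * (\<beta> * real k powr (2 - s)))"
  proof (rule sum_by_length_le[where L = "\<lambda>e. snd e - fst e" and f = "\<lambda>k. \<beta> * real k powr (2 - s)"])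
    fix k assume k: "1 \<le> k" "k \<le> n"
    have "{e \<in> ?A. snd e - fst e = k} \<subseteq> (\<lambda>x. (x, x + k)) ` {..<n}"
      using k by (auto simp: pairs_def image_iff)
    then have "card {e \<in> ?A. snd e - fst e = k} \<le> card ((\<lambda>x. (x, x + k)) ` {..<n})"
      by (intro card_mono) auto
    also have "\<dots> \<le> n"
      using card_image_le[of "{..<n}" "\<lambda>x. (x, x + k)"] by simp
    finally show "card {e \<in> ?A. snd e - fst e = k} \<le> n" .
  qed (use assms in \<open>auto simp: pairs_def finite_pairs[unfolded pairs_def]\<close>)
  also have "\<dots> / (\<epsilon> * real n)\<^sup>2 = \<beta> / \<epsilon>\<^sup>2 * ((\<Sum>k=1..n. real k powr (2 - s)) / real n)"
    using assms by (simp add: sum_distrib_left[symmetric] power2_eq_square field_simps)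
  finally show ?thesis
    by (simp add: divide_right_mono)
qed

text \<open>The bond \<open>{i, i + 1}\<close> lies on every walk from the left of it to the right of it.\<close>
definition uncrossed :: "nat \<Rightarrow> nat \<Rightarrow> (nat \<times> nat \<Rightarrow> bool) \<Rightarrow> bool" where
  "uncrossed n i w \<longleftrightarrow> (\<forall>x y. x \<le> i \<and> i < y \<and> y \<le> n \<and> y \<noteq> Suc x \<longrightarrow> \<not> w (x, y))"

text \<open>The number of uncrossed bonds to the left of a vertex is a potential: a unit step
  changes it by at most 1, and a long open edge not at all, since it crosses every bond that it
  spans.\<close>

lemma card_uncrossed_le: "card {i. i < n \<and> uncrossed n i w} \<le> seg_dist 0 n w"
proof -
  define \<phi> where "\<phi> z = real (card {i. i < z \<and> uncrossed n i w})" for z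
  have mono: "\<phi> x \<le> \<phi> y" if "x \<le> y" for x y
    unfolding \<phi>_def using that by (intro of_nat_mono card_mono) auto
  have step: "\<phi> y \<le> \<phi> x + 1" if xy: "x < y" "y \<le> n" "y = Suc x \<or> w (x, y)" for x y
  proof (cases "y = Suc x")
    case True
    have "{i. i < y \<and> uncrossed n i w} \<subseteq> insert x {i. i < x \<and> uncrossed n i w}"
      using True by auto
    then have "card {i. i < y \<and> uncrossed n i w} \<le> card (insert x {i. i < x \<and> uncrossed n i w})"
      by (intro card_mono) auto
    also have "\<dots> \<le> Suc (card {i. i < x \<and> uncrossed n i w})"
      by (rule card_insert_le_m1) auto
    finally show ?thesis by (simp add: \<phi>_def)
  next
    case False
    have "{i. i < y \<and> uncrossed n i w} = {i. i < x \<and> uncrossed n i w}"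
      using False xy unfolding uncrossed_def by (auto simp: not_less) (meson not_less)
    then show ?thesis by (simp add: \<phi>_def)
  qed
  have "\<phi> b \<le> \<phi> a + 1" if "(a, b) \<in> adj (seg 0 n w)" for a b
    using that step[of a b] mono[of b a] unfolding adj_seg by fastforce
  from lipschitz_graph_dist[of "seg 0 n w" \<phi>, OF this reach_seg[of 0 0 n n]]
  have "\<phi> n - \<phi> 0 \<le> real (graph_dist (seg 0 n w) 0 n)" by simp
  then show ?thesis by (simp add: \<phi>_def seg_dist_def)
qed

text \<open>At most \<open>k\<close> pairs of length \<open>k\<close> straddle the bond, so the
  exponent of the product of the closing probabilities is at most \<open>\<beta>\<close> times the
  sum of \<open>k * k powr (- s)\<close>. The bound is uniform in \<open>i\<close> and
  \<open>n\<close>.\<close>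

lemma prob_uncrossed_ge:
  assumes "\<beta> > 0" "s > 2" "i < n"
  shows "exp (- \<beta> * (\<Sum>k. real k powr (1 - s))) \<le>
    measure_pmf.prob (line_field s \<beta> n) {w. uncrossed n i w}"
proof -
  define F where "F = {(x, y). x \<le> i \<and> i < y \<and> y \<le> n \<and> y \<noteq> Suc x}"
  have F: "F \<subseteq> pairs (Suc n)" by (auto simp: F_def pairs_def)
  then have fin: "finite F" by (rule finite_subset) simp
  have summ: "summable (\<lambda>k. real k powr (1 - s))"
    using assms by (simp add: summable_real_powr_iff)
  have "measure_pmf.prob (line_field s \<beta> n) {w. uncrossed n i w} =
      measure_pmf.prob (line_field s \<beta> n) {w. \<forall>e\<in>F. \<not> w e}"
    by (rule arg_cong[of _ _ "measure_pmf.prob _"]) (auto simp: uncrossed_def F_def)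
  also have "\<dots> = (\<Prod>e\<in>F. 1 - line_prob s \<beta> e)"
    unfolding line_field_def using F line_prob_bounds[OF assms(1)] by (intro prob_all_closed) auto
  also have "\<dots> = (\<Prod>e\<in>F. exp (- \<beta> * real (snd e - fst e) powr (- s)))"
    by (intro prod.cong refl) (auto simp: F_def line_prob_def)
  also have "\<dots> = exp (- \<beta> * (\<Sum>e\<in>F. real (snd e - fst e) powr (- s)))"
    using fin by (simp add: exp_sum sum_distrib_left)
  also have "\<dots> \<ge> exp (- \<beta> * (\<Sum>k. real k powr (1 - s)))"
  proof -
    have "(\<Sum>e\<in>F. real (snd e - fst e) powr (- s)) \<le> (\<Sum>k=1..n. real k * real k powr (- s))"
    proof (rule sum_by_length_le[where L = "\<lambda>e. snd e - fst e" and f = "\<lambda>k. real k powr (- s)"])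
      fix k assume k: "1 \<le> k" "k \<le> n"
      have "{e \<in> F. snd e - fst e = k} \<subseteq> (\<lambda>x. (x, x + k)) ` {Suc i - k..<Suc i}"
        by (auto simp: F_def image_iff)
      then have "card {e \<in> F. snd e - fst e = k} \<le> card ((\<lambda>x. (x, x + k)) ` {Suc i - k..<Suc i})"
        by (intro card_mono) auto
      also have "\<dots> \<le> card {Suc i - k..<Suc i}"
        by (rule card_image_le) simp
      also have "\<dots> \<le> k" by simp
      finally show "card {e \<in> F. snd e - fst e = k} \<le> k" .
    qed (use fin in \<open>auto simp: F_def\<close>)
    also have "\<dots> = (\<Sum>k=1..n. real k powr (1 - s))"
      by (intro sum.cong refl) (auto simp: powr_diff powr_minus field_simps)
    also have "\<dots> \<le> (\<Sum>k. real k powr (1 - s))"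
      using summ by (intro sum_le_suminf) auto
    finally show ?thesis using assms by simp
  qed
  finally show ?thesis .
qed

lemma mean_dist_ge:
  assumes "\<beta> > 0" "s > 2"
  shows "exp (- \<beta> * (\<Sum>k. real k powr (1 - s))) * real n \<le> mean_dist s \<beta> n"
proof -
  let ?c = "exp (- \<beta> * (\<Sum>k. real k powr (1 - s)))"
  have "?c * real n = (\<Sum>i<n. ?c)" by simp
  also have "\<dots> \<le> (\<Sum>i<n. measure_pmf.prob (line_field s \<beta> n) {w. uncrossed n i w})"
    using assms by (intro sum_mono prob_uncrossed_ge) auto
  also have "\<dots> = measure_pmf.expectation (line_field s \<beta> n) (\<lambda>w. \<Sum>i<n. indicator {w. uncrossed n i w} w)"
    unfolding line_field_def by (subst Bochner_Integration.integral_sum, simp) simp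
  also have "\<dots> \<le> mean_dist s \<beta> n"
    unfolding mean_dist_def line_field_def
  proof (rule expectation_bern_field_mono)
    fix w
    have "(\<Sum>i<n. indicator {w. uncrossed n i w} w :: real) = real (card {i. i < n \<and> uncrossed n i w})"
      by (simp add: indicator_def sum.If_cases Int_def)
    then show "(\<Sum>i<n. indicator {w. uncrossed n i w} w) \<le> real (seg_dist 0 n w)"
      using card_uncrossed_le[of n w] by simp
  qed simp
  finally show ?thesis .
qed

text \<open>Subadditivity gives the limit of the means and uncrossed bonds make it positive. A
  deviation of \<open>\<epsilon> * n\<close> from \<open>\<gamma> * n\<close> is split into halves:
  one for the mean, which lies within it eventually, and one for the fluctuation.\<close>

theorem line_speed:
  assumes "\<beta> > 0" "s > 2"
  obtains \<gamma> where "0 < \<gamma>" "\<gamma> \<le> 1"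
    "\<And>\<epsilon>. \<epsilon> > 0 \<Longrightarrow> (\<lambda>n. measure_pmf.prob (line_field s \<beta> n)
      {w. \<epsilon> * real n \<le> \<bar>real (seg_dist 0 n w) - \<gamma> * real n\<bar>}) \<longlonglongrightarrow> 0"
proof -
  let ?c = "exp (- \<beta> * (\<Sum>k. real k powr (1 - s)))"
  obtain \<gamma> where \<gamma>: "(\<lambda>n. mean_dist s \<beta> n / real n) \<longlonglongrightarrow> \<gamma>"
    using fekete_subadditive[of "mean_dist s \<beta>"] mean_dist_subadditive mean_dist_nonneg mean_dist_le
    by blast
  have c_le: "?c \<le> \<gamma>"
  proof (rule LIMSEQ_le_const[OF \<gamma>], intro exI[of _ 1] allI impI)
    fix n :: nat assume "1 \<le> n"
    then show "?c \<le> mean_dist s \<beta> n / real n"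
      using mean_dist_ge[OF assms, of n] by (simp add: field_simps)
  qed
  moreover have "\<gamma> \<le> 1"
  proof (rule LIMSEQ_le_const2[OF \<gamma>], intro exI[of _ 1] allI impI)
    fix n :: nat assume "1 \<le> n"
    then show "mean_dist s \<beta> n / real n \<le> 1"
      using mean_dist_le[of s \<beta> n] by (simp add: field_simps)
  qed
  moreover have "(\<lambda>n. measure_pmf.prob (line_field s \<beta> n)
      {w. \<epsilon> * real n \<le> \<bar>real (seg_dist 0 n w) - \<gamma> * real n\<bar>}) \<longlonglongrightarrow> 0" if \<epsilon>: "\<epsilon> > 0" for \<epsilon>
  proof -
    obtain n0 where n0: "\<And>n. n \<ge> n0 \<Longrightarrow> \<bar>mean_dist s \<beta> n / real n - \<gamma>\<bar> < \<epsilon> / 2"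
      using LIMSEQ_D[OF \<gamma>, of "\<epsilon> / 2"] \<epsilon> by auto
    have "measure_pmf.prob (line_field s \<beta> n) {w. \<epsilon> * real n \<le> \<bar>real (seg_dist 0 n w) - \<gamma> * real n\<bar>} \<le>
        \<beta> / (\<epsilon> / 2)\<^sup>2 * ((\<Sum>k=1..n. real k powr (2 - s)) / real n)" if n: "n \<ge> max 1 n0" for n
    proof -
      have "\<bar>mean_dist s \<beta> n - \<gamma> * real n\<bar> = \<bar>mean_dist s \<beta> n / real n - \<gamma>\<bar> * real n"
      proof -
        have "mean_dist s \<beta> n - \<gamma> * real n = (mean_dist s \<beta> n / real n - \<gamma>) * real n"
          using n by (simp add: left_diff_distrib)
        then show ?thesis by (simp add: abs_mult)
      qed
      also have "\<dots> \<le> \<epsilon> / 2 * real n"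
        using n0[of n] n by (intro mult_right_mono) auto
      finally have *: "\<bar>mean_dist s \<beta> n - \<gamma> * real n\<bar> \<le> \<epsilon> / 2 * real n" .
      have "measure_pmf.prob (line_field s \<beta> n) {w. \<epsilon> * real n \<le> \<bar>real (seg_dist 0 n w) - \<gamma> * real n\<bar>} \<le>
          measure_pmf.prob (line_field s \<beta> n) {w. \<epsilon> / 2 * real n \<le> \<bar>real (seg_dist 0 n w) - mean_dist s \<beta> n\<bar>}"
        by (rule prob_le_cong_set_pmf) (use * in linarith)
      also have "\<dots> \<le> \<beta> / (\<epsilon> / 2)\<^sup>2 * ((\<Sum>k=1..n. real k powr (2 - s)) / real n)"
        using assms \<epsilon> n by (intro line_deviation_le) auto
      finally show ?thesis .
    qed
    then have "\<forall>\<^sub>F n in sequentially. measure_pmf.prob (line_field s \<beta> n)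
        {w. \<epsilon> * real n \<le> \<bar>real (seg_dist 0 n w) - \<gamma> * real n\<bar>} \<le>
        \<beta> / (\<epsilon> / 2)\<^sup>2 * ((\<Sum>k=1..n. real k powr (2 - s)) / real n)"
      using eventually_ge_at_top[of "max 1 n0"] by (rule eventually_mono[rotated])
    moreover have "(\<lambda>n. \<beta> / (\<epsilon> / 2)\<^sup>2 * ((\<Sum>k=1..n. real k powr (2 - s)) / real n)) \<longlonglongrightarrow> 0"
      by (rule tendsto_mult_right_zero[OF mean_powr_tendsto_0[OF assms(2)]])
    ultimately show ?thesis
      by (rule tendsto_0_le[OF measure_nonneg])
  qed
  moreover have "0 < \<gamma>"
    by (rule less_le_trans[OF exp_gt_zero c_le])
  ultimately show ?thesis
    by (intro that[of \<gamma>])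
qed

subsection \<open>Linear diameter\<close>

lemma cycle_dist_short:
  assumes "x < y" "y \<le> n" "2 * n \<le> N"
  shows "cycle_dist N (x + u) (y + u) = int (y - x)"
  using assms by (auto simp: cycle_dist_def min_def)

text \<open>Within an arc of at most half the cycle, the cycle distance is the difference of the
  vertices, so the arc has the edge probabilities of the line.\<close>

lemma seg_dist_lrp_law:
  assumes "2 * n \<le> N" "u + n < N"
  shows "map_pmf (seg_dist u n) (lrp_field s \<beta> N) = map_pmf (seg_dist 0 n) (line_field s \<beta> n)"
  unfolding lrp_field_def
proof (rule seg_dist_law)
  fix x y assume "x < y" "y \<le> n"
  moreover from this have "int (y - x) = 1 \<longleftrightarrow> y = Suc x" by auto
  ultimately show "(case (x + u, y + u) of (x, y) \<Rightarrow> edge_prob s \<beta> N x y) = line_prob s \<beta> (x, y)"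
    using cycle_dist_short[of x y n N u] assms by (simp add: edge_prob_def line_prob_def)
qed (use assms in \<open>auto simp: pairs_def finite_pairs[unfolded pairs_def]\<close>)

lemma seg_subset_edges:
  assumes "w \<in> set_pmf (lrp_field s \<beta> N)" "u + n < N"
  shows "seg u n w \<subseteq> edges N w"
proof
  fix e assume "e \<in> seg u n w"
  then obtain x y where e: "e = {x, y}" "x < y" "y \<le> u + n" "y = Suc x \<or> w (x, y)"
    by (auto simp: seg_def)
  show "e \<in> edges N w"
  proof (cases "y = Suc x")
    case True
    then show ?thesis
      using lrp_graph_cycle_edge[OF edges_lrp_field[OF assms(1)], of x] e assms(2) by simp
  next
    case False
    then show ?thesis
      using e assms(2) by (simp add: mem_edges)
  qed
qed

lemma lrp_wrap_edge:
  assumes "w \<in> set_pmf (lrp_field s \<beta> N)" "N \<ge> 3"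
  shows "w (0, N - 1)"
proof (rule bern_field_certain[OF finite_pairs _ _ assms(1)[unfolded lrp_field_def]])
  show "(0, N - 1) \<in> pairs N"
    using assms(2) by (simp add: pairs_def)
  show "(case (0, N - 1) of (x, y) \<Rightarrow> edge_prob s \<beta> N x y) = 1"
    using assms(2) by (simp add: edge_prob_def cycle_dist_def)
qed

lemma lrp_wrap_adj:
  assumes "w \<in> set_pmf (lrp_field s \<beta> N)" "N \<ge> 3"
  shows "(0, N - 1) \<in> adj (edges N w)"
  using lrp_wrap_edge[OF assms] assms(2) by (simp add: adj_edges)

text \<open>The points \<open>i n\<close> for \<open>i \<le> K\<close> divide the cycle into \<open>K\<close> arcs of length \<open>n\<close> and a short
  remainder, and the shorter way round between two of them has at most \<open>K / 2\<close> arcs.\<close>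
lemma graph_dist_grid_le:
  fixes \<rho> :: real
  assumes conn: "\<And>x y. x < N \<Longrightarrow> y < N \<Longrightarrow> reach E x y"
    and nn: "\<And>x y. x \<le> y \<Longrightarrow> y < N \<Longrightarrow> graph_dist E x y \<le> y - x"
    and wrap: "(0, N - 1) \<in> adj E"
    and K: "K \<ge> 1" and n: "n = (N - 1) div K" and N: "N \<ge> 1"
    and arcs: "\<And>i. i < K \<Longrightarrow> real (graph_dist E (i * n) (i * n + n)) \<le> \<rho>"
    and x: "x < N" and y: "y < N"
  shows "real (graph_dist E x y) \<le> real K * \<rho> / 2 + 2 * real n + 3 * real K"
proof -
  have Kn: "K * n \<le> N - 1" "N - 1 < K * n + K"
    using mult_div_mod_eq[of K "N - 1"] mod_less_divisor[of K "N - 1"] K unfolding n by linarith+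
  have gN: "i * n < N" if "i \<le> K" for i
  proof -
    have "i * n \<le> K * n" using that by simp
    with Kn N show ?thesis by linarith
  qed
  have tri: "real (graph_dist E a c) \<le> real (graph_dist E a b) + real (graph_dist E b c)"
    if "a < N" "b < N" "c < N" for a b c
    using graph_dist_triangle[OF conn conn, of a b c] that by (simp flip: of_nat_add)
  have chain: "real (graph_dist E (i * n) ((i + k) * n)) \<le> real k * \<rho>" if "i + k \<le> K" for i k
    using that
  proof (induction k)
    case (Suc k)
    have "real (graph_dist E (i * n) ((i + Suc k) * n)) \<le>
        real (graph_dist E (i * n) ((i + k) * n)) + real (graph_dist E ((i + k) * n) ((i + Suc k) * n))"
      using Suc.prems gN[of i] gN[of "i + k"] gN[of "i + Suc k"] by (intro tri) auto
    moreover have "real (graph_dist E ((i + k) * n) ((i + Suc k) * n)) \<le> \<rho>"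
      using arcs[of "i + k"] Suc.prems by (simp add: algebra_simps)
    ultimately show ?case
      using Suc by (simp add: algebra_simps)
  qed simp
  \<comment> \<open>Fewer than \<open>K\<close> unit steps lead from \<open>K * n\<close> to
    \<open>N - 1\<close>, and the wrap edge closes the cycle.\<close>
  have ends: "real (graph_dist E 0 (K * n)) \<le> real K"
  proof -
    have "graph_dist E (K * n) (N - 1) \<le> N - 1 - K * n"
      using Kn N by (intro nn) auto
    then have "real (graph_dist E (K * n) (N - 1)) + 1 \<le> real K"
      using Kn by linarith
    moreover have "real (graph_dist E 0 (K * n)) \<le>
        real (graph_dist E 0 (N - 1)) + real (graph_dist E (N - 1) (K * n))"
      using N gN[of K] by (intro tri) auto
    ultimately show ?thesis
      using graph_dist_adj[OF wrap] graph_dist_sym[of E "N - 1" "K * n"] by linarith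
  qed
  have grid: "real (graph_dist E (i * n) (j * n)) \<le> real K * \<rho> / 2 + real K" if "i \<le> j" "j \<le> K" for i j
  proof -
    have 1: "real (graph_dist E (i * n) (j * n)) \<le> real (j - i) * \<rho>"
      using chain[of i "j - i"] that by simp
    have "real (graph_dist E (i * n) (j * n)) \<le>
        real (graph_dist E (i * n) 0) + (real (graph_dist E 0 (K * n)) + real (graph_dist E (K * n) (j * n)))"
      using tri[of "i * n" 0 "j * n"] tri[of 0 "K * n" "j * n"] gN that N by fastforce
    moreover have "real (graph_dist E (i * n) 0) \<le> real i * \<rho>"
      using chain[of 0 i] that graph_dist_sym[of E 0 "i * n"] by simp
    moreover have "real (graph_dist E (K * n) (j * n)) \<le> real (K - j) * \<rho>"
      using chain[of j "K - j"] that graph_dist_sym[of E "j * n" "K * n"] by simp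
    ultimately have "real (graph_dist E (i * n) (j * n)) \<le> real i * \<rho> + real K + real (K - j) * \<rho>"
      using ends by linarith
    \<comment> \<open>Adding the two ways round avoids deciding which is shorter: together they use
      exactly \<open>K\<close> arcs, so twice the distance is at most
      \<open>K * \<rho> + K\<close>.\<close>
    with 1 have "2 * real (graph_dist E (i * n) (j * n)) \<le>
        (real (j - i) * \<rho> + real i * \<rho> + real (K - j) * \<rho>) + real K"
      by linarith
    also have "real (j - i) * \<rho> + real i * \<rho> + real (K - j) * \<rho> = real K * \<rho>"
      using that by (simp add: of_nat_diff algebra_simps)
    finally show ?thesis by simp
  qed
  have near: "\<exists>i\<le>K. real (graph_dist E (i * n) z) \<le> real n + real K" if z: "z < N" for z
  proof -
    \<comment> \<open>The cap \<open>K\<close> serves vertices in the remainder beyond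
      \<open>K * n\<close>; if \<open>n = 0\<close>, every vertex is within \<open>K\<close> of
      0.\<close>
    define i where "i = (if n = 0 then 0 else min (z div n) K)"
    have i: "i * n \<le> z" "z \<le> i * n + n + K"
    proof -
      show "i * n \<le> z"
        by (auto simp: i_def min_def) (metis div_times_less_eq_dividend le_trans mult_le_mono1 nat_le_linear)
      show "z \<le> i * n + n + K"
      proof (cases "n \<noteq> 0 \<and> z div n \<le> K")
        case True
        then have "i = z div n" by (simp add: i_def)
        then show ?thesis
          using True dividend_less_div_times[of n z] by (simp add: add.commute)
      next
        case False
        then show ?thesis using Kn z by (auto simp: i_def)
      qed
    qed
    have "graph_dist E (i * n) z \<le> z - i * n"
      using i z by (intro nn) auto
    then have "real (graph_dist E (i * n) z) \<le> real n + real K"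
      using i by linarith
    moreover have "i \<le> K" by (simp add: i_def)
    ultimately show ?thesis by blast
  qed
  obtain i j where ij: "i \<le> K" "j \<le> K" "real (graph_dist E (i * n) x) \<le> real n + real K"
      "real (graph_dist E (j * n) y) \<le> real n + real K"
    using near[OF x] near[OF y] by blast
  have "real (graph_dist E (i * n) (j * n)) \<le> real K * \<rho> / 2 + real K"
    using grid[of i j] grid[of j i] ij graph_dist_sym[of E "i * n" "j * n"] by (cases "i \<le> j") auto
  moreover have "real (graph_dist E x y) \<le>
      real (graph_dist E x (i * n)) + (real (graph_dist E (i * n) (j * n)) + real (graph_dist E (j * n) y))"
    using tri[of x "i * n" y] tri[of "i * n" "j * n" y] gN ij x y by fastforce
  ultimately show ?thesis
    using ij graph_dist_sym[of E x "i * n"] by linarith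
qed

lemma filterlim_div_at_top:
  assumes "K \<ge> 1"
  shows "filterlim (\<lambda>N::nat. (N - 1) div K) sequentially sequentially"
  unfolding filterlim_at_top
proof
  fix Z :: nat
  have "Z \<le> (N - 1) div K" if "N \<ge> Z * K + 1" for N
  proof -
    have "Z * K \<le> N - 1" using that by simp
    then show ?thesis using assms by (simp add: less_eq_div_iff_mult_less_eq)
  qed
  then show "\<forall>\<^sub>F N in sequentially. Z \<le> (N - 1) div K"
    using eventually_ge_at_top[of "Z * K + 1"] by (rule eventually_mono[rotated])
qed

text \<open>\<open>K\<close> stays fixed while \<open>N\<close> grows. The union bound over the arcs
  thus costs only a factor \<open>K\<close>, and the arc length tends to infinity, so the speed on
  the line applies to each arc.\<close>

lemma lrp_diameter_upper:
  assumes "\<beta> > 0" "s > 2" and \<gamma>: "0 < \<gamma>"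
    and conv: "\<And>\<epsilon>. \<epsilon> > 0 \<Longrightarrow> (\<lambda>n. measure_pmf.prob (line_field s \<beta> n)
      {w. \<epsilon> * real n \<le> \<bar>real (seg_dist 0 n w) - \<gamma> * real n\<bar>}) \<longlonglongrightarrow> 0"
    and \<epsilon>: "\<epsilon> > 0"
  shows "(\<lambda>N. measure_pmf.prob (lrp_graph s \<beta> N)
    {E. real (graph_diameter {..<N} E) > (\<gamma> / 2 + \<epsilon>) * real N}) \<longlonglongrightarrow> 0"
proof -
  \<comment> \<open>The error \<open>\<epsilon> * N\<close> is spent as follows: half on the
    deviations of the arcs, a quarter on \<open>2 * n\<close>, by
    \<open>K \<ge> 8 / \<epsilon>\<close>, and a quarter on \<open>3 * K\<close>, by
    \<open>N > 12 * K / \<epsilon>\<close>. Having \<open>K \<ge> 2\<close> keeps each arc within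
    half the cycle.\<close>
  obtain K0 :: nat where K0: "8 / \<epsilon> < real K0"
    using reals_Archimedean2 by blast
  define K where "K = max 2 K0"
  have K: "K \<ge> 2" "8 / \<epsilon> \<le> real K" using K0 by (auto simp: K_def)
  define n where "n N = (N - 1) div K" for N
  let ?p = "\<lambda>n. measure_pmf.prob (line_field s \<beta> n) {w. \<epsilon> * real n \<le> \<bar>real (seg_dist 0 n w) - \<gamma> * real n\<bar>}"
  have lim: "(\<lambda>N. real K * ?p (n N)) \<longlonglongrightarrow> 0"
    using filterlim_compose[OF conv[OF \<epsilon>] filterlim_div_at_top[of K]] K
    unfolding n_def by (intro tendsto_mult_right_zero) auto
  obtain N0 :: nat where N0: "12 * real K / \<epsilon> < real N0"
    using reals_Archimedean2 by blast
  have "measure_pmf.prob (lrp_graph s \<beta> N) {E. real (graph_diameter {..<N} E) > (\<gamma> / 2 + \<epsilon>) * real N} \<le>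
      real K * ?p (n N)" if N: "N \<ge> max N0 3" for N
  proof -
    have Kn: "K * n N < N"
      using N times_div_less_eq_dividend[of K "N - 1"] unfolding n_def by linarith
    have "measure_pmf.prob (lrp_field s \<beta> N)
        {w. real (graph_diameter {..<N} (edges N w)) > (\<gamma> / 2 + \<epsilon>) * real N} \<le>
      measure_pmf.prob (lrp_field s \<beta> N)
        {w. \<exists>i\<in>{..<K}. \<epsilon> * real (n N) \<le> \<bar>real (seg_dist (i * n N) (n N) w) - \<gamma> * real (n N)\<bar>}"
    proof (rule prob_le_cong_set_pmf, rule ccontr)
      fix w assume w: "w \<in> set_pmf (lrp_field s \<beta> N)"
        and D: "(\<gamma> / 2 + \<epsilon>) * real N < real (graph_diameter {..<N} (edges N w))"
        and good: "\<not> (\<exists>i\<in>{..<K}. \<epsilon> * real (n N) \<le> \<bar>real (seg_dist (i * n N) (n N) w) - \<gamma> * real (n N)\<bar>)"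
      let ?E = "edges N w"
      have arcs: "real (graph_dist ?E (i * n N) (i * n N + n N)) \<le> (\<gamma> + \<epsilon>) * real (n N)" if "i < K" for i
      proof -
        have "i * n N + n N \<le> K * n N"
          using mult_le_mono1[of "Suc i" K "n N"] that by simp
        then have lt: "i * n N + n N < N" using Kn by linarith
        have "graph_dist ?E (i * n N) (i * n N + n N) \<le> seg_dist (i * n N) (n N) w"
          unfolding seg_dist_def using seg_subset_edges[OF w lt]
          by (intro graph_dist_mono reach_seg) auto
        then have "real (graph_dist ?E (i * n N) (i * n N + n N)) \<le> real (seg_dist (i * n N) (n N) w)"
          by simp
        also have "\<dots> \<le> (\<gamma> + \<epsilon>) * real (n N)"
          using good that by (force simp: algebra_simps abs_less_iff not_le)
        finally show ?thesis .
      qed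
      have bound: "real (graph_dist ?E x y) \<le> (\<gamma> / 2 + \<epsilon>) * real N" if "x < N" "y < N" for x y
      proof -
        have "real (graph_dist ?E x y) \<le> real K * ((\<gamma> + \<epsilon>) * real (n N)) / 2 + 2 * real (n N) + 3 * real K"
          by (rule graph_dist_grid_le[OF reach_lrp[OF w] graph_dist_lrp_le_diff[OF w]
                lrp_wrap_adj[OF w] _ n_def _ arcs]) (use that N K in auto)
        also have "real K * ((\<gamma> + \<epsilon>) * real (n N)) / 2 \<le> (\<gamma> + \<epsilon>) * real N / 2"
        proof -
          have "(\<gamma> + \<epsilon>) * (real K * real (n N)) \<le> (\<gamma> + \<epsilon>) * real N"
            using Kn \<gamma> \<epsilon> by (intro mult_left_mono) (auto simp flip: of_nat_mult)
          then show ?thesis by (simp add: mult_ac)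
        qed
        also have "2 * real (n N) \<le> \<epsilon> / 4 * real N"
        proof -
          have "8 * real (n N) \<le> \<epsilon> * real K * real (n N)"
            using K(2) \<epsilon> by (intro mult_right_mono) (auto simp: field_simps)
          also have "\<dots> = \<epsilon> * real (K * n N)" by simp
          also have "\<dots> \<le> \<epsilon> * real N"
            using Kn \<epsilon> by (intro mult_left_mono) (simp_all only: of_nat_le_iff less_imp_le)
          finally show ?thesis by simp
        qed
        also have "3 * real K \<le> \<epsilon> / 4 * real N"
        proof -
          have "12 * real K / \<epsilon> \<le> real N" using N0 N by linarith
          then show ?thesis using \<epsilon> by (simp add: field_simps)
        qed
        finally show ?thesis by (simp add: field_simps)
      qed
      have "graph_diameter {..<N} ?E \<le> nat \<lfloor>(\<gamma> / 2 + \<epsilon>) * real N\<rfloor>"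
        using N bound by (subst lrp_diameter_le_iff) (auto simp: le_nat_floor)
      moreover have "real (nat \<lfloor>(\<gamma> / 2 + \<epsilon>) * real N\<rfloor>) \<le> (\<gamma> / 2 + \<epsilon>) * real N"
        using \<gamma> \<epsilon> by simp
      ultimately show False using D by linarith
    qed
    also have "\<dots> \<le> (\<Sum>i<K. measure_pmf.prob (lrp_field s \<beta> N)
        {w. \<epsilon> * real (n N) \<le> \<bar>real (seg_dist (i * n N) (n N) w) - \<gamma> * real (n N)\<bar>})"
      by (rule prob_Bex_le) simp
    also have "\<dots> = (\<Sum>i<K. ?p (n N))"
    proof (rule sum.cong[OF refl])
      fix i assume "i \<in> {..<K}"
      then have "i * n N + n N \<le> K * n N"
        using mult_le_mono1[of "Suc i" K "n N"] by simp
      then have lt: "i * n N + n N < N" using Kn by linarith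
      have "2 * n N \<le> K * n N" using K by simp
      then have "2 * n N \<le> N" using Kn by linarith
      from seg_dist_lrp_law[OF this lt]
      show "measure_pmf.prob (lrp_field s \<beta> N)
          {w. \<epsilon> * real (n N) \<le> \<bar>real (seg_dist (i * n N) (n N) w) - \<gamma> * real (n N)\<bar>} = ?p (n N)"
        by (rule prob_seg_dist_law)
    qed
    also have "\<dots> = real K * ?p (n N)" by simp
    finally show ?thesis by (simp only: prob_lrp_graph)
  qed
  then have "\<forall>\<^sub>F N in sequentially. measure_pmf.prob (lrp_graph s \<beta> N)
      {E. real (graph_diameter {..<N} E) > (\<gamma> / 2 + \<epsilon>) * real N} \<le> real K * ?p (n N)"
    using eventually_ge_at_top[of "max N0 3"] by (rule eventually_mono[rotated])
  from tendsto_0_le[OF measure_nonneg this lim] show ?thesis .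
qed

section \<open>Linear lower bound on the cycle\<close>

text \<open>The edges are put back one at a time. Reachability and the distances between their ends
  can only improve meanwhile, so hypotheses on \<open>G\<close> alone suffice.\<close>

lemma graph_dist_remove_edges:
  fixes l :: "'a \<times> 'a \<Rightarrow> nat"
  assumes "finite F" and ab: "reach G a b"
    and F: "\<And>x y. (x, y) \<in> F \<Longrightarrow> reach G a x \<and> reach G x y \<and> graph_dist G x y \<le> l (x, y)"
  shows "graph_dist G a b \<le> graph_dist (G \<union> (\<lambda>(x, y). {x, y}) ` F) a b + (\<Sum>e\<in>F. l e)"
  using assms(1) F
proof (induction F rule: finite_induct)
  case (insert e F)
  obtain x y where e: "e = (x, y)" by fastforce
  let ?H = "G \<union> (\<lambda>(x, y). {x, y}) ` F"
  have xy: "reach G a x" "reach G x y" "graph_dist G x y \<le> l e"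
    using insert.prems e by auto
  have "graph_dist ?H a b \<le> graph_dist (insert {x, y} ?H) a b + l e"
  proof (rule graph_dist_insert)
    show "graph_dist ?H x y \<le> l e"
      using graph_dist_mono[OF xy(2), of ?H] xy(3) by auto
  qed (use reach_mono[OF xy(1)] reach_mono[OF xy(2)] reach_mono[OF ab] in auto)
  then show ?case
    using insert by (fastforce simp: e)
qed simp

text \<open>The pairs that join the two arcs away from \<open>h\<close>. The wrap edge is exempted:
  it keeps the cycle intact for detours, and it only links the starting point to the far end of the
  other arc.\<close>

definition crossing :: "nat \<Rightarrow> nat \<Rightarrow> (nat \<times> nat) set" where
  "crossing N h = {(x, y). x < h \<and> h < y \<and> y < N \<and> (x, y) \<noteq> (0, N - 1)}"

lemma finite_crossing [simp]: "finite (crossing N h)"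
  by (rule finite_subset[OF _ finite_pairs[of N]]) (auto simp: crossing_def pairs_def)

definition crossing_length :: "nat \<Rightarrow> nat \<Rightarrow> (nat \<times> nat \<Rightarrow> bool) \<Rightarrow> nat" where
  "crossing_length N h w =
    (\<Sum>(x, y)\<in>{e \<in> crossing N h. w e}. nat (cycle_dist N x y))"

text \<open>Once the crossing edges are removed, a walk from \<open>0\<close> to \<open>h\<close> must traverse one of the
  two arcs.\<close>
lemma arcs_le_graph_dist:
  assumes w: "w \<in> set_pmf (lrp_field s \<beta> N)" and h: "0 < h" "h < N - 1"
  shows "min (seg_dist 0 h w) (seg_dist h (N - 1 - h) w) \<le>
    graph_dist (edges N w) 0 h + crossing_length N h w"
proof -
  define F where "F = {e \<in> crossing N h. w e}"
  define G where "G = edges N w - (\<lambda>(x, y). {x, y}) ` F"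
  have finF: "finite F" by (simp add: F_def)
  have adjG: "(x, y) \<in> adj G \<longleftrightarrow> y < N \<and> w (x, y) \<and> (x, y) \<notin> crossing N h" if "x < y" for x y
  proof -
    have "{x, y} \<in> (\<lambda>(x, y). {x, y}) ` F \<longleftrightarrow> (x, y) \<in> F"
    proof
      assume "{x, y} \<in> (\<lambda>(x, y). {x, y}) ` F"
      then obtain a b where ab: "(a, b) \<in> F" "{x, y} = {a, b}" by force
      then have "a < b" by (simp add: F_def crossing_def)
      with ab that show "(x, y) \<in> F" by (auto simp: doubleton_eq_iff)
    qed force
    then show ?thesis
      using mem_edges[OF that, of N w] unfolding adj_def G_def F_def by auto
  qed
  have succ: "(i, Suc i) \<in> adj G" if "Suc i < N" for i
    using lrp_succ_adj[OF w that] that by (simp add: adjG adj_edges) (simp add: crossing_def)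
  have wrap: "(0, N - 1) \<in> adj G"
    using lrp_wrap_edge[OF w] h by (simp add: adjG) (simp add: crossing_def)
  have lineG: "(x, y) \<in> adj G ^^ (y - x)" if "x \<le> y" "y < N" for x y
    using line_walk[of x "y - x" G] succ that by simp
  have reachG: "reach G x y" if "x < N" "y < N" for x y
  proof (cases "x \<le> y")
    case True
    then show ?thesis using lineG that by (blast intro: reachI)
  next
    case False
    then show ?thesis using lineG[of y x] that by (intro reach_sym[OF reachI]) auto
  qed
  \<comment> \<open>The unit edges and the wrap edge survive in \<open>G\<close>, so both ways round
    the cycle are available as detours for a deleted edge.\<close>
  have distG: "graph_dist G x y \<le> nat (cycle_dist N x y)" if "x < y" "y < N" for x y
  proof -
    have 1: "graph_dist G x y \<le> y - x"
      using lineG that by (intro graph_dist_le) auto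
    have "graph_dist G x y \<le> graph_dist G x 0 + (graph_dist G 0 (N - 1) + graph_dist G (N - 1) y)"
      using graph_dist_triangle[OF reachG reachG, of x 0 y] graph_dist_triangle[OF reachG reachG, of 0 "N - 1" y]
        that by fastforce
    moreover have "graph_dist G x 0 \<le> x"
      using graph_dist_le[OF lineG[of 0 x]] that graph_dist_sym[of G x 0] by simp
    moreover have "graph_dist G (N - 1) y \<le> N - 1 - y"
      using graph_dist_le[OF lineG[of y "N - 1"]] that graph_dist_sym[of G "N - 1" y] by simp
    ultimately have "graph_dist G x y \<le> N - (y - x)"
      using graph_dist_adj[OF wrap] that by linarith
    with 1 show ?thesis
      using cycle_dist_cases[OF that] by auto
  qed
  have E: "G \<union> (\<lambda>(x, y). {x, y}) ` F = edges N w"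
  proof -
    have "(\<lambda>(x, y). {x, y}) ` F \<subseteq> edges N w"
      by (auto simp: F_def crossing_def mem_edges)
    then show ?thesis by (auto simp: G_def)
  qed
  have "graph_dist G 0 h \<le> graph_dist (edges N w) 0 h + (\<Sum>e\<in>F. nat (cycle_dist N (fst e) (snd e)))"
    unfolding E[symmetric]
  proof (rule graph_dist_remove_edges[OF finF reachG])
    fix x y assume "(x, y) \<in> F"
    then show "reach G 0 x \<and> reach G x y \<and>
        graph_dist G x y \<le> nat (cycle_dist N (fst (x, y)) (snd (x, y)))"
      using reachG distG[of x y] by (auto simp: F_def crossing_def)
  qed (use h in auto)
  also have "(\<Sum>e\<in>F. nat (cycle_dist N (fst e) (snd e))) = crossing_length N h w"
    by (simp add: crossing_length_def F_def case_prod_unfold)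
  finally have upper: "graph_dist G 0 h \<le> graph_dist (edges N w) 0 h + crossing_length N h w" .
  let ?m = "N - 1 - h"
  define L where "L = min (seg_dist 0 h w) (seg_dist h ?m w)"
  \<comment> \<open>The distance from 0 within the left arc and from \<open>N - 1\<close> within the
    right arc. Truncation at \<open>L\<close> makes the two pieces agree at \<open>h\<close>, where
    both equal \<open>L\<close>; at both ends of the wrap edge the value is 0.\<close>
  define \<phi> where "\<phi> z = (if z \<le> h then real (min (graph_dist (seg 0 h w) 0 z) L)
    else real (min (graph_dist (seg h ?m w) (N - 1) z) L))" for z
  have hm: "h + ?m = N - 1" using h by simp
  have \<phi>_right: "\<phi> z = real (min (graph_dist (seg h ?m w) (N - 1) z) L)" if "h \<le> z" for z
  proof (cases "z = h")
    case True
    have "L \<le> graph_dist (seg 0 h w) 0 h" "L \<le> graph_dist (seg h ?m w) (N - 1) h"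
      using hm graph_dist_sym[of "seg h ?m w" "N - 1" h] by (auto simp: L_def seg_dist_def)
    then show ?thesis using True by (simp add: \<phi>_def)
  qed (use that in \<open>simp add: \<phi>_def\<close>)
  have min_lip: "\<bar>real (min a L) - real (min b L)\<bar> \<le> 1" if "a \<le> b + 1" "b \<le> a + 1" for a b
    using that by (auto simp: min_def)
  have seg_lip: "graph_dist (seg u m w) z y \<le> graph_dist (seg u m w) z x + 1 \<and>
      graph_dist (seg u m w) z x \<le> graph_dist (seg u m w) z y + 1"
    if xy: "u \<le> x" "x < y" "y \<le> u + m" "w (x, y)" and z: "u \<le> z" "z \<le> u + m" for u m x y z
  proof -
    have a: "(x, y) \<in> adj (seg u m w)" "(y, x) \<in> adj (seg u m w)"
      using xy by (auto simp: adj_seg)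
    have "graph_dist (seg u m w) z y \<le> graph_dist (seg u m w) z x + graph_dist (seg u m w) x y"
      "graph_dist (seg u m w) z x \<le> graph_dist (seg u m w) z y + graph_dist (seg u m w) y x"
      using xy z by (auto intro!: graph_dist_triangle reach_seg)
    with graph_dist_adj[OF a(1)] graph_dist_adj[OF a(2)] show ?thesis by linarith
  qed
  have lip: "\<bar>\<phi> x - \<phi> y\<bar> \<le> 1" if xy: "x < y" "(x, y) \<in> adj G" for x y
  proof -
    have e: "y < N" "w (x, y)" "(x, y) \<notin> crossing N h"
      using xy by (auto simp: adjG)
    have "y \<le> h \<or> h \<le> x \<or> x = 0 \<and> y = N - 1 \<and> h < y"
      using e(1,3) by (simp add: crossing_def) linarith
    then consider "y \<le> h" | "h \<le> x" | "x = 0" "y = N - 1" "h < y"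
      by blast
    then show ?thesis
    proof cases
      case 1
      have "\<phi> x = real (min (graph_dist (seg 0 h w) 0 x) L)"
        "\<phi> y = real (min (graph_dist (seg 0 h w) 0 y) L)"
        using 1 xy by (simp_all add: \<phi>_def)
      moreover have "graph_dist (seg 0 h w) 0 y \<le> graph_dist (seg 0 h w) 0 x + 1 \<and>
          graph_dist (seg 0 h w) 0 x \<le> graph_dist (seg 0 h w) 0 y + 1"
        using 1 xy e by (intro seg_lip) simp_all
      ultimately show ?thesis
        by (simp only: min_lip)
    next
      case 2
      have "\<phi> x = real (min (graph_dist (seg h ?m w) (N - 1) x) L)"
        "\<phi> y = real (min (graph_dist (seg h ?m w) (N - 1) y) L)"
        using 2 xy by (intro \<phi>_right; simp)+
      moreover have "graph_dist (seg h ?m w) (N - 1) y \<le> graph_dist (seg h ?m w) (N - 1) x + 1 \<and>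
          graph_dist (seg h ?m w) (N - 1) x \<le> graph_dist (seg h ?m w) (N - 1) y + 1"
        using 2 xy e hm h by (intro seg_lip) simp_all
      ultimately show ?thesis
        by (simp only: min_lip)
    next
      case 3
      then show ?thesis by (simp add: \<phi>_def)
    qed
  qed
  have "\<phi> b \<le> \<phi> a + 1" if ab: "(a, b) \<in> adj G" for a b
  proof -
    have "(a, b) \<in> adj (edges N w)"
      using ab by (simp add: adj_def G_def)
    then have "a \<noteq> b" by (auto simp: adj_edges)
    then consider "a < b" | "b < a" by linarith
    then show ?thesis
    proof cases
      case 1
      from lip[OF this ab] show ?thesis by linarith
    next
      case 2
      have "(b, a) \<in> adj G" using ab sym_adj[of a b G] by simp
      from lip[OF 2 this] show ?thesis by linarith
    qed
  qed
  from lipschitz_graph_dist[of G \<phi>, OF this reachG[of 0 h]]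
  have "\<phi> h - \<phi> 0 \<le> real (graph_dist G 0 h)" using h by simp
  moreover have "\<phi> 0 = 0" by (simp add: \<phi>_def)
  moreover have "\<phi> h = real L"
    by (simp add: \<phi>_def L_def seg_dist_def)
  ultimately have "L \<le> graph_dist G 0 h" by simp
  with upper show ?thesis by (simp add: L_def)
qed

text \<open>For either arc length, at most \<open>k\<close> crossing pairs have length
  \<open>k\<close>: their left end is one of the \<open>k\<close> vertices below \<open>h\<close>
  when the arc passes \<open>h\<close>, and one of the first \<open>k\<close> vertices when it
  passes 0.\<close>

lemma sum_crossing_le:
  fixes f :: "nat \<Rightarrow> real"
  assumes "\<And>k. 0 \<le> f k"
  shows "(\<Sum>e\<in>crossing N h. f (snd e - fst e) + f (N - (snd e - fst e))) \<le> 2 * (\<Sum>k=1..N. real k * f k)"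
proof -
  have "(\<Sum>e\<in>crossing N h. f (snd e - fst e)) \<le> (\<Sum>k=1..N. real k * f k)"
  proof (rule sum_by_length_le[OF finite_crossing])
    fix k :: nat
    have "{e \<in> crossing N h. snd e - fst e = k} \<subseteq> (\<lambda>x. (x, x + k)) ` {h - k..<h}"
      by (auto simp: crossing_def image_iff)
    then have "card {e \<in> crossing N h. snd e - fst e = k} \<le> card ((\<lambda>x. (x, x + k)) ` {h - k..<h})"
      by (intro card_mono) auto
    also have "\<dots> \<le> card {h - k..<h}"
      by (rule card_image_le) simp
    also have "\<dots> \<le> k" by simp
    finally show "card {e \<in> crossing N h. snd e - fst e = k} \<le> k" .
  qed (use assms in \<open>auto simp: crossing_def\<close>)
  moreover have "(\<Sum>e\<in>crossing N h. f (N - (snd e - fst e))) \<le> (\<Sum>k=1..N. real k * f k)"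
  proof (rule sum_by_length_le[OF finite_crossing, where L = "\<lambda>e. N - (snd e - fst e)"])
    fix k :: nat
    have "{e \<in> crossing N h. N - (snd e - fst e) = k} \<subseteq> (\<lambda>x. (x, x + (N - k))) ` {..<k}"
      by (auto simp: crossing_def image_iff)
    then have "card {e \<in> crossing N h. N - (snd e - fst e) = k} \<le> card ((\<lambda>x. (x, x + (N - k))) ` {..<k})"
      by (intro card_mono) auto
    also have "\<dots> \<le> card {..<k}"
      by (rule card_image_le) simp
    finally show "card {e \<in> crossing N h. N - (snd e - fst e) = k} \<le> k" by simp
  qed (use assms in \<open>auto simp: crossing_def\<close>)
  ultimately show ?thesis by (simp add: sum.distrib)
qed

text \<open>Markov's inequality. A crossing pair at distance \<open>k\<close> costs \<open>k\<close>
  with probability at most \<open>\<beta> * k powr (- s)\<close>, and the count of pairs of a given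
  length contributes another factor \<open>k\<close>. Certain edges do not occur, because crossing
  pairs are at distance at least 2.\<close>

lemma prob_crossing_length_ge:
  assumes "\<beta> > 0" "\<epsilon> > 0" "N > 0"
  shows "measure_pmf.prob (lrp_field s \<beta> N) {w. \<epsilon> * real N \<le> real (crossing_length N h w)} \<le>
    2 * \<beta> / \<epsilon> * ((\<Sum>k=1..N. real k powr (2 - s)) / real N)"
proof -
  let ?l = "\<lambda>e. real_of_int (cycle_dist N (fst e) (snd e))"
  have cr: "fst e < snd e" "snd e < N" "cycle_dist N (fst e) (snd e) \<ge> 2" "e \<in> pairs N"
    if "e \<in> crossing N h" for e
    using that by (auto simp: crossing_def pairs_def cycle_dist_def)
  have len: "real (crossing_length N h w) = (\<Sum>e\<in>crossing N h. ?l e * indicator {w. w e} w)" for w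
  proof -
    have "real (crossing_length N h w) = (\<Sum>e\<in>{e \<in> crossing N h. w e}. ?l e)"
      unfolding crossing_length_def of_nat_sum
      by (intro sum.cong refl) (use cr(3) in \<open>fastforce simp: case_prod_unfold\<close>)
    also have "\<dots> = (\<Sum>e\<in>crossing N h. if w e then ?l e else 0)"
      by (rule sum.inter_filter) simp
    also have "\<dots> = (\<Sum>e\<in>crossing N h. ?l e * indicator {w. w e} w)"
      by (intro sum.cong) auto
    finally show ?thesis .
  qed
  have "measure_pmf.prob (lrp_field s \<beta> N) {w. \<epsilon> * real N \<le> real (crossing_length N h w)} \<le>
      measure_pmf.expectation (lrp_field s \<beta> N) (\<lambda>w. real (crossing_length N h w)) / (\<epsilon> * real N)"
    unfolding lrp_field_def using assms by (intro markov_bern_field) auto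
  also have "measure_pmf.expectation (lrp_field s \<beta> N) (\<lambda>w. real (crossing_length N h w)) =
      (\<Sum>e\<in>crossing N h. ?l e * measure_pmf.prob (lrp_field s \<beta> N) {w. w e})"
    unfolding len lrp_field_def by (subst Bochner_Integration.integral_sum, simp) simp
  also have "\<dots> \<le> (\<Sum>e\<in>crossing N h. \<beta> * real (snd e - fst e) powr (1 - s) +
      \<beta> * real (N - (snd e - fst e)) powr (1 - s))"
  proof (rule sum_mono)
    fix e assume e: "e \<in> crossing N h"
    have pos: "?l e > 0" using cr(3)[OF e] by simp
    have "measure_pmf.prob (lrp_field s \<beta> N) {w. \<forall>e\<in>{e}. w e} =
        (\<Prod>e\<in>{e}. case e of (x, y) \<Rightarrow> edge_prob s \<beta> N x y)"
      unfolding lrp_field_def using cr(4)[OF e] edge_prob_bounds[OF assms(1)]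
      by (intro prob_all_open) (auto split: prod.splits)
    also have "\<dots> \<le> \<beta> * ?l e powr (- s)"
      using edge_prob_le[OF assms(1), of N "fst e" "snd e" s] cr(3)[OF e] by (simp add: case_prod_unfold)
    finally have "?l e * measure_pmf.prob (lrp_field s \<beta> N) {w. w e} \<le> ?l e * (\<beta> * ?l e powr (- s))"
      using pos by (intro mult_left_mono) auto
    also have "\<dots> = \<beta> * ?l e powr (1 - s)"
      using pos by (simp add: powr_diff powr_minus field_simps)
    also have "\<dots> \<le> \<beta> * (real (snd e - fst e) powr (1 - s) + real (N - (snd e - fst e)) powr (1 - s))"
      using assms cycle_dist_powr_le[OF cr(1,2)[OF e]] by (intro mult_left_mono) auto
    finally show "?l e * measure_pmf.prob (lrp_field s \<beta> N) {w. w e} \<le>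
        \<beta> * real (snd e - fst e) powr (1 - s) + \<beta> * real (N - (snd e - fst e)) powr (1 - s)"
      by (simp add: algebra_simps)
  qed
  also have "\<dots> \<le> 2 * (\<Sum>k=1..N. real k * (\<beta> * real k powr (1 - s)))"
    using assms by (intro sum_crossing_le[of "\<lambda>k. \<beta> * real k powr (1 - s)"]) auto
  also have "(\<Sum>k=1..N. real k * (\<beta> * real k powr (1 - s))) = \<beta> * (\<Sum>k=1..N. real k powr (2 - s))"
    unfolding sum_distrib_left
  proof (intro sum.cong refl)
    fix k assume "k \<in> {1..N}"
    then have "real k powr (2 - s) = real k powr 1 * real k powr (1 - s)"
      by (subst powr_add[symmetric]) simp
    then show "real k * (\<beta> * real k powr (1 - s)) = \<beta> * real k powr (2 - s)"
      by simp
  qed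
  also have "2 * (\<beta> * (\<Sum>k=1..N. real k powr (2 - s))) / (\<epsilon> * real N) =
      2 * \<beta> / \<epsilon> * ((\<Sum>k=1..N. real k powr (2 - s)) / real N)"
    by simp
  finally show ?thesis
    using assms by (simp add: divide_right_mono)
qed

text \<open>Outside three unlikely events (either arc is too short, or the crossing edges are too
  long in total) the distance from 0 to \<open>h N\<close> is at least
  \<open>(\<gamma> - \<epsilon>) * (N / 2 - 1) - \<epsilon> * N\<close>.\<close>

lemma lrp_diameter_lower:
  assumes "\<beta> > 0" "s > 2" and \<gamma>: "0 < \<gamma>"
    and conv: "\<And>\<epsilon>. \<epsilon> > 0 \<Longrightarrow> (\<lambda>n. measure_pmf.prob (line_field s \<beta> n)
      {w. \<epsilon> * real n \<le> \<bar>real (seg_dist 0 n w) - \<gamma> * real n\<bar>}) \<longlonglongrightarrow> 0"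
    and \<epsilon>: "0 < \<epsilon>" "\<epsilon> < \<gamma>"
  shows "(\<lambda>N. measure_pmf.prob (lrp_graph s \<beta> N)
    {E. real (graph_diameter {..<N} E) < (\<gamma> / 2 - 2 * \<epsilon>) * real N}) \<longlonglongrightarrow> 0"
proof -
  let ?p = "\<lambda>n. measure_pmf.prob (line_field s \<beta> n) {w. \<epsilon> * real n \<le> \<bar>real (seg_dist 0 n w) - \<gamma> * real n\<bar>}"
  let ?q = "\<lambda>N. 2 * \<beta> / \<epsilon> * ((\<Sum>k=1..N. real k powr (2 - s)) / real N)"
  define h where "h N = N div 2" for N :: nat
  define m where "m N = N - 1 - h N" for N
  have "filterlim h sequentially sequentially"
    unfolding filterlim_at_top
  proof
    fix Z :: nat
    show "\<forall>\<^sub>F N in sequentially. Z \<le> h N"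
      using eventually_ge_at_top[of "2 * Z"] by (rule eventually_mono) (auto simp: h_def)
  qed
  moreover have "filterlim m sequentially sequentially"
    unfolding filterlim_at_top
  proof
    fix Z :: nat
    show "\<forall>\<^sub>F N in sequentially. Z \<le> m N"
      using eventually_ge_at_top[of "2 * Z + 2"] by (rule eventually_mono) (auto simp: h_def m_def)
  qed
  ultimately have "(\<lambda>N. ?p (h N) + (?p (m N) + ?q N)) \<longlonglongrightarrow> 0 + (0 + 0)"
    by (intro tendsto_add filterlim_compose[OF conv[OF \<epsilon>(1)]]
        tendsto_mult_right_zero[OF mean_powr_tendsto_0[OF assms(2)]])
  then have lim: "(\<lambda>N. ?p (h N) + (?p (m N) + ?q N)) \<longlonglongrightarrow> 0" by simp
  \<comment> \<open>The arcs lose \<open>\<epsilon> * N / 2\<close> and the crossing edges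
    \<open>\<epsilon> * N\<close>. Of the allowance \<open>2 * \<epsilon> * N\<close> this leaves
    \<open>\<epsilon> * N / 2\<close>, which exceeds \<open>\<gamma>\<close> and so absorbs the
    rounding loss \<open>\<gamma> - \<epsilon>\<close>.\<close>
  obtain N0 :: nat where N0: "2 * \<gamma> / \<epsilon> < real N0"
    using reals_Archimedean2 by blast
  have "measure_pmf.prob (lrp_graph s \<beta> N) {E. real (graph_diameter {..<N} E) < (\<gamma> / 2 - 2 * \<epsilon>) * real N} \<le>
      ?p (h N) + (?p (m N) + ?q N)" if N: "N \<ge> max N0 4" for N
  proof -
    have hm: "0 < h N" "h N < N - 1" "h N + m N < N" "2 * h N \<le> N" "2 * m N \<le> N"
      using N by (auto simp: h_def m_def)
    let ?P = "measure_pmf.prob (lrp_field s \<beta> N)"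
    let ?B = "\<lambda>u n w. \<epsilon> * real n \<le> \<bar>real (seg_dist u n w) - \<gamma> * real n\<bar>"
    have "?P {w. real (graph_diameter {..<N} (edges N w)) < (\<gamma> / 2 - 2 * \<epsilon>) * real N} \<le>
      ?P {w. ?B 0 (h N) w \<or> (?B (h N) (m N) w \<or> \<epsilon> * real N \<le> real (crossing_length N (h N) w))}"
    proof (rule prob_le_cong_set_pmf, rule ccontr)
      fix w assume w: "w \<in> set_pmf (lrp_field s \<beta> N)"
        and D: "real (graph_diameter {..<N} (edges N w)) < (\<gamma> / 2 - 2 * \<epsilon>) * real N"
        and good: "\<not> (?B 0 (h N) w \<or> (?B (h N) (m N) w \<or> \<epsilon> * real N \<le> real (crossing_length N (h N) w)))"
      have long: "(\<gamma> - \<epsilon>) * (real N / 2 - 1) \<le> real (seg_dist u n w)"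
        if "\<not> ?B u n w" "real N / 2 - 1 \<le> real n" for u n
      proof -
        have "(\<gamma> - \<epsilon>) * (real N / 2 - 1) \<le> (\<gamma> - \<epsilon>) * real n"
          using that \<epsilon> by (intro mult_left_mono) auto
        also have "\<dots> \<le> real (seg_dist u n w)"
          using that(1) by (simp add: algebra_simps abs_less_iff not_le)
        finally show ?thesis .
      qed
      have "real N / 2 - 1 \<le> real (h N)" "real N / 2 - 1 \<le> real (m N)"
        using N by (simp_all add: h_def m_def)
      then have "(\<gamma> - \<epsilon>) * (real N / 2 - 1) \<le> real (min (seg_dist 0 (h N) w) (seg_dist (h N) (m N) w))"
        using long good by (auto simp: min_def)
      also have "\<dots> \<le> real (graph_dist (edges N w) 0 (h N)) + real (crossing_length N (h N) w)"
        using arcs_le_graph_dist[OF w hm(1,2)] by (simp add: m_def flip: of_nat_add)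
      also have "real (graph_dist (edges N w) 0 (h N)) \<le> real (graph_diameter {..<N} (edges N w))"
        using N hm by (simp add: graph_dist_le_diameter)
      also have "real (crossing_length N (h N) w) \<le> \<epsilon> * real N"
        using good by simp
      finally have "(\<gamma> - \<epsilon>) * (real N / 2 - 1) < (\<gamma> / 2 - 2 * \<epsilon>) * real N + \<epsilon> * real N"
        using D by simp
      then have 1: "\<epsilon> * real N < 2 * (\<gamma> - \<epsilon>)"
        by (simp add: field_simps)
      have 2: "2 * \<gamma> < \<epsilon> * real N"
      proof -
        have "2 * \<gamma> / \<epsilon> < real N" using N0 N by linarith
        then show ?thesis using \<epsilon> by (simp add: field_simps)
      qed
      from less_trans[OF 2 1] show False using \<epsilon> by simp
    qed
    also have "\<dots> \<le> ?P {w. ?B 0 (h N) w} +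
        ?P {w. ?B (h N) (m N) w \<or> \<epsilon> * real N \<le> real (crossing_length N (h N) w)}"
      by (rule prob_disj_le)
    also have "?P {w. ?B (h N) (m N) w \<or> \<epsilon> * real N \<le> real (crossing_length N (h N) w)} \<le>
        ?P {w. ?B (h N) (m N) w} + ?P {w. \<epsilon> * real N \<le> real (crossing_length N (h N) w)}"
      by (rule prob_disj_le)
    also have "?P {w. ?B 0 (h N) w} = ?p (h N)"
      using hm by (intro prob_seg_dist_law seg_dist_lrp_law) auto
    also have "?P {w. ?B (h N) (m N) w} = ?p (m N)"
      using hm by (intro prob_seg_dist_law seg_dist_lrp_law) auto
    also have "?P {w. \<epsilon> * real N \<le> real (crossing_length N (h N) w)} \<le> ?q N"
      using assms N by (intro prob_crossing_length_ge) auto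
    finally show ?thesis by (simp only: prob_lrp_graph)
  qed
  then have "\<forall>\<^sub>F N in sequentially. measure_pmf.prob (lrp_graph s \<beta> N)
      {E. real (graph_diameter {..<N} E) < (\<gamma> / 2 - 2 * \<epsilon>) * real N} \<le> ?p (h N) + (?p (m N) + ?q N)"
    using eventually_ge_at_top[of "max N0 4"] by (rule eventually_mono[rotated])
  from tendsto_0_le[OF measure_nonneg this lim] show ?thesis .
qed

section \<open>Convergence in distribution\<close>

theorem lrp_diameter_linear:
  assumes "\<beta> > 0" "s > 2"
  obtains \<eta> where "0 < \<eta>" "\<eta> \<le> 1"
    "\<And>c. \<eta> < c \<Longrightarrow> (\<lambda>N. measure_pmf.prob (lrp_graph s \<beta> N)
      {E. real (graph_diameter {..<N} E) > c * real N}) \<longlonglongrightarrow> 0"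
    "\<And>c. c < \<eta> \<Longrightarrow> (\<lambda>N. measure_pmf.prob (lrp_graph s \<beta> N)
      {E. real (graph_diameter {..<N} E) \<le> c * real N}) \<longlonglongrightarrow> 0"
proof -
  obtain \<gamma> where \<gamma>: "0 < \<gamma>" "\<gamma> \<le> 1" and conv: "\<And>\<epsilon>. \<epsilon> > 0 \<Longrightarrow> (\<lambda>n. measure_pmf.prob (line_field s \<beta> n)
      {w. \<epsilon> * real n \<le> \<bar>real (seg_dist 0 n w) - \<gamma> * real n\<bar>}) \<longlonglongrightarrow> 0"
    using line_speed[OF assms] by blast
  show ?thesis
  proof (rule that[of "\<gamma> / 2"])
    fix c :: real assume "\<gamma> / 2 < c"
    then show "(\<lambda>N. measure_pmf.prob (lrp_graph s \<beta> N)
        {E. real (graph_diameter {..<N} E) > c * real N}) \<longlonglongrightarrow> 0"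
      using lrp_diameter_upper[OF assms \<gamma>(1) conv, of "c - \<gamma> / 2"] by simp
  next
    fix c :: real assume c: "c < \<gamma> / 2"
    \<comment> \<open>Dividing by 3 leaves \<open>2 * \<epsilon>\<close> strictly below the gap
      \<open>\<gamma> / 2 - c\<close>; the cap \<open>\<gamma> / 2\<close> keeps
      \<open>\<epsilon> < \<gamma>\<close> even if \<open>c\<close> is very negative.\<close>
    define \<epsilon> where "\<epsilon> = min (\<gamma> / 2) ((\<gamma> / 2 - c) / 3)"
    have \<epsilon>: "0 < \<epsilon>" "\<epsilon> < \<gamma>" "c < \<gamma> / 2 - 2 * \<epsilon>"
    proof -
      have "\<epsilon> \<le> \<gamma> / 2" "\<epsilon> \<le> (\<gamma> / 2 - c) / 3"
        unfolding \<epsilon>_def by (rule min.cobounded1, rule min.cobounded2)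
      then show "\<epsilon> < \<gamma>" "c < \<gamma> / 2 - 2 * \<epsilon>"
        using c \<gamma> by (simp_all add: field_simps)
      show "0 < \<epsilon>"
        using c \<gamma> by (simp add: \<epsilon>_def)
    qed
    have "measure_pmf.prob (lrp_graph s \<beta> N) {E. real (graph_diameter {..<N} E) \<le> c * real N} \<le>
        measure_pmf.prob (lrp_graph s \<beta> N) {E. real (graph_diameter {..<N} E) < (\<gamma> / 2 - 2 * \<epsilon>) * real N}"
      if "N \<ge> 1" for N
    proof (rule prob_le_cong_set_pmf)
      fix E assume "real (graph_diameter {..<N} E) \<le> c * real N"
      also have "\<dots> < (\<gamma> / 2 - 2 * \<epsilon>) * real N"
        using \<epsilon>(3) that by (intro mult_strict_right_mono) auto
      finally show "real (graph_diameter {..<N} E) < (\<gamma> / 2 - 2 * \<epsilon>) * real N" .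
    qed
    then have "\<forall>\<^sub>F N in sequentially.
        measure_pmf.prob (lrp_graph s \<beta> N) {E. real (graph_diameter {..<N} E) \<le> c * real N} \<le>
        measure_pmf.prob (lrp_graph s \<beta> N) {E. real (graph_diameter {..<N} E) < (\<gamma> / 2 - 2 * \<epsilon>) * real N}"
      using eventually_ge_at_top[of 1] by (rule eventually_mono[rotated])
    from tendsto_0_le[OF measure_nonneg this lrp_diameter_lower[OF assms \<gamma>(1) conv \<epsilon>(1,2)]]
    show "(\<lambda>N. measure_pmf.prob (lrp_graph s \<beta> N)
        {E. real (graph_diameter {..<N} E) \<le> c * real N}) \<longlonglongrightarrow> 0" .
  qed (use \<gamma> in auto)
qed

text \<open>Distribution functions need to converge only where the limit is continuous. The limit
  jumps from 0 to 1 at \<open>\<eta>\<close>, so that point is exempt, and elsewhere the two tail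
  hypotheses give the limits 1 and 0.\<close>

lemma weak_conv_m_return:
  fixes X :: "nat \<Rightarrow> 'a \<Rightarrow> real"
  assumes above: "\<And>c. \<eta> < c \<Longrightarrow> (\<lambda>N. measure_pmf.prob (M N) {x. X N x > c}) \<longlonglongrightarrow> 0"
    and below: "\<And>c. c < \<eta> \<Longrightarrow> (\<lambda>N. measure_pmf.prob (M N) {x. X N x \<le> c}) \<longlonglongrightarrow> 0"
  shows "weak_conv_m (\<lambda>N. distr (measure_pmf (M N)) borel (X N)) (return borel \<eta>)"
  unfolding weak_conv_m_def weak_conv_def
proof (intro allI impI)
  fix c :: real
  assume cont: "isCont (cdf (return borel \<eta>)) c"
  have cdf_X: "cdf (distr (measure_pmf (M N)) borel (X N)) c = measure_pmf.prob (M N) {x. X N x \<le> c}" for N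
    unfolding cdf_def by (subst measure_distr) (auto simp: vimage_def)
  have cdf_\<eta>: "cdf (return borel \<eta>) = (\<lambda>c. if \<eta> \<le> c then 1 else 0)"
    by (auto simp: cdf_def measure_return fun_eq_iff indicator_def)
  have "c \<noteq> \<eta>"
  proof
    assume "c = \<eta>"
    with cont have "(\<lambda>n. cdf (return borel \<eta>) (\<eta> - 1 / real (Suc n))) \<longlonglongrightarrow> cdf (return borel \<eta>) \<eta>"
      by (intro isCont_tendsto_compose[of _ "cdf (return borel \<eta>)"]) (simp, real_asymp)
    then have "(\<lambda>n. 0 :: real) \<longlonglongrightarrow> 1"
      by (simp add: cdf_\<eta>)
    then show False
      by (simp add: LIMSEQ_const_iff)
  qed
  then consider "\<eta> < c" | "c < \<eta>" by linarith
  then show "(\<lambda>N. cdf (distr (measure_pmf (M N)) borel (X N)) c) \<longlonglongrightarrow> cdf (return borel \<eta>) c"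
  proof cases
    case 1
    have "measure_pmf.prob (M N) {x. X N x \<le> c} = 1 - measure_pmf.prob (M N) {x. X N x > c}" for N
      using measure_pmf.prob_compl[of "{x. X N x > c}" "M N"]
      by (simp add: Collect_neg_eq[symmetric] not_less Compl_eq_Diff_UNIV[symmetric])
    then show ?thesis
      using tendsto_diff[OF tendsto_const above[OF 1], of 1] 1 by (simp add: cdf_X cdf_\<eta>)
  next
    case 2
    then show ?thesis
      using below[OF 2] by (simp add: cdf_X cdf_\<eta>)
  qed
qed

lemma lrp_diameter_weak_conv:
  assumes "\<beta> > 0" "s > 2"
  obtains \<eta> where "0 < \<eta>" "\<eta> \<le> 1"
    "weak_conv_m (\<lambda>N. distr (measure_pmf (lrp_graph s \<beta> N)) borel
      (\<lambda>E. real (graph_diameter {..<N} E) / real N)) (return borel \<eta>)"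
    "(\<lambda>N. measure_pmf.prob (lrp_graph s \<beta> N)
      {E. real (graph_diameter {..<N} E) < \<eta> / 2 * real N}) \<longlonglongrightarrow> 0"
proof -
  obtain \<eta> where \<eta>: "0 < \<eta>" "\<eta> \<le> 1"
    and above: "\<And>c. \<eta> < c \<Longrightarrow> (\<lambda>N. measure_pmf.prob (lrp_graph s \<beta> N)
      {E. real (graph_diameter {..<N} E) > c * real N}) \<longlonglongrightarrow> 0"
    and below: "\<And>c. c < \<eta> \<Longrightarrow> (\<lambda>N. measure_pmf.prob (lrp_graph s \<beta> N)
      {E. real (graph_diameter {..<N} E) \<le> c * real N}) \<longlonglongrightarrow> 0"
    using lrp_diameter_linear[OF assms] by blast
  have ev: "\<forall>\<^sub>F N in sequentially. measure_pmf.prob (lrp_graph s \<beta> N) {E. P N E} \<le>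
      measure_pmf.prob (lrp_graph s \<beta> N) {E. Q N E}"
    if "\<And>N E. N \<ge> 1 \<Longrightarrow> P N E \<Longrightarrow> Q N E" for P Q
    using eventually_ge_at_top[of 1] by eventually_elim (rule prob_le_cong_set_pmf, rule that)
  show ?thesis
  proof (rule that[OF \<eta>])
    show "weak_conv_m (\<lambda>N. distr (measure_pmf (lrp_graph s \<beta> N)) borel
        (\<lambda>E. real (graph_diameter {..<N} E) / real N)) (return borel \<eta>)"
    proof (rule weak_conv_m_return)
      fix c assume "\<eta> < c"
      show "(\<lambda>N. measure_pmf.prob (lrp_graph s \<beta> N)
          {E. real (graph_diameter {..<N} E) / real N > c}) \<longlonglongrightarrow> 0"
        by (rule tendsto_0_le[OF measure_nonneg ev above[OF \<open>\<eta> < c\<close>]]) (simp add: field_simps)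
    next
      fix c assume "c < \<eta>"
      show "(\<lambda>N. measure_pmf.prob (lrp_graph s \<beta> N)
          {E. real (graph_diameter {..<N} E) / real N \<le> c}) \<longlonglongrightarrow> 0"
        by (rule tendsto_0_le[OF measure_nonneg ev below[OF \<open>c < \<eta>\<close>]]) (simp add: field_simps)
    qed
    have "\<eta> / 2 < \<eta>" using \<eta> by simp
    show "(\<lambda>N. measure_pmf.prob (lrp_graph s \<beta> N)
        {E. real (graph_diameter {..<N} E) < \<eta> / 2 * real N}) \<longlonglongrightarrow> 0"
      by (rule tendsto_0_le[OF measure_nonneg ev below[OF \<open>\<eta> / 2 < \<eta>\<close>]]) simp
  qed
qed

subsection \<open>Bounded diameter\<close>

lemma sum_Pow_power_card:
  fixes z :: "'b :: comm_semiring_1"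
  assumes "finite A"
  shows "(\<Sum>X\<in>Pow A. z ^ card X) = (1 + z) ^ card A"
proof -
  have "(\<Prod>x\<in>A. z + 1) = (\<Sum>X\<in>Pow A. (\<Prod>x\<in>X. z) * (\<Prod>x\<in>A - X. 1))"
    using assms by (rule prod_add)
  then show ?thesis
    by (simp add: add.commute)
qed

definition no_edges :: "'a set set \<Rightarrow> 'a set \<Rightarrow> 'a set \<Rightarrow> bool" where
  "no_edges E A B \<longleftrightarrow> (\<forall>x\<in>A. \<forall>y\<in>B. (x, y) \<notin> adj E)"

text \<open>Disjointness makes sorting the pairs injective on \<open>A \<times> B\<close>, so there
  are \<open>card A * card B\<close> independent edges, each at distance at most
  \<open>N\<close>.\<close>

lemma prob_no_edges_le:
  assumes "s > 0" "\<beta> > 0" "A \<subseteq> {..<N}" "B \<subseteq> {..<N}" "A \<inter> B = {}"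
  shows "measure_pmf.prob (lrp_field s \<beta> N) {w. no_edges (edges N w) A B} \<le>
    exp (- (\<beta> * real N powr (- s)) * (real (card A) * real (card B)))"
proof -
  define h where "h = (\<lambda>(x :: nat, y). (min x y, max x y))"
  define F where "F = h ` (A \<times> B)"
  have inj: "inj_on h (A \<times> B)"
    using assms(5) by (auto simp: inj_on_def h_def min_def max_def split: if_splits)
  have F: "F \<subseteq> pairs N"
    using assms by (auto simp: F_def h_def pairs_def min_def max_def; force)
  have "real_of_int (cycle_dist N x y) \<le> real N" if "(x, y) \<in> F" for x y
    using that F cycle_dist_le_diff[of x y N] by (fastforce simp: pairs_def)
  then have "measure_pmf.prob (lrp_field s \<beta> N) {w. \<forall>e\<in>F. \<not> w e} \<le>
      exp (- (\<beta> * real N powr (- s)) * real (card F))"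
    using assms F by (intro lrp_all_closed_le) auto
  also have "card F = card A * card B"
    unfolding F_def using inj by (simp add: card_image card_cartesian_product)
  finally have *: "measure_pmf.prob (lrp_field s \<beta> N) {w. \<forall>e\<in>F. \<not> w e} \<le>
      exp (- (\<beta> * real N powr (- s)) * (real (card A) * real (card B)))"
    by simp
  have "measure_pmf.prob (lrp_field s \<beta> N) {w. no_edges (edges N w) A B} \<le>
      measure_pmf.prob (lrp_field s \<beta> N) {w. \<forall>e\<in>F. \<not> w e}"
  proof (rule prob_le_cong_set_pmf, rule ballI)
    fix w e assume w: "no_edges (edges N w) A B" and "e \<in> F"
    then obtain x y where xy: "x \<in> A" "y \<in> B" "e = (min x y, max x y)"
      by (auto simp: F_def h_def)
    then have "(x, y) \<notin> adj (edges N w)"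
      using w by (auto simp: no_edges_def)
    then show "\<not> w e"
      using xy F \<open>e \<in> F\<close> by (auto simp: adj_edges pairs_def min_def max_def split: if_splits)
  qed
  with * show ?thesis by linarith
qed

text \<open>\<open>A\<close> stands for a ball, \<open>T\<close> for the ball of the next radius,
  and \<open>\<kappa>\<close> for \<open>\<beta> * N powr (- s)\<close>. The threshold makes the
  absence of edges have probability at most \<open>N powr (- 4 * card T)\<close>, small enough to
  pay for all choices of \<open>A\<close> and \<open>T\<close>.\<close>

definition poor_expansion :: "real \<Rightarrow> nat \<Rightarrow> nat set set \<Rightarrow> bool" where
  "poor_expansion \<kappa> N E \<longleftrightarrow> (\<exists>T\<in>Pow {..<N} - {{}}. \<exists>A\<in>Pow T.
     4 * real (card T) * ln (real N) \<le> \<kappa> * (real (card A) * real (card ({..<N} - T))) \<and>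
     no_edges E A ({..<N} - T))"

text \<open>The choices of \<open>A\<close> inside \<open>T\<close> contribute
  \<open>2 ^ card T\<close>; summing over \<open>T\<close> is then a binomial expansion, with the
  empty set subtracted.\<close>

lemma prob_poor_expansion_le:
  assumes "s > 0" "\<beta> > 0" "N > 0"
  shows "measure_pmf.prob (lrp_field s \<beta> N)
      {w. poor_expansion (\<beta> * real N powr (- s)) N (edges N w)} \<le> (1 + 2 / real N ^ 4) ^ N - 1"
proof -
  let ?P = "measure_pmf.prob (lrp_field s \<beta> N)"
  let ?\<kappa> = "\<beta> * real N powr (- s)"
  let ?bad = "\<lambda>T A w. 4 * real (card T) * ln (real N) \<le> ?\<kappa> * (real (card A) * real (card ({..<N} - T))) \<and>
     no_edges (edges N w) A ({..<N} - T)"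
  have one: "?P {w. ?bad T A w} \<le> (1 / real N ^ 4) ^ card T" if "A \<subseteq> T" "T \<subseteq> {..<N}" for A T
  proof (cases "4 * real (card T) * ln (real N) \<le> ?\<kappa> * (real (card A) * real (card ({..<N} - T)))")
    case True
    have "?P {w. ?bad T A w} \<le> ?P {w. no_edges (edges N w) A ({..<N} - T)}"
      by (rule prob_le_cong_set_pmf) auto
    also have "\<dots> \<le> exp (- ?\<kappa> * (real (card A) * real (card ({..<N} - T))))"
      using that assms by (intro prob_no_edges_le) auto
    also have "\<dots> \<le> exp (- (4 * real (card T) * ln (real N)))"
      using True by simp
    also have "\<dots> = (1 / real N ^ 4) ^ card T"
    proof -
      have "exp (4 * real (card T) * ln (real N)) = exp (ln (real N)) ^ (4 * card T)"
        by (simp add: exp_of_nat_mult[symmetric])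
      then show ?thesis
        using assms by (simp add: exp_minus power_mult power_one_over inverse_eq_divide)
    qed
    finally show ?thesis .
  qed auto
  have "?P {w. poor_expansion ?\<kappa> N (edges N w)} \<le>
      (\<Sum>T\<in>Pow {..<N} - {{}}. ?P {w. \<exists>A\<in>Pow T. ?bad T A w})"
    unfolding poor_expansion_def by (rule prob_Bex_le) auto
  also have "\<dots> \<le> (\<Sum>T\<in>Pow {..<N} - {{}}. (2 / real N ^ 4) ^ card T)"
  proof (rule sum_mono)
    fix T assume T: "T \<in> Pow {..<N} - {{}}"
    then have fin: "finite T" using finite_subset by auto
    have "?P {w. \<exists>A\<in>Pow T. ?bad T A w} \<le> (\<Sum>A\<in>Pow T. ?P {w. ?bad T A w})"
      using fin by (intro prob_Bex_le) auto
    also have "\<dots> \<le> (\<Sum>A\<in>Pow T. (1 / real N ^ 4) ^ card T)"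
      using T by (intro sum_mono one) auto
    also have "\<dots> = (2 / real N ^ 4) ^ card T"
      using fin by (simp add: card_Pow power_divide)
    finally show "?P {w. \<exists>A\<in>Pow T. ?bad T A w} \<le> (2 / real N ^ 4) ^ card T" .
  qed
  also have "\<dots> = (1 + 2 / real N ^ 4) ^ N - 1"
    by (subst sum_diff) (auto simp: sum_Pow_power_card)
  finally show ?thesis .
qed

text \<open>As long as the next ball holds at most half of the vertices, its complement has at least
  \<open>N / 2\<close>. Good expansion then gives
  \<open>\<kappa> * card (S j) * N / 2 < 4 * card (S (Suc j)) * ln N\<close>, a growth factor of at
  least \<open>\<kappa> * N / (8 * ln N) \<ge> r\<close>.\<close>

lemma ball_growth:
  fixes \<kappa> r :: real
  assumes conn: "\<And>x y. x < N \<Longrightarrow> y < N \<Longrightarrow> reach E x y"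
    and good: "\<not> poor_expansion \<kappa> N E" and N: "ln (real N) > 0"
    and r: "r \<ge> 0" "8 * ln (real N) * r \<le> \<kappa> * real N" and v: "v < N"
  defines "S \<equiv> \<lambda>j. {z. z < N \<and> graph_dist E v z \<le> j}"
  shows "real N / 2 < real (card (S j)) \<or> r ^ j \<le> real (card (S j))"
proof (induction j)
  case 0
  have "{v} \<subseteq> S 0" using v by (simp add: S_def)
  then have "card {v} \<le> card (S 0)" by (rule card_mono[rotated]) (simp add: S_def)
  then show ?case by simp
next
  case (Suc j)
  have fin: "finite (S i)" for i by (simp add: S_def)
  have sub: "S j \<subseteq> S (Suc j)" by (auto simp: S_def)
  show ?case
  proof (cases "real N / 2 < real (card (S (Suc j)))")
    case False
    have "card (S j) \<le> card (S (Suc j))"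
      using sub fin by (rule card_mono[rotated])
    with False Suc have IH: "r ^ j \<le> real (card (S j))" by auto
    have "no_edges E (S j) ({..<N} - S (Suc j))"
    proof (unfold no_edges_def, intro ballI notI)
      fix x y assume x: "x \<in> S j" and y: "y \<in> {..<N} - S (Suc j)" and a: "(x, y) \<in> adj E"
      have "graph_dist E v y \<le> graph_dist E v x + graph_dist E x y"
        using x y v by (intro graph_dist_triangle conn) (auto simp: S_def)
      with graph_dist_adj[OF a] x y show False
        by (auto simp: S_def)
    qed
    moreover have "S (Suc j) \<in> Pow {..<N} - {{}}"
      using v by (auto simp: S_def intro!: exI[of _ v])
    ultimately have "\<kappa> * (real (card (S j)) * real (card ({..<N} - S (Suc j)))) <
        4 * real (card (S (Suc j))) * ln (real N)"
      using good sub unfolding poor_expansion_def by (auto simp: not_le)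
    moreover have "real N / 2 \<le> real (card ({..<N} - S (Suc j)))"
    proof -
      have "card ({..<N} - S (Suc j)) = N - card (S (Suc j))"
        using fin by (subst card_Diff_subset) (auto simp: S_def)
      then show ?thesis using False by simp
    qed
    moreover have "\<kappa> \<ge> 0"
    proof -
      have "0 \<le> \<kappa> * real N" using r N by (auto intro: order_trans[rotated])
      then show ?thesis using v by (simp add: zero_le_mult_iff)
    qed
    ultimately have "\<kappa> * (real (card (S j)) * (real N / 2)) < 4 * real (card (S (Suc j))) * ln (real N)"
      by (smt (verit) mult_left_mono of_nat_0_le_iff)
    moreover have "8 * ln (real N) * r * real (card (S j)) \<le> \<kappa> * real N * real (card (S j))"
      using r by (intro mult_right_mono) auto
    ultimately have "ln (real N) * (r * real (card (S j))) < ln (real N) * real (card (S (Suc j)))"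
      by (simp add: mult_ac)
    then have "r * real (card (S j)) < real (card (S (Suc j)))"
      using N by simp
    moreover have "r * r ^ j \<le> r * real (card (S j))"
      using IH r by (intro mult_left_mono) auto
    ultimately show ?thesis by simp
  qed simp
qed

theorem lrp_diameter_bounded:
  assumes "s > 0" "\<beta> > 0" "s < 1"
  shows "\<exists>C::real. (\<lambda>N. measure_pmf.prob (lrp_graph s \<beta> N)
    {E. real (graph_diameter {..<N} E) > C}) \<longlonglongrightarrow> 0"
proof -
  \<comment> \<open>With \<open>\<kappa> * N = \<beta> * N powr (2 * \<epsilon>)\<close>, one factor
    \<open>N powr \<epsilon>\<close> absorbs \<open>8 * ln N / \<beta>\<close> and the other is the
    growth factor. After \<open>k \<ge> 1 / \<epsilon>\<close> steps it has reached
    \<open>N\<close>, so both alternatives of \<open>ball_growth\<close> give more than half of the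
    vertices.\<close>
  define \<epsilon> where "\<epsilon> = (1 - s) / 2"
  define k where "k = nat \<lceil>1 / \<epsilon>\<rceil>"
  have \<epsilon>: "\<epsilon> > 0" "2 * \<epsilon> = 1 - s" using assms by (auto simp: \<epsilon>_def)
  have k: "1 \<le> \<epsilon> * real k"
  proof -
    have "1 / \<epsilon> \<le> real k" unfolding k_def by linarith
    then show ?thesis using \<epsilon> by (simp add: field_simps)
  qed
  have lim: "(\<lambda>N. exp (2 / real N ^ 3) - 1) \<longlonglongrightarrow> 0"
    by real_asymp
  have "\<forall>\<^sub>F N in sequentially. 8 * ln (real N) * real N powr \<epsilon> \<le> \<beta> * real N powr (2 * \<epsilon>)"
    using assms \<epsilon>(1) by real_asymp
  then have ev: "\<forall>\<^sub>F N in sequentially. 8 * ln (real N) * real N powr \<epsilon> \<le> \<beta> * real N powr (1 - s) \<and> 2 \<le> N"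
    using eventually_ge_at_top[of 2] unfolding \<epsilon>(2) by eventually_elim simp
  have "measure_pmf.prob (lrp_graph s \<beta> N) {E. real (graph_diameter {..<N} E) > real (2 * k)} \<le>
      exp (2 / real N ^ 3) - 1"
    if N: "8 * ln (real N) * real N powr \<epsilon> \<le> \<beta> * real N powr (1 - s) \<and> 2 \<le> N" for N
  proof -
    let ?\<kappa> = "\<beta> * real N powr (- s)"
    have "measure_pmf.prob (lrp_field s \<beta> N) {w. real (graph_diameter {..<N} (edges N w)) > real (2 * k)} \<le>
        measure_pmf.prob (lrp_field s \<beta> N) {w. poor_expansion ?\<kappa> N (edges N w)}"
    proof (rule prob_le_cong_set_pmf, rule ccontr)
      fix w assume w: "w \<in> set_pmf (lrp_field s \<beta> N)" and D: "real (2 * k) < real (graph_diameter {..<N} (edges N w))"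
        and good: "\<not> poor_expansion ?\<kappa> N (edges N w)"
      let ?E = "edges N w"
      have conn: "\<And>x y. x < N \<Longrightarrow> y < N \<Longrightarrow> reach ?E x y"
        using w by (intro reach_lrp)
      define S where "S v = {z. z < N \<and> graph_dist ?E v z \<le> k}" for v
      have big: "real N / 2 < real (card (S v))" if "v < N" for v
      proof -
        have "real N powr (1 - s) = real N powr (- s) * real N"
          using N by (simp add: powr_diff powr_minus field_simps)
        then have "8 * ln (real N) * real N powr \<epsilon> \<le> ?\<kappa> * real N"
          using N by simp
        then have "real N / 2 < real (card (S v)) \<or> (real N powr \<epsilon>) ^ k \<le> real (card (S v))"
          unfolding S_def using N that good by (intro ball_growth[of N ?E ?\<kappa>] conn) auto
        moreover have "real N \<le> (real N powr \<epsilon>) ^ k"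
        proof -
          have "real N powr 1 \<le> real N powr (\<epsilon> * real k)"
            using N k by (intro powr_mono) auto
          then show ?thesis
            using N by (simp add: powr_powr flip: powr_realpow)
        qed
        ultimately show ?thesis using N by linarith
      qed
      have "graph_dist ?E x y \<le> 2 * k" if "x < N" "y < N" for x y
      proof -
        have "S x \<inter> S y \<noteq> {}"
        proof
          assume "S x \<inter> S y = {}"
          then have "card (S x) + card (S y) = card (S x \<union> S y)"
            by (subst card_Un_disjoint) (auto simp: S_def)
          also have "\<dots> \<le> card {..<N}"
            by (rule card_mono) (auto simp: S_def)
          finally have "real (card (S x)) + real (card (S y)) \<le> real N"
            by (simp flip: of_nat_add)
          with big[OF that(1)] big[OF that(2)] show False by linarith
        qed
        then obtain z where z: "z \<in> S x" "z \<in> S y" by auto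
        have "graph_dist ?E x y \<le> graph_dist ?E x z + graph_dist ?E z y"
          using z that by (intro graph_dist_triangle conn) (auto simp: S_def)
        with z show ?thesis
          using graph_dist_sym[of ?E y z] by (auto simp: S_def)
      qed
      then have "graph_diameter {..<N} ?E \<le> 2 * k"
        using N by (subst lrp_diameter_le_iff) auto
      with D show False by linarith
    qed
    also have "\<dots> \<le> (1 + 2 / real N ^ 4) ^ N - 1"
      using N assms by (intro prob_poor_expansion_le) auto
    also have "\<dots> \<le> exp (2 / real N ^ 4) ^ N - 1"
      by (intro diff_right_mono power_mono) auto
    also have "exp (2 / real N ^ 4) ^ N = exp (2 / real N ^ 3)"
      using N by (simp add: exp_of_nat_mult[symmetric] power_numeral_reduce)
    finally show ?thesis
      by (simp only: prob_lrp_graph)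
  qed
  then have "\<forall>\<^sub>F N in sequentially. measure_pmf.prob (lrp_graph s \<beta> N)
      {E. real (graph_diameter {..<N} E) > real (2 * k)} \<le> exp (2 / real N ^ 3) - 1"
    using ev by (rule eventually_mono[rotated])
  from tendsto_0_le[OF _ this lim] show ?thesis
    by (intro exI[of _ "real (2 * k)"]) simp
qed

subsection \<open>Polylogarithmic upper bound\<close>

text \<open>An edge between the \<open>l R\<close>-neighbourhoods of two points at distance \<open>R\<close> leaves two gaps of
  length \<open>l R \<le> R powr q\<close>. Each level of the recursion doubles the number of gaps and multiplies
  the logarithm of their length by \<open>q\<close>, hence the exponent \<open>\<Delta>\<close> with \<open>2 * q powr \<Delta> \<le> 1\<close>.\<close>
lemma hub_recursion:
  fixes l :: "nat \<Rightarrow> nat" and K q \<Delta> :: real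
  assumes conn: "\<And>x y. x < N \<Longrightarrow> y < N \<Longrightarrow> reach E x y"
    and nn: "\<And>x y. x \<le> y \<Longrightarrow> y < N \<Longrightarrow> graph_dist E x y \<le> y - x"
    and hub: "\<And>x y. x < y \<Longrightarrow> y < N \<Longrightarrow> K \<le> real (y - x) \<Longrightarrow> 2 * l (y - x) < y - x \<Longrightarrow>
      \<exists>u v. x \<le> u \<and> u \<le> x + l (y - x) \<and> y - l (y - x) \<le> v \<and> v \<le> y \<and> (u, v) \<in> adj E"
    and K: "1 \<le> K" and q: "0 < q" and \<Delta>: "0 \<le> \<Delta>" "2 * q powr \<Delta> \<le> 1"
    and l: "\<And>R. K \<le> real R \<Longrightarrow> 1 \<le> l R \<and> l R < R \<and> real (l R) \<le> real R powr q \<and> 1 \<le> q * ln (real R)"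
  shows "x \<le> y \<Longrightarrow> y < N \<Longrightarrow> real (y - x) \<le> L \<Longrightarrow> 1 \<le> L \<Longrightarrow>
    real (graph_dist E x y) + 1 \<le> (K + 1) * max 1 (ln L) powr \<Delta>"
proof (induction "y - x" arbitrary: x y L rule: less_induct)
  case less
  define R where "R = y - x"
  have B_ge: "K + 1 \<le> (K + 1) * max 1 (ln L) powr \<Delta>"
    using ge_one_powr_ge_zero[of "max 1 (ln L)" \<Delta>] \<Delta> K by simp
  show ?case
  proof (cases "real R < K")
    case True
    have "real (graph_dist E x y) \<le> real R"
      using nn[OF less.prems(1,2)] by (simp add: R_def)
    with True B_ge show ?thesis by linarith
  next
    case False
    then have KR: "K \<le> real R" by simp
    have xy: "x < y" and R1: "1 \<le> real R"
      using KR K by (auto simp: R_def)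
    define m where "m = l R"
    have m: "1 \<le> m" "m < R" "real m \<le> real R powr q" "1 \<le> q * ln (real R)"
      using l[OF KR] by (auto simp: m_def)
    define B where "B = (K + 1) * max 1 (ln (real m)) powr \<Delta>"
    have IH: "real (graph_dist E a b) + 1 \<le> B" if "a \<le> b" "b < N" "b - a \<le> m" for a b
      unfolding B_def using that m by (intro less.hyps) (auto simp: R_def)
    \<comment> \<open>Carrying \<open>+ 1\<close> in the claim pays for the hub edge:
      \<open>(d + 1 + d') + 1 = (d + 1) + (d' + 1)\<close>.\<close>
    have "real (graph_dist E x y) + 1 \<le> 2 * B"
    proof (cases "2 * m < R")
      case True
      obtain u v where uv: "x \<le> u" "u \<le> x + m" "y - m \<le> v" "v \<le> y" "(u, v) \<in> adj E"
        using hub[OF xy less.prems(2)] KR True unfolding m_def R_def by blast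
      have lt: "u < N" "v < N" "x < N"
        using uv True less.prems xy by (auto simp: R_def)
      have "graph_dist E x y \<le> graph_dist E x u + graph_dist E u y"
        using lt less.prems by (intro graph_dist_triangle conn) auto
      also have "graph_dist E u y \<le> graph_dist E u v + graph_dist E v y"
        using lt less.prems by (intro graph_dist_triangle conn) auto
      finally have "graph_dist E x y \<le> graph_dist E x u + 1 + graph_dist E v y"
        using graph_dist_adj[OF uv(5)] by linarith
      moreover have "real (graph_dist E x u) + 1 \<le> B" "real (graph_dist E v y) + 1 \<le> B"
        using uv lt less.prems by (auto intro!: IH)
      ultimately show ?thesis by linarith
    next
      case False
      define z where "z = x + R div 2"
      have z: "x \<le> z" "z \<le> y" "z - x \<le> m" "y - z \<le> m"
        using False xy by (auto simp: z_def R_def)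
      have "graph_dist E x y \<le> graph_dist E x z + graph_dist E z y"
        using z less.prems by (intro graph_dist_triangle conn) auto
      moreover have "real (graph_dist E x z) + 1 \<le> B" "real (graph_dist E z y) + 1 \<le> B"
        using z less.prems by (auto intro!: IH)
      ultimately show ?thesis by linarith
    qed
    also have "2 * B \<le> (K + 1) * max 1 (ln L) powr \<Delta>"
    proof -
      have "ln (real m) \<le> ln (real R powr q)"
        using m R1 by (subst ln_le_cancel_iff) auto
      then have "max 1 (ln (real m)) \<le> q * ln (real R)"
        using m R1 by (simp add: ln_powr)
      also have "\<dots> \<le> q * max 1 (ln L)"
        using q less.prems R1 by (intro mult_left_mono) (auto simp: R_def le_max_iff_disj)
      finally have "max 1 (ln (real m)) powr \<Delta> \<le> (q * max 1 (ln L)) powr \<Delta>"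
        using \<Delta> by (intro powr_mono2) auto
      also have "\<dots> = q powr \<Delta> * max 1 (ln L) powr \<Delta>"
        by (simp add: powr_mult)
      finally have "2 * max 1 (ln (real m)) powr \<Delta> \<le> (2 * q powr \<Delta>) * max 1 (ln L) powr \<Delta>"
        by simp
      also have "\<dots> \<le> 1 * max 1 (ln L) powr \<Delta>"
        using \<Delta> by (intro mult_right_mono) auto
      finally have "(K + 1) * (2 * max 1 (ln (real m)) powr \<Delta>) \<le> (K + 1) * (max 1 (ln L) powr \<Delta>)"
        using K by (intro mult_left_mono) auto
      then show ?thesis by (simp add: B_def)
    qed
    finally show ?thesis by simp
  qed
qed

text \<open>The two neighbourhoods are disjoint and lie between \<open>x\<close> and
  \<open>y\<close>. They offer \<open>(m + 1)\<^sup>2 \<ge> (y - x) powr (2 * g)\<close> pairs, none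
  farther apart than \<open>y - x\<close>.\<close>

lemma prob_no_hub_le:
  assumes "s > 0" "\<beta> > 0" and xy: "x < y" "y < N" and m: "2 * m < y - x" "real (y - x) powr g \<le> real m"
  shows "measure_pmf.prob (lrp_field s \<beta> N)
      {w. \<not> (\<exists>u v. x \<le> u \<and> u \<le> x + m \<and> y - m \<le> v \<and> v \<le> y \<and> (u, v) \<in> adj (edges N w))} \<le>
    exp (- \<beta> * real (y - x) powr (2 * g - s))"
proof -
  define F where "F = {x..x + m} \<times> {y - m..y}"
  have F: "F \<subseteq> pairs N"
    using xy m by (auto simp: F_def pairs_def)
  have "real_of_int (cycle_dist N u v) \<le> real (y - x)" if "(u, v) \<in> F" for u v
    using that F cycle_dist_le_diff[of u v N] by (fastforce simp: F_def pairs_def)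
  then have "measure_pmf.prob (lrp_field s \<beta> N) {w. \<forall>e\<in>F. \<not> w e} \<le>
      exp (- (\<beta> * real (y - x) powr (- s)) * real (card F))"
    using assms F by (intro lrp_all_closed_le) auto
  also have "card F = (m + 1) * (m + 1)"
    using m by (simp add: F_def)
  also have "exp (- (\<beta> * real (y - x) powr (- s)) * real ((m + 1) * (m + 1))) \<le>
      exp (- \<beta> * real (y - x) powr (2 * g - s))"
  proof -
    have "real (y - x) powr (2 * g - s) = real (y - x) powr (- s) * (real (y - x) powr g * real (y - x) powr g)"
      by (simp add: powr_add[symmetric])
    also have "\<dots> \<le> real (y - x) powr (- s) * (real (m + 1) * real (m + 1))"
      using m by (intro mult_left_mono mult_mono) auto
    finally have "real (y - x) powr (2 * g - s) \<le> real (y - x) powr (- s) * real ((m + 1) * (m + 1))"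
      by (simp only: of_nat_mult)
    from mult_left_mono[OF this, of \<beta>] show ?thesis
      using assms by (simp only: mult.assoc exp_le_cancel_iff neg_le_iff_le mult_minus_left)
  qed
  finally have "measure_pmf.prob (lrp_field s \<beta> N) {w. \<forall>e\<in>F. \<not> w e} \<le>
    exp (- \<beta> * real (y - x) powr (2 * g - s))" .
  moreover have "measure_pmf.prob (lrp_field s \<beta> N)
      {w. \<not> (\<exists>u v. x \<le> u \<and> u \<le> x + m \<and> y - m \<le> v \<and> v \<le> y \<and> (u, v) \<in> adj (edges N w))} \<le>
      measure_pmf.prob (lrp_field s \<beta> N) {w. \<forall>e\<in>F. \<not> w e}"
  proof (rule prob_le_cong_set_pmf, rule ballI)
    fix w e
    assume w: "\<not> (\<exists>u v. x \<le> u \<and> u \<le> x + m \<and> y - m \<le> v \<and> v \<le> y \<and> (u, v) \<in> adj (edges N w))"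
      and "e \<in> F"
    then obtain u v where e: "e = (u, v)" "x \<le> u" "u \<le> x + m" "y - m \<le> v" "v \<le> y" "u < v" "v < N"
      using F by (auto simp: F_def pairs_def)
    then show "\<not> w e"
      using w by (auto simp: adj_edges)
  qed
  ultimately show ?thesis by linarith
qed

theorem lrp_diameter_polylog:
  assumes "s > 0" "\<beta> > 0" "s < 2"
  shows "\<exists>\<delta>::real. (\<lambda>N. measure_pmf.prob (lrp_graph s \<beta> N)
    {E. real (graph_diameter {..<N} E) > ln (real N) powr \<delta>}) \<longlonglongrightarrow> 0"
proof -
  \<comment> \<open>\<open>g\<close> is the midpoint of \<open>s / 2\<close> and 1, and
    \<open>q\<close> that of \<open>g\<close> and 1, which leaves room for rounding up
    \<open>l\<close>. The choice \<open>c * (2 * g - s) = 2\<close> bounds a failure by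
    \<open>exp (- \<beta> * (ln N)\<^sup>2)\<close>, which beats \<open>N\<^sup>2\<close>;
    \<open>\<Delta>\<close> solves \<open>2 * q powr \<Delta> = 1\<close>.\<close>
  define g where "g = (s + 2) / 4"
  define q where "q = (g + 1) / 2"
  define c where "c = 2 / (2 * g - s)"
  define \<Delta> where "\<Delta> = ln 2 / (- ln q)"
  have g: "0 < g" "g < 1" "0 < 2 * g - s" and q: "g < q" "0 < q" "q < 1"
    using assms by (auto simp: g_def q_def add_pos_pos)
  have c: "c > 0" and \<Delta>: "\<Delta> \<ge> 0"
    using g q by (simp_all add: c_def \<Delta>_def divide_nonneg_neg)
  have q\<Delta>: "2 * q powr \<Delta> \<le> 1"
  proof -
    have "q powr \<Delta> = exp (- ln 2)"
      using q by (simp add: powr_def \<Delta>_def)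
    then show ?thesis by (simp add: exp_minus)
  qed
  define l where "l R = nat \<lceil>real R powr g\<rceil>" for R :: nat
  have l_ge: "real R powr g \<le> real (l R)" for R
    unfolding l_def by linarith
  have "\<forall>\<^sub>F R in sequentially. real R powr g + 1 \<le> real R powr q \<and> real R powr g + 1 < real R \<and> 1 \<le> q * ln (real R)"
    using g q by (intro eventually_conj; real_asymp)
  then obtain R1 where R1: "\<And>R. R \<ge> R1 \<Longrightarrow>
      real R powr g + 1 \<le> real R powr q \<and> real R powr g + 1 < real R \<and> 1 \<le> q * ln (real R)"
    by (auto simp: eventually_sequentially)
  have l: "1 \<le> l R \<and> l R < R \<and> real (l R) \<le> real R powr q \<and> 1 \<le> q * ln (real R)"
    if "R \<ge> R1" "R \<ge> 1" for R
  proof -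
    have "real (l R) \<le> real R powr g + 1" "1 \<le> real R powr g"
      using that g unfolding l_def by (auto simp: ge_one_powr_ge_zero)
    then show ?thesis
      using R1[OF that(1)] l_ge[of R] by auto
  qed
  \<comment> \<open>\<open>c\<close> comes from the cutoff and \<open>\<Delta>\<close> from the
    depth of the recursion; the extra 1 absorbs the factor in \<open>K N + 1 \<le> 2 * K N\<close>,
    once \<open>ln N \<ge> 2\<close>.\<close>
  define \<delta> where "\<delta> = c + \<Delta> + 1"
  define K where "K N = ln (real N) powr c" for N :: nat
  define bad where "bad N w \<longleftrightarrow> (\<exists>(x, y)\<in>{(x, y). (x, y) \<in> pairs N \<and> K N \<le> real (y - x) \<and> 2 * l (y - x) < y - x}.
    \<not> (\<exists>u v. x \<le> u \<and> u \<le> x + l (y - x) \<and> y - l (y - x) \<le> v \<and> v \<le> y \<and> (u, v) \<in> adj (edges N w)))"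
    for N w
  have lim: "(\<lambda>N. real N ^ 2 * exp (- \<beta> * ln (real N) ^ 2)) \<longlonglongrightarrow> 0"
    using assms by real_asymp
  have bad: "measure_pmf.prob (lrp_field s \<beta> N) {w. bad N w} \<le> real N ^ 2 * exp (- \<beta> * ln (real N) ^ 2)"
    if "N \<ge> 2" for N
  proof -
    let ?I = "{(x, y). (x, y) \<in> pairs N \<and> K N \<le> real (y - x) \<and> 2 * l (y - x) < y - x}"
    have fin: "finite ?I"
      by (rule finite_subset[OF _ finite_pairs[of N]]) auto
    have "measure_pmf.prob (lrp_field s \<beta> N) {w. bad N w} \<le>
        (\<Sum>i\<in>?I. measure_pmf.prob (lrp_field s \<beta> N) {w. case i of (x, y) \<Rightarrow>
          \<not> (\<exists>u v. x \<le> u \<and> u \<le> x + l (y - x) \<and> y - l (y - x) \<le> v \<and> v \<le> y \<and> (u, v) \<in> adj (edges N w))})"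
      unfolding bad_def by (rule prob_Bex_le[OF fin])
    also have "\<dots> \<le> (\<Sum>i\<in>?I. exp (- \<beta> * ln (real N) ^ 2))"
    proof (intro sum_mono)
      fix i assume "i \<in> ?I"
      then obtain x y where i: "i = (x, y)" "x < y" "y < N" "K N \<le> real (y - x)" "2 * l (y - x) < y - x"
        by (auto simp: pairs_def)
      have "ln (real N) ^ 2 = K N powr (2 * g - s)"
      proof -
        have "c * (2 * g - s) = 2"
          using g by (simp add: c_def field_simps)
        then show ?thesis
          using that by (simp only: K_def powr_powr) (simp add: powr_numeral)
      qed
      also have "\<dots> \<le> real (y - x) powr (2 * g - s)"
        using i g by (intro powr_mono2) (auto simp: K_def)
      finally have "exp (- \<beta> * real (y - x) powr (2 * g - s)) \<le> exp (- \<beta> * ln (real N) ^ 2)"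
        using assms by simp
      with prob_no_hub_le[OF assms(1,2) i(2,3,5) l_ge]
      show "measure_pmf.prob (lrp_field s \<beta> N) {w. case i of (x, y) \<Rightarrow>
          \<not> (\<exists>u v. x \<le> u \<and> u \<le> x + l (y - x) \<and> y - l (y - x) \<le> v \<and> v \<le> y \<and> (u, v) \<in> adj (edges N w))}
        \<le> exp (- \<beta> * ln (real N) ^ 2)"
        unfolding i(1) prod.case by (rule order_trans)
    qed
    also have "\<dots> = real (card ?I) * exp (- \<beta> * ln (real N) ^ 2)"
      by simp
    also have "\<dots> \<le> real N ^ 2 * exp (- \<beta> * ln (real N) ^ 2)"
    proof -
      have "card ?I \<le> card ({..<N} \<times> {..<N})"
        by (rule card_mono) (auto simp: pairs_def)
      then have "real (card ?I) \<le> real N ^ 2"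
        by (simp add: power2_eq_square flip: of_nat_mult)
      then show ?thesis by (intro mult_right_mono) auto
    qed
    finally show ?thesis .
  qed
  have "\<forall>\<^sub>F N in sequentially. real (max R1 1) \<le> ln (real N) powr c"
    using c by real_asymp
  moreover have "\<forall>\<^sub>F N in sequentially. 2 \<le> ln (real N)"
    by real_asymp
  ultimately have ev: "\<forall>\<^sub>F N in sequentially. real (max R1 1) \<le> K N \<and> 2 \<le> ln (real N) \<and> 2 \<le> N"
    using eventually_ge_at_top[of 2] unfolding K_def by eventually_elim auto
  have "measure_pmf.prob (lrp_graph s \<beta> N) {E. real (graph_diameter {..<N} E) > ln (real N) powr \<delta>}
      \<le> real N ^ 2 * exp (- \<beta> * ln (real N) ^ 2)"
    if N: "real (max R1 1) \<le> K N \<and> 2 \<le> ln (real N) \<and> 2 \<le> N" for N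
  proof -
    have "measure_pmf.prob (lrp_field s \<beta> N) {w. real (graph_diameter {..<N} (edges N w)) > ln (real N) powr \<delta>}
      \<le> measure_pmf.prob (lrp_field s \<beta> N) {w. bad N w}"
    proof (rule prob_le_cong_set_pmf, rule ccontr)
      fix w assume w: "w \<in> set_pmf (lrp_field s \<beta> N)" and "\<not> bad N w"
        and D: "ln (real N) powr \<delta> < real (graph_diameter {..<N} (edges N w))"
      let ?E = "edges N w"
      have d: "real (graph_dist ?E x y) + 1 \<le> (K N + 1) * max 1 (ln (real N)) powr \<Delta>"
        if "x \<le> y" "y < N" for x y
      proof (rule hub_recursion[where l = l and q = q and E = ?E and N = N and x = x and y = y and K = "K N"])
        show "\<exists>u v. x \<le> u \<and> u \<le> x + l (y - x) \<and> y - l (y - x) \<le> v \<and> v \<le> y \<and> (u, v) \<in> adj ?E"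
          if "x < y" "y < N" "K N \<le> real (y - x)" "2 * l (y - x) < y - x" for x y
          using \<open>\<not> bad N w\<close> that unfolding bad_def pairs_def by blast
        show "1 \<le> l R \<and> l R < R \<and> real (l R) \<le> real R powr q \<and> 1 \<le> q * ln (real R)"
          if "K N \<le> real R" for R
          using that N by (intro l) auto
        show "real (y - x) \<le> real N" "1 \<le> real N" "1 \<le> K N"
          using \<open>y < N\<close> N by auto
      qed (use that q q\<Delta> \<Delta> w in \<open>auto intro: reach_lrp graph_dist_lrp_le_diff\<close>)
      have "(K N + 1) * max 1 (ln (real N)) powr \<Delta> \<le> ln (real N) powr \<delta>"
      proof -
        have "K N + 1 \<le> 2 * K N" using N by auto
        also have "\<dots> \<le> ln (real N) * ln (real N) powr c"
          using N unfolding K_def by (intro mult_right_mono) auto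
        finally have "(K N + 1) * ln (real N) powr \<Delta> \<le>
            (ln (real N) * ln (real N) powr c) * ln (real N) powr \<Delta>"
          by (intro mult_right_mono) auto
        also have "\<dots> = ln (real N) powr \<delta>"
          using N by (simp add: \<delta>_def powr_add mult_ac)
        finally show ?thesis
          using N by (simp add: max_def)
      qed
      then have d': "real (graph_dist ?E x y) \<le> ln (real N) powr \<delta>" if "x \<le> y" "y < N" for x y
        using d[OF that] by linarith
      have "graph_dist ?E x y \<le> nat \<lfloor>ln (real N) powr \<delta>\<rfloor>" if "x < N" "y < N" for x y
      proof -
        have "real (graph_dist ?E x y) \<le> ln (real N) powr \<delta>"
          using d'[of x y] d'[of y x] that graph_dist_sym[of ?E x y] by (cases "x \<le> y") auto
        then show ?thesis by (simp add: le_nat_floor)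
      qed
      then have "graph_diameter {..<N} ?E \<le> nat \<lfloor>ln (real N) powr \<delta>\<rfloor>"
        using N by (subst lrp_diameter_le_iff) auto
      moreover have "real (nat \<lfloor>ln (real N) powr \<delta>\<rfloor>) \<le> ln (real N) powr \<delta>"
        by simp
      ultimately show False
        using D by linarith
    qed
    also have "\<dots> \<le> real N ^ 2 * exp (- \<beta> * ln (real N) ^ 2)"
      using N by (intro bad) auto
    finally show ?thesis
      by (simp only: prob_lrp_graph)
  qed
  then have "\<forall>\<^sub>F N in sequentially. measure_pmf.prob (lrp_graph s \<beta> N)
      {E. real (graph_diameter {..<N} E) > ln (real N) powr \<delta>} \<le> real N ^ 2 * exp (- \<beta> * ln (real N) ^ 2)"
    using ev by (rule eventually_mono[rotated])
  from tendsto_0_le[OF _ this lim] show ?thesis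
    by (intro exI[of _ \<delta>]) simp
qed

subsection \<open>Logarithmic lower bound\<close>

definition opair :: "nat \<Rightarrow> nat \<Rightarrow> nat \<times> nat" where
  "opair x y = (min x y, max x y)"

fun path_edges :: "nat list \<Rightarrow> (nat \<times> nat) set" where
  "path_edges (x # y # xs) = insert (opair x y) (path_edges (y # xs))"
| "path_edges _ = {}"

text \<open>The root 0 is the last vertex, so that paths grow at the head, as in the recursion of
  \<open>path_edges\<close>.\<close>

definition simple_paths :: "nat \<Rightarrow> nat \<Rightarrow> nat list set" where
  "simple_paths N k = {xs. length xs = Suc k \<and> distinct xs \<and> set xs \<subseteq> {..<N} \<and> last xs = 0}"

lemma finite_path_edges [simp]: "finite (path_edges xs)"
  by (induction xs rule: path_edges.induct) auto

lemma path_edges_subset: "distinct xs \<Longrightarrow> set xs \<subseteq> {..<N} \<Longrightarrow> path_edges xs \<subseteq> pairs N"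
  by (induction xs rule: path_edges.induct) (auto simp: opair_def pairs_def min_def max_def)

lemma path_edges_vertices: "(a, b) \<in> path_edges xs \<Longrightarrow> a \<in> set xs \<and> b \<in> set xs"
  by (induction xs rule: path_edges.induct) (auto simp: opair_def min_def max_def split: if_splits)

text \<open>A new vertex makes the new edge distinct from all earlier ones. For this reason only
  simple paths are counted: their opening probabilities multiply.\<close>

lemma prod_path_edges:
  fixes f :: "nat \<times> nat \<Rightarrow> 'b :: comm_monoid_mult"
  assumes "x \<notin> set (y # xs)"
  shows "prod f (path_edges (x # y # xs)) = f (opair x y) * prod f (path_edges (y # xs))"
proof -
  have "opair x y \<notin> path_edges (y # xs)"
    using assms path_edges_vertices[of "min x y" "max x y" "y # xs"]
    by (auto simp: opair_def min_def split: if_splits)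
  then show ?thesis by simp
qed

lemma finite_simple_paths [simp]: "finite (simple_paths N k)"
  by (rule finite_subset[OF _ finite_lists_length_eq[of "{..<N}" "Suc k"]])
    (auto simp: simple_paths_def)

lemma simple_paths_Suc:
  "simple_paths N (Suc k) \<subseteq> (\<lambda>(xs, x). x # xs) ` (SIGMA xs : simple_paths N k. {..<N} - set xs)"
proof
  fix ys assume "ys \<in> simple_paths N (Suc k)"
  then obtain x xs where "ys = x # xs" "length xs = Suc k" "distinct (x # xs)"
      "set (x # xs) \<subseteq> {..<N}" "last (x # xs) = 0"
    by (cases ys) (auto simp: simple_paths_def)
  moreover from this have "xs \<in> simple_paths N k"
    by (cases xs) (auto simp: simple_paths_def)
  ultimately show "ys \<in> (\<lambda>(xs, x). x # xs) ` (SIGMA xs : simple_paths N k. {..<N} - set xs)"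
    by (intro image_eqI[of _ _ "(xs, x)"]) auto
qed

lemma sum_simple_paths_le:
  fixes p :: "nat \<times> nat \<Rightarrow> real"
  assumes p: "\<And>e. 0 \<le> p e" and "0 \<le> M"
    and deg: "\<And>y. y < N \<Longrightarrow> (\<Sum>x\<in>{..<N} - {y}. p (opair x y)) \<le> M"
  shows "(\<Sum>xs\<in>simple_paths N k. prod p (path_edges xs)) \<le> M ^ k"
proof (induction k)
  case 0
  have "simple_paths N 0 \<subseteq> {[0]}"
    by (auto simp: simple_paths_def length_Suc_conv)
  then have "(\<Sum>xs\<in>simple_paths N 0. prod p (path_edges xs)) \<le> (\<Sum>xs\<in>{[0]}. prod p (path_edges xs))"
    by (intro sum_mono2) auto
  then show ?case by simp
next
  case (Suc k)
  let ?w = "\<lambda>xs. prod p (path_edges xs)"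
  let ?S = "SIGMA xs : simple_paths N k. {..<N} - set xs"
  have w: "0 \<le> ?w xs" for xs using p by (simp add: prod_nonneg)
  have "sum ?w (simple_paths N (Suc k)) \<le> sum ?w ((\<lambda>(xs, x). x # xs) ` ?S)"
    using w by (intro sum_mono2 simple_paths_Suc finite_imageI finite_SigmaI) auto
  also have "sum ?w ((\<lambda>(xs, x). x # xs) ` ?S) = (\<Sum>(xs, x)\<in>?S. ?w (x # xs))"
    by (subst sum.reindex) (auto simp: inj_on_def case_prod_unfold)
  also have "\<dots> = (\<Sum>xs\<in>simple_paths N k. \<Sum>x\<in>{..<N} - set xs. ?w (x # xs))"
    by (subst sum.Sigma) auto
  also have "\<dots> \<le> (\<Sum>xs\<in>simple_paths N k. M * ?w xs)"
  proof (rule sum_mono)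
    fix xs assume xs: "xs \<in> simple_paths N k"
    then obtain y ys where y: "xs = y # ys" "y < N"
      by (cases xs) (auto simp: simple_paths_def)
    have "(\<Sum>x\<in>{..<N} - set xs. ?w (x # xs)) = (\<Sum>x\<in>{..<N} - set xs. p (opair x y) * ?w xs)"
      unfolding y(1) by (intro sum.cong refl prod_path_edges) auto
    also have "\<dots> = (\<Sum>x\<in>{..<N} - set xs. p (opair x y)) * ?w xs"
      by (simp add: sum_distrib_right)
    also have "\<dots> \<le> (\<Sum>x\<in>{..<N} - {y}. p (opair x y)) * ?w xs"
      using p w y(1) by (intro mult_right_mono sum_mono2) auto
    also have "\<dots> \<le> M * ?w xs"
      using deg[OF y(2)] w by (intro mult_right_mono)
    finally show "(\<Sum>x\<in>{..<N} - set xs. ?w (x # xs)) \<le> M * ?w xs" .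
  qed
  also have "\<dots> = M * sum ?w (simple_paths N k)"
    by (simp add: sum_distrib_left)
  also have "\<dots> \<le> M ^ Suc k"
    using Suc assms(2) by (simp add: mult_left_mono)
  finally show ?case .
qed

text \<open>The bound on the distances along the path is the invariant that yields simplicity: a
  vertex at distance \<open>k + 1\<close> from 0 cannot lie on a path all of whose vertices are
  within \<open>k\<close>.\<close>

lemma shortest_path_simple:
  assumes conn: "\<And>x y. x < N \<Longrightarrow> y < N \<Longrightarrow> reach (edges N w) x y"
  shows "z < N \<Longrightarrow> graph_dist (edges N w) z 0 = k \<Longrightarrow>
    \<exists>xs\<in>simple_paths N k. hd xs = z \<and> (\<forall>e\<in>path_edges xs. w e) \<and>
      (\<forall>v\<in>set xs. graph_dist (edges N w) v 0 \<le> k)"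
proof (induction k arbitrary: z)
  case 0
  then have "z = 0"
    using graph_dist_walk[OF conn[of z 0]] by simp
  with 0 show ?case
    by (intro bexI[of _ "[0]"]) (auto simp: simple_paths_def)
next
  case (Suc k)
  let ?E = "edges N w"
  have "(z, 0) \<in> adj ?E ^^ Suc k"
    using graph_dist_walk[OF conn[of z 0]] Suc.prems by simp
  then obtain y where y: "(z, y) \<in> adj ?E" "(y, 0) \<in> adj ?E ^^ k"
    by (rule relpow_Suc_E2)
  have yN: "y < N"
    using y(1) by (auto simp: adj_edges)
  have "graph_dist ?E z 0 \<le> graph_dist ?E z y + graph_dist ?E y 0"
    using Suc.prems yN by (intro graph_dist_triangle conn) auto
  with graph_dist_adj[OF y(1)] graph_dist_le[OF y(2)] Suc.prems have dy: "graph_dist ?E y 0 = k"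
    by linarith
  from Suc.IH[OF yN this] obtain xs where xs: "xs \<in> simple_paths N k" "hd xs = y"
      "\<forall>e\<in>path_edges xs. w e" "\<forall>v\<in>set xs. graph_dist ?E v 0 \<le> k"
    by blast
  then obtain ys where ys: "xs = y # ys"
    by (cases xs) (auto simp: simple_paths_def)
  have "z \<notin> set xs"
    using xs(4) Suc.prems by auto
  moreover have "w (opair z y)"
    using y(1) by (auto simp: adj_edges opair_def min_def max_def)
  ultimately show ?case
    using xs ys Suc.prems by (intro bexI[of _ "z # xs"]) (auto simp: simple_paths_def)
qed

lemma sum_line_le:
  fixes f :: "nat \<Rightarrow> real"
  assumes "y < N" "\<And>k. 0 \<le> f k"
  shows "(\<Sum>x\<in>{..<N} - {y}. f (if x < y then y - x else x - y)) \<le> 2 * (\<Sum>k=1..<N. f k)"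
proof -
  have "(\<Sum>x\<in>{..<N} - {y}. f (if x < y then y - x else x - y)) =
      (\<Sum>x\<in>{..<y} \<union> {y<..<N}. f (if x < y then y - x else x - y))"
    using assms by (intro sum.cong) auto
  also have "\<dots> = (\<Sum>x\<in>{..<y}. f (y - x)) + (\<Sum>x\<in>{y<..<N}. f (x - y))"
    by (subst sum.union_disjoint) (auto intro!: arg_cong2[of _ _ _ _ "(+)"] sum.cong)
  also have "(\<Sum>x\<in>{..<y}. f (y - x)) = (\<Sum>k\<in>(\<lambda>x. y - x) ` {..<y}. f k)"
    by (subst sum.reindex) (auto simp: inj_on_def)
  also have "\<dots> \<le> (\<Sum>k=1..<N. f k)"
    using assms by (intro sum_mono2) auto
  also have "(\<Sum>x\<in>{y<..<N}. f (x - y)) = (\<Sum>k\<in>(\<lambda>x. x - y) ` {y<..<N}. f k)"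
    by (subst sum.reindex) (auto simp: inj_on_def)
  also have "\<dots> \<le> (\<Sum>k=1..<N. f k)"
    using assms by (intro sum_mono2) auto
  finally show ?thesis by simp
qed

text \<open>The factor 4 counts two sides of \<open>y\<close> and, on each, the two arc lengths of
  which the cycle distance is the smaller.\<close>

lemma mean_degree_le:
  assumes "\<beta> > 0" "y < N"
  shows "(\<Sum>x\<in>{..<N} - {y}. (case opair x y of (a, b) \<Rightarrow> edge_prob s \<beta> N a b)) \<le>
    4 * max 1 \<beta> * (\<Sum>k=1..<N. real k powr (- s))"
proof -
  let ?f = "\<lambda>k. real k powr (- s) + real (N - k) powr (- s)"
  have "(\<Sum>x\<in>{..<N} - {y}. (case opair x y of (a, b) \<Rightarrow> edge_prob s \<beta> N a b)) \<le>
      (\<Sum>x\<in>{..<N} - {y}. max 1 \<beta> * ?f (if x < y then y - x else x - y))"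
  proof (rule sum_mono)
    fix x assume x: "x \<in> {..<N} - {y}"
    have "edge_prob s \<beta> N a b \<le> max 1 \<beta> * ?f (b - a)" if "a < b" "b < N" for a b
      using edge_prob_le_max[OF assms(1), of s N a b] cycle_dist_powr_le[OF that, of "- s"]
        mult_left_mono[of _ _ "max 1 \<beta>"] by (smt (verit) max.cobounded1)
    then show "(case opair x y of (a, b) \<Rightarrow> edge_prob s \<beta> N a b) \<le>
        max 1 \<beta> * ?f (if x < y then y - x else x - y)"
      using x assms by (auto simp: opair_def min_def max_def)
  qed
  also have "\<dots> \<le> 2 * (\<Sum>k=1..<N. max 1 \<beta> * ?f k)"
    using assms by (intro sum_line_le) auto
  also have "(\<Sum>k=1..<N. max 1 \<beta> * ?f k) =
      max 1 \<beta> * ((\<Sum>k=1..<N. real k powr (- s)) + (\<Sum>k=1..<N. real (N - k) powr (- s)))"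
    by (simp only: sum_distrib_left[symmetric] sum.distrib)
  also have "(\<Sum>k=1..<N. real (N - k) powr (- s)) = (\<Sum>k=1..<N. real k powr (- s))"
    by (rule sum.reindex_bij_witness[of _ "\<lambda>k. N - k" "\<lambda>k. N - k"]) auto
  finally show ?thesis by (simp add: mult_ac)
qed

text \<open>If the diameter is at most \<open>n\<close>, each of the \<open>N\<close> vertices is
  the head of an open simple path to 0 of length at most \<open>n\<close>. Markov's inequality for
  the number \<open>X\<close> of such paths concludes; \<open>M \<ge> 2\<close> bounds the geometric
  sum by its next term.\<close>

lemma prob_small_diameter_le:
  assumes "\<beta> > 0" "M \<ge> 2" "N > 0" and M: "4 * max 1 \<beta> * (\<Sum>k=1..<N. real k powr (- s)) \<le> M"
  shows "measure_pmf.prob (lrp_field s \<beta> N) {w. graph_diameter {..<N} (edges N w) \<le> n} \<le>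
    M ^ Suc n / real N"
proof -
  let ?p = "\<lambda>(x, y). edge_prob s \<beta> N x y"
  define X where "X w = (\<Sum>k\<le>n. \<Sum>xs\<in>simple_paths N k. indicator {w. \<forall>e\<in>path_edges xs. w e} w :: real)" for w
  have p: "0 \<le> ?p e \<and> ?p e \<le> 1" for e
    using edge_prob_bounds[OF assms(1)] by (auto split: prod.splits)
  have "measure_pmf.prob (lrp_field s \<beta> N) {w. graph_diameter {..<N} (edges N w) \<le> n} \<le>
      measure_pmf.prob (lrp_field s \<beta> N) {w. X w \<ge> real N}"
  proof (rule prob_le_cong_set_pmf)
    fix w assume w: "w \<in> set_pmf (lrp_field s \<beta> N)" and D: "graph_diameter {..<N} (edges N w) \<le> n"
    let ?G = "\<lambda>k. {xs \<in> simple_paths N k. \<forall>e\<in>path_edges xs. w e}"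
    have "{..<N} \<subseteq> hd ` (\<Union>k\<le>n. ?G k)"
    proof
      fix z assume "z \<in> {..<N}"
      then have z: "z < N" by simp
      have "graph_dist (edges N w) z 0 \<le> n"
        using D z assms(3) by (simp add: lrp_diameter_le_iff)
      then show "z \<in> hd ` (\<Union>k\<le>n. ?G k)"
        using shortest_path_simple[OF reach_lrp[OF w] z refl] by fastforce
    qed
    then have "card {..<N} \<le> card (\<Union>k\<le>n. ?G k)"
      by (rule surj_card_le[rotated]) auto
    also have "\<dots> \<le> (\<Sum>k\<le>n. card (?G k))"
      by (rule card_UN_le) auto
    finally have "real N \<le> (\<Sum>k\<le>n. real (card (?G k)))"
      by (simp flip: of_nat_sum)
    also have "\<dots> = X w"
      unfolding X_def by (intro sum.cong refl) (simp add: sum.If_cases indicator_def Int_def)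
    finally show "X w \<ge> real N" .
  qed
  also have "\<dots> \<le> measure_pmf.expectation (lrp_field s \<beta> N) X / real N"
    unfolding lrp_field_def using assms(3)
    by (intro markov_bern_field) (auto simp: X_def intro!: sum_nonneg)
  also have "measure_pmf.expectation (lrp_field s \<beta> N) X =
      (\<Sum>k\<le>n. \<Sum>xs\<in>simple_paths N k. measure_pmf.prob (lrp_field s \<beta> N) {w. \<forall>e\<in>path_edges xs. w e})"
    unfolding X_def[abs_def] lrp_field_def
    by (subst Bochner_Integration.integral_sum, simp)+ simp
  also have "\<dots> = (\<Sum>k\<le>n. \<Sum>xs\<in>simple_paths N k. prod ?p (path_edges xs))"
    unfolding lrp_field_def using p
    by (intro sum.cong refl prob_all_open path_edges_subset) (auto simp: simple_paths_def)
  also have "\<dots> \<le> (\<Sum>k\<le>n. M ^ k)"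
    using p assms(2) order_trans[OF mean_degree_le[OF assms(1)] M]
    by (intro sum_mono sum_simple_paths_le) auto
  also have "\<dots> \<le> M ^ Suc n"
  proof (induction n)
    case (Suc n)
    then have "(\<Sum>k\<le>Suc n. M ^ k) \<le> 2 * M ^ Suc n" by simp
    also have "\<dots> \<le> M * M ^ Suc n"
      using assms(2) by (intro mult_right_mono) auto
    finally show ?case by simp
  qed (use assms in auto)
  finally show ?thesis
    using assms(3) by (simp add: divide_right_mono)
qed

theorem lrp_diameter_log_lower:
  assumes "s > 1" "\<beta> > 0"
  shows "\<exists>C::real. C > 0 \<and> (\<lambda>N. measure_pmf.prob (lrp_graph s \<beta> N)
    {E. real (graph_diameter {..<N} E) < C * ln (real N)}) \<longlonglongrightarrow> 0"
proof -
  have summ: "summable (\<lambda>k. real k powr (- s))"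
    using assms by (simp add: summable_real_powr_iff)
  define M where "M = max 2 (4 * max 1 \<beta> * (\<Sum>k. real k powr (- s)))"
  have M: "4 * max 1 \<beta> * (\<Sum>k=1..<N. real k powr (- s)) \<le> M" for N
  proof -
    have "(\<Sum>k=1..<N. real k powr (- s)) \<le> (\<Sum>k. real k powr (- s))"
      using summ by (intro sum_le_suminf) auto
    then have "4 * max 1 \<beta> * (\<Sum>k=1..<N. real k powr (- s)) \<le> 4 * max 1 \<beta> * (\<Sum>k. real k powr (- s))"
      by (intro mult_left_mono) auto
    then show ?thesis by (simp add: M_def)
  qed
  have M2: "M \<ge> 2" by (simp add: M_def)
  \<comment> \<open>Then \<open>M powr (C * ln N) = N powr (1/2)\<close>, so the expected number of
    paths stays below \<open>N\<close> by a factor of order \<open>N powr (1/2)\<close>.\<close>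
  define C where "C = 1 / (2 * ln M)"
  have C: "C > 0" using M2 by (simp add: C_def)
  have lim: "(\<lambda>N. M * real N powr (1/2) / real N) \<longlonglongrightarrow> 0"
    by real_asymp
  have "measure_pmf.prob (lrp_graph s \<beta> N) {E. real (graph_diameter {..<N} E) < C * ln (real N)} \<le>
      M * real N powr (1/2) / real N" if N: "N \<ge> 1" for N
  proof -
    define n where "n = nat \<lfloor>C * ln (real N)\<rfloor>"
    have n: "real n \<le> C * ln (real N)"
      using C N by (simp add: n_def)
    have "measure_pmf.prob (lrp_graph s \<beta> N) {E. real (graph_diameter {..<N} E) < C * ln (real N)} \<le>
        measure_pmf.prob (lrp_graph s \<beta> N) {E. graph_diameter {..<N} E \<le> n}"
      by (rule prob_le_cong_set_pmf) (simp add: n_def le_nat_floor)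
    also have "\<dots> \<le> M ^ Suc n / real N"
      unfolding prob_lrp_graph using assms M2 M N by (intro prob_small_diameter_le) auto
    also have "\<dots> \<le> M * real N powr (1/2) / real N"
    proof -
      have "M ^ n = M powr real n"
        using M2 by (simp add: powr_realpow)
      also have "\<dots> \<le> M powr (C * ln (real N))"
        using M2 n by (intro powr_mono) auto
      also have "\<dots> = real N powr (1/2)"
        using M2 N by (simp add: powr_def C_def)
      finally show ?thesis
        using M2 by (intro divide_right_mono) (auto simp: mult_left_mono)
    qed
    finally show ?thesis .
  qed
  then have "\<forall>\<^sub>F N in sequentially. measure_pmf.prob (lrp_graph s \<beta> N)
      {E. real (graph_diameter {..<N} E) < C * ln (real N)} \<le> M * real N powr (1/2) / real N"
    using eventually_ge_at_top[of 1] by (rule eventually_mono[rotated])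
  from tendsto_0_le[OF _ this lim] C show ?thesis
    by (intro exI[of _ C]) simp
qed

subsection \<open>The four regimes\<close>

theorem theorem3p1:
  fixes s \<beta> :: real
  assumes "s > 0" and "\<beta> > 0"
  shows
    "(s > 2 \<longrightarrow>
        (\<exists>C::real. C > 0 \<and>
           (\<lambda>N. measure_pmf.prob (lrp_graph s \<beta> N)
                  {E. real (graph_diameter {..<N} E) < C * real N}) \<longlonglongrightarrow> 0) \<and>
        (\<exists>\<eta>::real. 0 < \<eta> \<and> \<eta> \<le> 1 \<and>
           weak_conv_m
             (\<lambda>N. distr (measure_pmf (lrp_graph s \<beta> N)) borel
                    (\<lambda>E. real (graph_diameter {..<N} E) / real N))
             (return borel \<eta>))) \<and>
     (s < 1 \<longrightarrow>
        (\<exists>C::real.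
           (\<lambda>N. measure_pmf.prob (lrp_graph s \<beta> N)
                  {E. real (graph_diameter {..<N} E) > C}) \<longlonglongrightarrow> 0)) \<and>
     (1 < s \<and> s < 2 \<longrightarrow>
        (\<exists>\<delta>::real.
           (\<lambda>N. measure_pmf.prob (lrp_graph s \<beta> N)
                  {E. real (graph_diameter {..<N} E) > ln (real N) powr \<delta>}) \<longlonglongrightarrow> 0)) \<and>
     (1 < s \<and> s < 2 \<longrightarrow>
        (\<exists>C::real. C > 0 \<and>
           (\<lambda>N. measure_pmf.prob (lrp_graph s \<beta> N)
                  {E. real (graph_diameter {..<N} E) < C * ln (real N)}) \<longlonglongrightarrow> 0))"
proof (intro conjI impI)
  assume "s > 2"
  then obtain \<eta> where \<eta>: "0 < \<eta>" "\<eta> \<le> 1"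
    "weak_conv_m (\<lambda>N. distr (measure_pmf (lrp_graph s \<beta> N)) borel
      (\<lambda>E. real (graph_diameter {..<N} E) / real N)) (return borel \<eta>)"
    "(\<lambda>N. measure_pmf.prob (lrp_graph s \<beta> N)
      {E. real (graph_diameter {..<N} E) < \<eta> / 2 * real N}) \<longlonglongrightarrow> 0"
    using lrp_diameter_weak_conv[OF assms(2)] by blast
  show "\<exists>C::real. C > 0 \<and>
      (\<lambda>N. measure_pmf.prob (lrp_graph s \<beta> N)
        {E. real (graph_diameter {..<N} E) < C * real N}) \<longlonglongrightarrow> 0"
    using \<eta>(1,4) by (intro exI[of _ "\<eta> / 2"]) simp
  show "\<exists>\<eta>::real. 0 < \<eta> \<and> \<eta> \<le> 1 \<and>
      weak_conv_m (\<lambda>N. distr (measure_pmf (lrp_graph s \<beta> N)) borel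
        (\<lambda>E. real (graph_diameter {..<N} E) / real N)) (return borel \<eta>)"
    using \<eta> by (intro exI[of _ \<eta>]) simp
next
  assume "s < 1"
  then show "\<exists>C::real. (\<lambda>N. measure_pmf.prob (lrp_graph s \<beta> N)
      {E. real (graph_diameter {..<N} E) > C}) \<longlonglongrightarrow> 0"
    using assms by (intro lrp_diameter_bounded)
next
  assume "1 < s \<and> s < 2"
  then show "\<exists>\<delta>::real. (\<lambda>N. measure_pmf.prob (lrp_graph s \<beta> N)
      {E. real (graph_diameter {..<N} E) > ln (real N) powr \<delta>}) \<longlonglongrightarrow> 0"
    using assms by (intro lrp_diameter_polylog) auto
next
  assume "1 < s \<and> s < 2"
  then show "\<exists>C::real. C > 0 \<and> (\<lambda>N. measure_pmf.prob (lrp_graph s \<beta> N)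
      {E. real (graph_diameter {..<N} E) < C * ln (real N)}) \<longlonglongrightarrow> 0"
    using assms by (intro lrp_diameter_log_lower) auto
qed

end
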